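(* For all integers $k\ge1$ and $n\ge0$, $$e_4(11^kn+\delta_{11,k})\equiv0\pmod{11^k}.$$
   Context: $q=e^{2\pi i\tau}$, $(q;q)_\infty=\prod_{n\ge1}(1-q^n)$, $E_4(\tau)=1+240\sum_{n\ge1}\sigma_3(n)q^n$ with $\sigma_3(n)=\sum_{d\mid n}d^3$. The numbers $e_4(n)$ are defined by $\sum_{n\ge0}e_4(n)q^n=E_4(\tau)/(q;q)_\infty$. For a prime $\ell\ge5$ and $k\ge1$, $\delta_{\ell,k}$ is the integer with $0<\delta_{\ell,k}<\ell^k$ and $24\delta_{\ell,k}\equiv1\pmod{\ell^k}$. *)

theory Defs
  imports "HOL-Analysis.Analysis" "HOL-Number_Theory.Number_Theory"
begin

text \<open>
  All $q$-series are formal power series in $q$ = \<^term>\<open>fps_X\<close> with integer coefficients.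
\<close>

definition sigma3 :: "nat \<Rightarrow> nat" where
  "sigma3 n = (\<Sum>d | d dvd n. d ^ 3)"

definition E4 :: "int fps" where
  "E4 = 1 + 240 * Abs_fps (\<lambda>n. if n \<ge> 1 then int (sigma3 n) else 0)"

text \<open>
  $(q;q)_\infty$, with the product index shifted to start at 0; the limit is taken in the
  $q$-adic topology of \<^typ>\<open>int fps\<close>.
\<close>

definition qq_inf :: "int fps" where
  "qq_inf = (\<Prod>n. 1 - fps_X ^ Suc n)"

text \<open>
  Since \<^typ>\<open>int\<close> is not a field, \<^const>\<open>inverse\<close> is not available on \<^typ>\<open>int fps\<close>. The
  constant coefficient of $(q;q)_\infty$ is 1, so its inverse is the right inverse with
  constant coefficient 1. See \<open>qq_inf_nth_0\<close> and \<open>e4_gen_fun\<close> below.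
\<close>

definition e4 :: "nat \<Rightarrow> int" where
  "e4 n = fps_nth (E4 * fps_right_inverse qq_inf 1) n"

definition delta :: "nat \<Rightarrow> nat \<Rightarrow> nat" where
  "delta l k = (THE d. 0 < d \<and> d < l ^ k \<and> [24 * d = 1] (mod l ^ k))"

lemma nth_one_minus_X_power_mult:
  fixes f :: "int fps"
  assumes "n < m"
  shows "fps_nth (f * (1 - fps_X ^ m)) n = fps_nth f n"
  using assms by (simp add: right_diff_distrib fps_X_power_mult_right_nth)

lemma qq_inf_has_prod: "(\<lambda>n. 1 - fps_X ^ Suc n :: int fps) has_prod qq_inf"
  and qq_inf_nth_0: "fps_nth qq_inf 0 = 1"
proof -
  define P where "P = (\<lambda>m. \<Prod>i\<le>m. 1 - fps_X ^ Suc i :: int fps)"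
  define L where "L = Abs_fps (\<lambda>n. fps_nth (P n) n)"
  have P_Suc: "fps_nth (P (Suc m)) n = fps_nth (P m) n" if "n \<le> m" for m n
  proof -
    have "P (Suc m) = P m * (1 - fps_X ^ Suc (Suc m))"
      by (simp add: P_def)
    with that nth_one_minus_X_power_mult[of n "Suc (Suc m)" "P m"] show ?thesis
      by simp
  qed
  have stable: "fps_nth (P m) n = fps_nth L n" if "n \<le> m" for m n
    using that
  proof (induction m rule: dec_induct)
    case base
    show ?case by (simp add: L_def)
  next
    case (step m)
    with P_Suc show ?case by simp
  qed
  have lim: "P \<longlonglongrightarrow> L"
    by (rule tendsto_fpsI) (use stable in \<open>auto simp: eventually_sequentially\<close>)
  have L0: "fps_nth L 0 = 1"
    by (simp add: L_def P_def)
  hence "L \<noteq> 0" by auto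
  with lim have "(\<lambda>n. 1 - fps_X ^ Suc n :: int fps) has_prod L"
    by (simp add: has_prod_def raw_has_prod_def P_def)
  moreover from has_prod_unique[OF this] have "L = qq_inf"
    by (simp add: qq_inf_def)
  ultimately show "(\<lambda>n. 1 - fps_X ^ Suc n :: int fps) has_prod qq_inf"
    and "fps_nth qq_inf 0 = 1"
    using L0 by simp_all
qed

lemma e4_gen_fun: "Abs_fps e4 * qq_inf = E4"
proof -
  have "Abs_fps e4 = E4 * fps_right_inverse qq_inf 1"
    by (simp add: fps_eq_iff e4_def)
  moreover have "qq_inf * fps_right_inverse qq_inf 1 = 1"
    by (rule fps_right_inverse) (simp add: qq_inf_nth_0)
  ultimately show ?thesis
    by (simp add: mult_ac)
qed

lemma delta_unique_existence:
  assumes "prime l" "l \<ge> 5" "k \<ge> 1"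
  shows "\<exists>!d::nat. 0 < d \<and> d < l ^ k \<and> [24 * d = 1] (mod l ^ k)"
proof -
  have "\<not> l dvd 24"
  proof
    assume "l dvd 24"
    hence "l dvd 2 ^ 3 * 3" by simp
    hence "l dvd 2 \<or> l dvd 3"
      using assms(1) prime_dvd_mult_iff prime_dvd_power by blast
    with assms(2) show False
      by (auto dest: dvd_imp_le)
  qed
  with assms(1) have cop: "coprime 24 (l ^ k)"
    by (metis coprime_commute coprime_power_right_iff prime_imp_coprime)
  have gt: "l ^ k > 1"
    using assms by (intro one_less_power) auto
  from cong_solve_coprime_nat[OF cop] obtain x where x: "[24 * x = 1] (mod l ^ k)"
    by auto
  define d where "d = x mod l ^ k"
  have d: "[24 * d = 1] (mod l ^ k)"
    using x by (simp add: d_def cong_def mod_mult_right_eq)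
  have "d \<noteq> 0"
  proof
    assume "d = 0"
    with d have "0 mod l ^ k = 1 mod l ^ k"
      by (simp only: cong_def mult_0_right)
    with gt show False by (simp only: mod_0 mod_less)
  qed
  moreover have "d < l ^ k"
    unfolding d_def by (rule mod_less_divisor) (use gt in linarith)
  moreover have "d' = d" if "d' < l ^ k" "[24 * d' = 1] (mod l ^ k)" for d'
  proof -
    have "[24 * d' = 24 * d] (mod l ^ k)"
      using that(2) d by (metis cong_sym cong_trans)
    hence "[d' = d] (mod l ^ k)"
      using cop by (simp add: cong_mult_lcancel_nat)
    with that(1) \<open>d < l ^ k\<close> show ?thesis
      by (simp add: cong_def)
  qed
  ultimately show ?thesis
    using d by blast
qed

end

theory Submission
  imports Defs "HOL-Complex_Analysis.Complex_Analysis"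
begin

text \<open>
  The function \<open>E\<^sub>4 / \<eta> = \<Sum> e\<^sub>4(j) q\<^sup>j\<^sup>-\<^sup>1\<^sup>/\<^sup>2\<^sup>4\<close> has weight \<open>7/2\<close> and the multiplier of \<open>\<eta>\<^sup>-\<^sup>1\<close>. Such forms are
  preserved by a Hecke operator of index 121, which sends a coefficient sequence \<open>a\<close> to
  \<open>a(121 j - 5) + 121 m(j) a(j) + 11\<^sup>5 a((j + 5) / 121)\<close> with integers \<open>m(j)\<close>; modularity of the image
  under \<open>\<tau> \<mapsto> -1/\<tau>\<close> is a computation with \<open>\<eta>\<close>-quotients on the 11-isogenies. After multiplication
  by \<open>\<eta>\<close> one is in weight 4, where there are no cusp forms, so that a form is determined by its
  coefficients with \<open>j \<le> 0\<close> and a divisor of these divides all coefficients. Starting from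
  \<open>E\<^sub>4 / \<eta>\<close>, whose only polar term is \<open>j = 0\<close>, each application of the operator makes the polar
  coefficients divisible by another factor 121. Hence \<open>11\<^sup>2\<^sup>s\<close> divides the \<open>s\<close>-th iterate, which modulo
  \<open>11\<^sup>2\<^sup>s\<^sup>+\<^sup>1\<close> is moreover a multiple of \<open>E\<^sub>4 / \<eta>\<close>. Solving the recursion for \<open>a(121 j - 5)\<close> gives the
  even powers of 11; the odd ones need in addition \<open>e\<^sub>4(11 n + 6) \<equiv> 0\<close> modulo 11, which follows in
  the same way from \<open>T\<^sub>1\<^sub>1\<close> on \<open>E\<^sub>4 \<Delta>\<^sup>5\<close> and five numerical values.

  The transformation laws of \<open>E\<^sub>4\<close> and \<open>\<eta>\<close> are read off from the Taylor expansion of the logarithmic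
  derivative of \<open>\<theta>\<^sub>1\<close>, whose own transformation law holds because the defect is an odd
  entire elliptic function, hence zero.
\<close>

text \<open>In weight 3 + 1/2 Hecke operators exist only for square index, which forces 121 instead
  of 11 and leaves the odd powers of 11 to a separate argument.

  The obstacle is that the iterates have poles of unbounded order: the coefficient at j = 0 is moved
  to j = -5, then to j = -610 and so on. In the variable 24 j - 1 the operator acts through
  multiplication and division by 121, and each deeper level of poles is reached with the factor
  \<open>11 ^ 5\<close>. Three of these five powers are kept as a reserve, two are the gain that
  every step must show. Returning one level up releases the reserve of three, which is more than the
  required two.

  All forms live on the full modular group; the number 11 enters the analysis only through the
  action of the inversion on isogenies of degree 11 and 121. Divisibility is kept over the integers
  throughout, since the comparison forms \<open>E4 ^ (3 * N + 1) / \<Delta> ^ N\<close> have leading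
  coefficient 1.\<close>

section \<open>The exponential and the upper half-plane\<close>

definition ex :: "complex \<Rightarrow> complex" where
  "ex z = exp (2 * of_real pi * \<i> * z)"

lemma ex_0 [simp]: "ex 0 = 1"
  by (simp add: ex_def)

lemma ex_nonzero [simp]: "ex z \<noteq> 0"
  by (simp add: ex_def)

lemma ex_add: "ex (a + b) = ex a * ex b"
  by (simp add: ex_def ring_distribs exp_add)

lemma ex_minus: "ex (- a) = inverse (ex a)"
  by (simp add: ex_def exp_minus)

lemma ex_diff: "ex (a - b) = ex a / ex b"
  by (simp add: ex_def ring_distribs exp_diff)

lemma ex_of_int [simp]: "ex (of_int n) = 1"
  unfolding ex_def using exp_integer_2pi[of "of_int n"] by (simp add: mult_ac)

lemma ex_of_nat [simp]: "ex (of_nat n) = 1"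
  using ex_of_int[of "int n"] by simp

lemma ex_1 [simp]: "ex 1 = 1"
  using ex_of_int[of 1] by simp

lemma ex_mult_nat: "ex (of_nat n * z) = ex z ^ n"
  by (simp add: ex_def exp_of_nat_mult [symmetric] mult_ac)

lemma ex_add_int: "ex (z + of_int n) = ex z"
  by (simp add: ex_add)

lemma ex_eqI: "a - b \<in> \<int> \<Longrightarrow> ex a = ex b"
  by (metis Ints_cases add.commute diff_add_cancel ex_add_int)

lemma norm_ex: "norm (ex z) = exp (- 2 * pi * Im z)"
  by (simp add: ex_def)

lemma norm_ex_less_1_iff: "norm (ex z) < 1 \<longleftrightarrow> Im z > 0"
  by (simp add: norm_ex zero_less_mult_iff)

lemma has_field_derivative_ex [derivative_intros]:
  "(f has_field_derivative f') (at x within A) \<Longrightarrow>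
     ((\<lambda>x. ex (f x)) has_field_derivative (2 * of_real pi * \<i> * f' * ex (f x))) (at x within A)"
  unfolding ex_def by (auto intro!: derivative_eq_intros)

lemma holomorphic_on_ex [holomorphic_intros]:
  "f holomorphic_on A \<Longrightarrow> (\<lambda>x. ex (f x)) holomorphic_on A"
  unfolding ex_def by (intro holomorphic_intros)

lemma continuous_on_ex [continuous_intros]:
  "continuous_on A f \<Longrightarrow> continuous_on A (\<lambda>x. ex (f x))"
  unfolding ex_def by (intro continuous_intros)

definition uhp :: "complex set" where
  "uhp = {\<tau>. Im \<tau> > 0}"

lemma in_uhp_iff [simp]: "\<tau> \<in> uhp \<longleftrightarrow> Im \<tau> > 0"
  by (simp add: uhp_def)

lemma open_uhp: "open uhp"
  unfolding uhp_def by (rule open_halfspace_Im_gt)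

lemma convex_uhp: "convex uhp"
  unfolding uhp_def by (rule convex_halfspace_Im_gt)

lemma connected_uhp: "connected uhp"
  by (rule convex_connected[OF convex_uhp])

lemma Im_minus_inverse: "Im (- (1 / \<tau>)) = Im \<tau> / (norm \<tau>)\<^sup>2"
  by (simp add: Im_divide cmod_power2)

lemma Im_minus_inverse_pos: "Im \<tau> > 0 \<Longrightarrow> Im (- (1 / \<tau>)) > 0"
  unfolding Im_minus_inverse by (auto simp: complex_eq_iff)

section \<open>Lambert series\<close>

definition fps_theta :: "complex fps \<Rightarrow> complex fps" where
  "fps_theta F = fps_X * fps_deriv F"

lemma fps_nth_theta [simp]: "fps_nth (fps_theta F) n = of_nat n * fps_nth F n"
  by (cases n) (simp_all add: fps_theta_def)

lemma fps_nth_theta_funpow: "fps_nth ((fps_theta ^^ k) F) n = of_nat n ^ k * fps_nth F n"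
  by (induction k) (simp_all add: mult_ac)

lemma fps_conv_radius_theta: "fps_conv_radius (fps_theta F) \<ge> fps_conv_radius F"
  using fps_conv_radius_mult[of fps_X "fps_deriv F"] fps_conv_radius_deriv[of F]
  by (simp add: fps_theta_def order_trans)

lemma fps_conv_radius_theta_funpow: "fps_conv_radius ((fps_theta ^^ k) F) \<ge> fps_conv_radius F"
  by (induction k) (use fps_conv_radius_theta order_trans in auto)

lemma has_field_derivative_eval_fps_ex:
  assumes "norm (ex z) < fps_conv_radius F"
  shows "((\<lambda>z. eval_fps F (ex z)) has_field_derivative
           2 * of_real pi * \<i> * eval_fps (fps_theta F) (ex z)) (at z)"
proof -
  have "eval_fps (fps_theta F) (ex z) = ex z * eval_fps (fps_deriv F) (ex z)"
    unfolding fps_theta_def using assms fps_conv_radius_deriv[of F]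
    by (subst eval_fps_mult) (auto intro: less_le_trans)
  thus ?thesis
    using DERIV_chain2[OF has_field_derivative_eval_fps[OF assms]
            has_field_derivative_ex[OF DERIV_ident]]
    by (simp add: mult_ac)
qed

text \<open>A series in a second variable w, meant to be evaluated at \<open>w = ex z\<close>. At m
  = 0 the division by zero gives the coefficient 0, so the sum starts at m = 1.\<close>

definition lambert_fps :: "complex \<Rightarrow> complex fps" where
  "lambert_fps q = Abs_fps (\<lambda>m. q ^ m / (1 - q ^ m))"

text \<open>For n = 0 every number is a divisor; the sum over this infinite set is 0, so there is no
  constant term.\<close>

definition divisor_fps :: "nat \<Rightarrow> complex fps" where
  "divisor_fps k = Abs_fps (\<lambda>n. of_nat (\<Sum>d | d dvd n. d ^ k))"

lemma conv_radius_geI_bound: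
  fixes f g :: "nat \<Rightarrow> complex"
  assumes "\<And>n. norm (f n) \<le> norm (g n)"
  shows "conv_radius f \<ge> conv_radius g"
proof (rule conv_radius_geI_ex')
  fix r :: real assume r: "0 < r" "ereal r < conv_radius g"
  have "summable (\<lambda>n. norm (g n * of_real r ^ n))"
    using r by (intro abs_summable_in_conv_radius) auto
  thus "summable (\<lambda>n. f n * of_real r ^ n)"
    by (rule summable_comparison_test'[of _ 0])
       (use assms in \<open>auto simp: norm_mult intro!: mult_right_mono\<close>)
qed

lemma fps_conv_radius_lambert:
  assumes "norm q < 1" "q \<noteq> 0"
  shows "fps_conv_radius (lambert_fps q) \<ge> inverse (norm q)" "inverse (norm q) > 1"
proof -
  show "inverse (norm q) > 1"
    using assms by (simp add: one_less_inverse)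
  have "norm (q ^ m / (1 - q ^ m)) \<le> norm (q ^ m / of_real (1 - norm q))" for m
  proof (cases "m = 0")
    case False
    hence "norm q ^ m \<le> norm q ^ 1"
      using assms by (intro power_decreasing) auto
    hence "1 - norm q \<le> norm (1 - q ^ m)"
      using norm_triangle_ineq2[of 1 "q ^ m"] by (simp add: norm_power)
    thus ?thesis
      using assms by (auto simp: norm_divide norm_power simp del: of_real_diff intro!: divide_left_mono mult_pos_pos)
  qed auto
  hence "conv_radius (\<lambda>m. q ^ m / (1 - q ^ m)) \<ge> conv_radius (\<lambda>m. q ^ m / of_real (1 - norm q))"
    by (rule conv_radius_geI_bound)
  moreover have "conv_radius (\<lambda>m. q ^ m / of_real (1 - norm q)) \<ge> inverse (norm q)"
  proof (rule conv_radius_geI_ex')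
    fix r :: real assume r: "0 < r" "ereal r < ereal (inverse (norm q))"
    hence "summable (\<lambda>n. (q * of_real r) ^ n)"
      using assms by (intro summable_geometric) (auto simp: norm_mult field_simps)
    thus "summable (\<lambda>n. q ^ n / of_real (1 - norm q) * of_real r ^ n)"
      by (auto simp: power_mult_distrib dest: summable_divide)
  qed
  ultimately show "fps_conv_radius (lambert_fps q) \<ge> inverse (norm q)"
    unfolding fps_conv_radius_def lambert_fps_def by (simp add: order_trans)
qed

lemma fps_conv_radius_lambert_gt_1:
  assumes "norm q < 1" "q \<noteq> 0"
  shows "fps_conv_radius ((fps_theta ^^ k) (lambert_fps q)) > 1"
proof -
  have "1 < ereal (inverse (norm q))"
    using fps_conv_radius_lambert(2)[OF assms] by (simp add: one_ereal_def)
  also have "\<dots> \<le> fps_conv_radius (lambert_fps q)"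
    by (rule fps_conv_radius_lambert(1)[OF assms])
  also have "\<dots> \<le> fps_conv_radius ((fps_theta ^^ k) (lambert_fps q))"
    by (rule fps_conv_radius_theta_funpow)
  finally show ?thesis .
qed

lemma divisor_sum_le: "(\<Sum>d | d dvd n. d ^ k) \<le> (n::nat) ^ Suc k"
proof (cases "n = 0")
  case False
  have "(\<Sum>d | d dvd n. d ^ k) \<le> (\<Sum>d | d dvd n. n ^ k)"
    by (intro sum_mono power_mono) (use False in \<open>auto dest: dvd_imp_le\<close>)
  also have "\<dots> = card {d. d dvd n} * n ^ k"
    by simp
  also have "card {d. d dvd n} \<le> card {1..n}"
    by (intro card_mono) (use False in \<open>auto dest: dvd_imp_le intro!: Suc_leI Nat.gr0I\<close>)
  finally show ?thesis by simp
qed (auto simp: power_0_left)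

lemma fps_conv_radius_divisor: "fps_conv_radius (divisor_fps k) \<ge> 1"
proof -
  \<comment> \<open>The bound n^(k+1) for divisor sums is the n-th coefficient of this iterated
    derivative of the geometric series.\<close>
  define G where "G = (fps_theta ^^ Suc k) (Abs_fps (\<lambda>_. 1))"
  have "conv_radius (fps_nth (divisor_fps k)) \<ge> conv_radius (fps_nth G)"
  proof (rule conv_radius_geI_bound)
    fix n
    have "norm (fps_nth (divisor_fps k) n) = real (\<Sum>d | d dvd n. d ^ k)"
      unfolding divisor_fps_def fps_nth_Abs_fps norm_of_nat ..
    also have "\<dots> \<le> real (n ^ Suc k)"
      using divisor_sum_le[of k n] of_nat_le_iff by blast
    also have "\<dots> = norm (fps_nth G n)"
      unfolding G_def fps_nth_theta_funpow by (simp add: norm_mult norm_power)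
    finally show "norm (fps_nth (divisor_fps k) n) \<le> norm (fps_nth G n)" .
  qed
  moreover have "conv_radius (\<lambda>_::nat. 1 :: complex) \<ge> 1"
    by (rule conv_radius_geI_ex') (auto intro!: summable_geometric)
  hence "fps_conv_radius G \<ge> 1"
    unfolding G_def using fps_conv_radius_theta_funpow[where F = "Abs_fps (\<lambda>_. 1)" and k = "Suc k"]
    by (simp add: fps_conv_radius_def del: funpow.simps)
  ultimately show ?thesis
    unfolding fps_conv_radius_def by order
qed

text \<open>Both sides are the double sum of \<open>m ^ k * q ^ (m * j)\<close> over m, j \<ge> 1:
  summing over j first gives geometric series, collecting the terms with \<open>m * j = n\<close>
  gives divisor sums. Absolute convergence comes from the same series at the real point
  \<open>norm q\<close>.\<close>

lemma lambert_divisor: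
  assumes "norm q < 1" "q \<noteq> 0"
  shows "eval_fps ((fps_theta ^^ k) (lambert_fps q)) 1 = eval_fps (divisor_fps k) q"
proof -
  define h where "h = (\<lambda>(m, j). of_nat m ^ k * q ^ (m * j) :: complex)"
  define B where "B = {1::nat..} \<times> {1::nat..}"
  have geo: "((\<lambda>j. of_nat m ^ k * q ^ (m * j)) has_sum of_nat m ^ k * (q ^ m / (1 - q ^ m))) {1..}"
    and geo_norm: "((\<lambda>j. norm (of_nat m ^ k * q ^ (m * j))) has_sum (real m ^ k * (norm q ^ m / (1 - norm q ^ m)))) {1..}"
    if m: "m \<ge> 1" for m
  proof -
    have lt: "norm (q ^ m) < 1"
      using assms m by (simp add: norm_power power_less_one_iff)
    have *: "((\<lambda>j. x ^ (m * j)) has_sum (x ^ m / (1 - x ^ m))) {1..}"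
      if "norm (x ^ m) < 1" for x :: "'b :: {real_normed_field, banach}"
    proof -
      have "((\<lambda>j. (x ^ m) ^ j) has_sum 1 / (1 - x ^ m)) UNIV"
        using that geometric_sums[OF that]
        by (intro norm_summable_imp_has_sum) (auto simp: norm_power)
      hence "((\<lambda>j. (x ^ m) * (x ^ m) ^ j) has_sum (x ^ m * (1 / (1 - x ^ m)))) UNIV"
        by (rule has_sum_cmult_right)
      thus ?thesis
        by (rule has_sum_reindex_bij_witness[of UNIV "\<lambda>j. j - 1" Suc, THEN iffD1, rotated -1])
           (auto simp: power_mult power_add)
    qed
    show "((\<lambda>j. of_nat m ^ k * q ^ (m * j)) has_sum of_nat m ^ k * (q ^ m / (1 - q ^ m))) {1..}"
      by (rule has_sum_cmult_right[OF *[OF lt]])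
    show "((\<lambda>j. norm (of_nat m ^ k * q ^ (m * j))) has_sum (real m ^ k * (norm q ^ m / (1 - norm q ^ m)))) {1..}"
      using has_sum_cmult_right[OF *[of "norm q"], of "real m ^ k"] lt
      by (simp add: norm_mult norm_power)
  qed
  have sum_norm: "summable (\<lambda>m. norm (of_nat m ^ k * (q ^ m / (1 - q ^ m))))"
    and "summable (\<lambda>m. norm (of_nat m ^ k * (of_real (norm q) ^ m / (1 - of_real (norm q) ^ m)) :: complex))"
    using norm_summable_fps[of 1 "(fps_theta ^^ k) (lambert_fps q)"]
      norm_summable_fps[of 1 "(fps_theta ^^ k) (lambert_fps (of_real (norm q)))"]
      fps_conv_radius_lambert_gt_1[of q k] fps_conv_radius_lambert_gt_1[of "of_real (norm q)" k] assms
    by (simp_all add: fps_nth_theta_funpow lambert_fps_def one_ereal_def)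
  moreover have "norm (of_nat m ^ k * (of_real (norm q) ^ m / (1 - of_real (norm q) ^ m)) :: complex) =
        real m ^ k * (norm q ^ m / (1 - norm q ^ m))" for m
  proof -
    have "(of_nat m ^ k * (of_real (norm q) ^ m / (1 - of_real (norm q) ^ m)) :: complex) =
        of_real (real m ^ k * (norm q ^ m / (1 - norm q ^ m)))" by simp
    moreover have "real m ^ k * (norm q ^ m / (1 - norm q ^ m)) \<ge> 0"
      using assms by (auto intro!: mult_nonneg_nonneg divide_nonneg_nonneg simp: power_le_one)
    ultimately show ?thesis by (simp only: norm_of_real abs_of_nonneg)
  qed
  ultimately have sum_norm': "summable (\<lambda>m. real m ^ k * (norm q ^ m / (1 - norm q ^ m)))"
    by simp
  have pos: "real m ^ k * (norm q ^ m / (1 - norm q ^ m)) \<ge> 0" for m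
    using assms by (auto intro!: mult_nonneg_nonneg divide_nonneg_nonneg simp: power_le_one)
  have "(\<lambda>x. norm (h x)) summable_on B"
    unfolding B_def
  proof (subst Infinite_Sum.abs_summable_on_Sigma_iff, intro conjI ballI)
    fix m assume "m \<in> {1::nat..}"
    thus "(\<lambda>j. norm (h (m, j))) summable_on {1..}"
      using has_sum_imp_summable[OF geo_norm[of m]] by (simp add: h_def)
  next
    have "(\<lambda>m. real m ^ k * (norm q ^ m / (1 - norm q ^ m))) summable_on {1..}"
      by (rule summable_on_subset_banach[of _ UNIV])
         (auto intro!: norm_summable_imp_summable_on simp only: real_norm_def abs_of_nonneg[OF pos] sum_norm')
    hence "(\<lambda>m. infsum (\<lambda>j. norm (h (m, j))) {1..}) summable_on {1..}"
      by (rule summable_on_cong[THEN iffD1, rotated])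
         (simp only: h_def prod.case atLeast_iff infsumI[OF geo_norm])
    thus "(\<lambda>m. norm (infsum (\<lambda>j. norm (h (m, j))) {1..})) summable_on {1..}"
      by (simp add: infsum_nonneg)
  qed
  hence summ: "h summable_on B"
    by (rule abs_summable_summable)
  then obtain S where S: "(h has_sum S) B"
    by (auto simp: summable_on_def)
  have "((\<lambda>m. of_nat m ^ k * (q ^ m / (1 - q ^ m))) has_sum S) {1..}"
    using S unfolding B_def
    by (rule has_sum_SigmaD) (use geo in \<open>auto simp: h_def\<close>)
  hence "((\<lambda>m. of_nat m ^ k * (q ^ m / (1 - q ^ m))) has_sum S) UNIV"
    by (rule has_sum_cong_neutral[THEN iffD1, rotated -1]) (auto simp: not_le)
  moreover have "((\<lambda>m. of_nat m ^ k * (q ^ m / (1 - q ^ m))) has_sum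
      eval_fps ((fps_theta ^^ k) (lambert_fps q)) 1) UNIV"
    using sum_norm by (intro norm_summable_imp_has_sum)
      (auto simp: eval_fps_def fps_nth_theta_funpow lambert_fps_def dest: summable_norm_cancel intro!: summable_sums)
  ultimately have 1: "S = eval_fps ((fps_theta ^^ k) (lambert_fps q)) 1"
    using has_sum_unique by blast
  have "((\<lambda>(n, d). of_nat d ^ k * q ^ n) has_sum S) (SIGMA n:{1..}. {d. d dvd n}) \<longleftrightarrow> (h has_sum S) B"
    by (rule has_sum_reindex_bij_witness[of _ "\<lambda>(m, j). (m * j, m)" "\<lambda>(n, d). (d, n div d)"])
       (auto simp: B_def h_def elim!: dvdE)
  with S have "((\<lambda>(n, d). of_nat d ^ k * q ^ n) has_sum S) (SIGMA n:{1..}. {d. d dvd n})"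
    by blast
  hence "((\<lambda>n. \<Sum>d | d dvd n. of_nat d ^ k * q ^ n) has_sum S) {1..}"
    by (rule has_sum_SigmaD) (auto intro!: has_sum_finiteI)
  hence "((\<lambda>n. fps_nth (divisor_fps k) n * q ^ n) has_sum S) UNIV"
    by (rule has_sum_cong_neutral[THEN iffD1, rotated -1])
       (auto simp: not_le divisor_fps_def sum_distrib_right)
  hence "eval_fps (divisor_fps k) q = S"
    unfolding eval_fps_def using has_sum_imp_sums sums_unique by metis
  thus ?thesis using 1 by simp
qed

section \<open>An elliptic function argument\<close>

text \<open>
  \<open>\<pi> cot(\<pi> z) - 2\<pi>\<i> lambert_diff \<tau> z\<close> is the logarithmic derivative of the Jacobi theta function
  \<open>\<theta>\<^sub>1\<close>, written with exponentials.
\<close>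

definition lambert_diff :: "complex \<Rightarrow> complex \<Rightarrow> complex" where
  "lambert_diff \<tau> z =
     eval_fps (lambert_fps (ex \<tau>)) (ex z) - eval_fps (lambert_fps (ex \<tau>)) (ex (-z))"

definition cot_ex :: "complex \<Rightarrow> complex" where
  "cot_ex z = of_real pi * \<i> * (ex z + 1) / (ex z - 1)"

definition zeta_like :: "complex \<Rightarrow> complex \<Rightarrow> complex" where
  "zeta_like \<tau> z = cot_ex z - 2 * of_real pi * \<i> * lambert_diff \<tau> z"

lemma eval_fps_lambert_sums:
  assumes "Im \<tau> > 0" "norm w < exp (2 * pi * Im \<tau>)"
  shows "(\<lambda>m. ex \<tau> ^ m / (1 - ex \<tau> ^ m) * w ^ m) sums eval_fps (lambert_fps (ex \<tau>)) w"
proof -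
  have "ereal (norm w) < ereal (inverse (norm (ex \<tau>)))"
    using assms by (simp add: norm_ex exp_minus)
  also have "\<dots> \<le> fps_conv_radius (lambert_fps (ex \<tau>))"
    using assms by (intro fps_conv_radius_lambert) (auto simp: norm_ex_less_1_iff)
  finally show ?thesis
    using sums_eval_fps[of w "lambert_fps (ex \<tau>)"] by (simp add: lambert_fps_def)
qed

lemma norm_ex_less_exp_iff: "norm (ex w) < exp (2 * pi * t) \<longleftrightarrow> - Im w < t"
proof -
  have "norm (ex w) < exp (2 * pi * t) \<longleftrightarrow> (2 * pi) * (- Im w) < (2 * pi) * t"
    unfolding norm_ex exp_less_cancel_iff by simp
  thus ?thesis by (subst (asm) mult_less_cancel_left_pos) auto
qed

text \<open>With \<open>q = w * v\<close> one has q^m / w^m = v^m, so the difference of the Lambert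
  series at 1/w and at v collapses to a geometric series in v. The bounds on Im z keep both z and z
  - \<tau> in the strip where the Lambert series converge.\<close>

lemma zeta_like_quasi_periodic:
  assumes "0 < Im z" "Im z < Im \<tau>"
  shows "zeta_like \<tau> z - zeta_like \<tau> (z - \<tau>) = - (2 * of_real pi * \<i>)"
proof -
  define q w v where "q = ex \<tau>" and "w = ex z" and "v = ex (\<tau> - z)"
  have \<tau>: "Im \<tau> > 0" using assms by simp
  have lt: "norm q < 1" "norm w < 1" "norm v < 1"
    using assms by (simp_all add: q_def w_def v_def norm_ex_less_1_iff)
  have [simp]: "q \<noteq> 0" "w \<noteq> 0" "v \<noteq> 0"
    by (simp_all add: q_def w_def v_def)
  have qwv: "q = w * v"
    by (simp add: q_def w_def v_def flip: ex_add)
  have ex_eqs: "ex (-z) = inverse w" "ex (z - \<tau>) = inverse v" "ex (\<tau> - z) = v"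
    by (simp_all add: w_def v_def flip: ex_minus)
  have le: "norm (ex (-z)) < exp (2 * pi * Im \<tau>)" "norm (ex z) < exp (2 * pi * Im \<tau>)"
     "norm (ex (z - \<tau>)) < exp (2 * pi * Im \<tau>)" "norm (ex (- (z - \<tau>))) < exp (2 * pi * Im \<tau>)"
    using assms by (simp_all add: norm_ex_less_exp_iff)
  define P where "P = eval_fps (lambert_fps (ex \<tau>))"
  note sums = eval_fps_lambert_sums[OF \<tau>, folded P_def q_def]
  have qm: "q ^ m \<noteq> 1" if "m > 0" for m
    using lt(1) that by (metis norm_one norm_power power_less_one_iff norm_ge_zero less_irrefl)
  have trm: "q ^ m / (1 - q ^ m) * inverse x ^ m - q ^ m / (1 - q ^ m) * y ^ m = y ^ m - (if m = 0 then 1 else 0)"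
    if "q = x * y" "x \<noteq> 0" "y \<noteq> 0" for x y m
  proof (cases "m = 0")
    case False
    have "q ^ m * inverse x ^ m = y ^ m"
      using that by (simp add: power_mult_distrib field_simps)
    hence "q ^ m / (1 - q ^ m) * inverse x ^ m - q ^ m / (1 - q ^ m) * y ^ m =
            (y ^ m - q ^ m * y ^ m) / (1 - q ^ m)"
      by (simp add: diff_divide_distrib)
    also have "\<dots> = y ^ m"
      using qm[of m] False by (simp add: field_simps)
    finally show ?thesis using False by simp
  qed auto
  have P_diff: "P (inverse x) - P y = 1 / (1 - y) - 1"
    if "q = x * y" "x \<noteq> 0" "y \<noteq> 0" "norm y < 1" "norm (inverse x) < exp (2 * pi * Im \<tau>)" "norm y < exp (2 * pi * Im \<tau>)"
    for x y
  proof -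
    have "(\<lambda>m. q ^ m / (1 - q ^ m) * inverse x ^ m - q ^ m / (1 - q ^ m) * y ^ m) sums (P (inverse x) - P y)"
      by (intro sums_diff sums that)
    moreover have "(\<lambda>m. y ^ m - (if m = 0 then 1 else 0)) sums (1 / (1 - y) - 1)"
      by (intro sums_diff geometric_sums sums_single that)
    ultimately show ?thesis
      unfolding trm[OF that(1-3)] by (rule sums_unique2)
  qed
  have 1: "P (inverse v) - P w = 1 / (1 - w) - 1"
    by (rule P_diff) (use lt qwv le in \<open>simp_all add: ex_eqs mult.commute flip: w_def\<close>)
  have 2: "P (inverse w) - P v = 1 / (1 - v) - 1"
    by (rule P_diff) (use lt qwv le in \<open>simp_all add: ex_eqs flip: w_def\<close>)
  have [simp]: "w \<noteq> 1" "v \<noteq> 1"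
    using lt by auto
  have lam: "lambert_diff \<tau> z - lambert_diff \<tau> (z - \<tau>) = - (1 / (1 - w) - 1) - (1 / (1 - v) - 1)"
  proof -
    have "lambert_diff \<tau> z - lambert_diff \<tau> (z - \<tau>) = (P w - P (inverse w)) - (P (inverse v) - P v)"
      by (simp add: lambert_diff_def P_def ex_eqs flip: w_def)
    also have "\<dots> = - (P (inverse v) - P w) - (P (inverse w) - P v)"
      by simp
    finally show ?thesis unfolding 1 2 .
  qed
  have cot: "cot_ex z - cot_ex (z - \<tau>) = of_real pi * \<i> * ((w + 1) / (w - 1) - (1 + v) / (1 - v))"
  proof -
    have "inverse v + 1 = (1 + v) / v" "inverse v - 1 = (1 - v) / v"
      by (simp_all add: field_simps)
    hence "cot_ex (z - \<tau>) = of_real pi * \<i> * ((1 + v) / (1 - v))"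
      by (simp add: cot_ex_def ex_eqs)
    thus ?thesis by (simp add: cot_ex_def right_diff_distrib flip: w_def)
  qed
  have wv: "(w + 1) / (w - 1) - (1 + v) / (1 - v) = - 2 - 2 * (1 / (1 - w) - 1) - 2 * (1 / (1 - v) - 1)"
    by (simp add: divide_simps) (simp add: algebra_simps)
  have "zeta_like \<tau> z - zeta_like \<tau> (z - \<tau>) = (cot_ex z - cot_ex (z - \<tau>)) -
          2 * of_real pi * \<i> * (lambert_diff \<tau> z - lambert_diff \<tau> (z - \<tau>))"
    by (simp add: zeta_like_def algebra_simps)
  thus ?thesis
    unfolding cot lam wv by (simp add: algebra_simps)
qed

lemma cot_ex_remove_pole:
  obtains g where "g holomorphic_on {z. z = 0 \<or> ex z \<noteq> 1}"
    "\<And>z. z \<noteq> 0 \<Longrightarrow> ex z \<noteq> 1 \<Longrightarrow> g z = cot_ex z - 1 / z"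
proof -
  define c where "c = 2 * of_real pi * \<i>"
  define E where "E = (\<lambda>z. if z = 0 then deriv (\<lambda>z. ex z - 1) 0 else (ex z - 1) / z)"
  have "((\<lambda>z. ex z - 1) has_field_derivative c) (at 0)"
    by (auto intro!: derivative_eq_intros simp: c_def)
  hence E0: "deriv (\<lambda>z. ex z - 1) 0 = c"
    by (rule DERIV_imp_deriv)
  have hol_E: "E holomorphic_on UNIV"
    using pole_theorem_open[of "\<lambda>z. ex z - 1" UNIV 0 "\<lambda>z. (ex z - 1) / z"]
    by (simp add: E_def holomorphic_intros cong: if_cong)
  \<comment> \<open>\<open>cot_ex z - 1 / z\<close> equals \<open>n1 z / (z * E z)\<close>. The
    value E 0 = 2 \<pi> \<i> makes \<open>n1\<close> vanish at 0, which allows a second division by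
    z.\<close>
  define n1 where "n1 = (\<lambda>z. of_real pi * \<i> * (ex z + 1) - E z)"
  have hol_n1: "n1 holomorphic_on UNIV"
    unfolding n1_def by (intro holomorphic_intros hol_E)
  have n1_0: "n1 0 = 0"
    by (simp add: n1_def E_def E0 c_def)
  define n2 where "n2 = (\<lambda>z. if z = 0 then deriv n1 0 else n1 z / z)"
  have hol_n2: "n2 holomorphic_on UNIV"
    using pole_theorem_open[of n1 UNIV 0 "\<lambda>z. n1 z / z"] hol_n1
    by (simp add: n2_def n1_0 cong: if_cong)
  show thesis
  proof
    show "(\<lambda>z. n2 z / E z) holomorphic_on {z. z = 0 \<or> ex z \<noteq> 1}"
      by (intro holomorphic_on_divide holomorphic_on_subset[OF hol_n2] holomorphic_on_subset[OF hol_E])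
         (auto simp: E_def E0 c_def)
    show "n2 z / E z = cot_ex z - 1 / z" if "z \<noteq> 0" "ex z \<noteq> 1" for z
      using that by (simp add: n2_def n1_def E_def cot_ex_def divide_simps)
  qed
qed

lemma ex_eq_1_iff: "ex z = 1 \<longleftrightarrow> z \<in> \<int>"
proof
  assume "ex z = 1"
  then obtain n :: int where n: "Re (2 * of_real pi * \<i> * z) = 0" "Im (2 * of_real pi * \<i> * z) = of_int (2 * n) * pi"
    by (auto simp: ex_def exp_eq_1)
  hence "z = of_int n"
    by (auto simp: complex_eq_iff)
  thus "z \<in> \<int>" by simp
qed (auto elim!: Ints_cases)

lemma holomorphic_on_lambert_diff:
  assumes "Im \<tau> > 0" "\<And>z. z \<in> A \<Longrightarrow> \<bar>Im (f z)\<bar> < Im \<tau>" "f holomorphic_on A"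
  shows "(\<lambda>z. lambert_diff \<tau> (f z)) holomorphic_on A"
proof -
  have *: "ereal (norm (ex w)) < fps_conv_radius (lambert_fps (ex \<tau>))" if "\<bar>Im w\<bar> < Im \<tau>" for w
  proof -
    have "ereal (norm (ex w)) < ereal (inverse (norm (ex \<tau>)))"
      using that norm_ex_less_exp_iff[of w "Im \<tau>"] by (simp add: norm_ex exp_minus)
    also have "\<dots> \<le> fps_conv_radius (lambert_fps (ex \<tau>))"
      using assms by (intro fps_conv_radius_lambert) (auto simp: norm_ex_less_1_iff)
    finally show ?thesis .
  qed
  have hol: "eval_fps (lambert_fps (ex \<tau>)) holomorphic_on eball 0 (fps_conv_radius (lambert_fps (ex \<tau>)))"
    by (rule holomorphic_on_eval_fps) simp
  have 1: "(\<lambda>z. eval_fps (lambert_fps (ex \<tau>)) (ex (f z))) holomorphic_on A"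
    by (rule holomorphic_on_compose_gen[OF _ hol, unfolded o_def])
       (use assms * in \<open>auto intro!: holomorphic_intros\<close>)
  have 2: "(\<lambda>z. eval_fps (lambert_fps (ex \<tau>)) (ex (- f z))) holomorphic_on A"
    by (rule holomorphic_on_compose_gen[OF _ hol, unfolded o_def])
       (use assms * in \<open>auto intro!: holomorphic_intros\<close>)
  show ?thesis
    unfolding lambert_diff_def by (intro holomorphic_intros 1 2)
qed

lemma zeta_like_minus: "zeta_like \<tau> (-z) = - zeta_like \<tau> z"
proof -
  have "cot_ex (-z) = - cot_ex z"
  proof (cases "ex z = 1")
    case False
    thus ?thesis
      by (simp add: cot_ex_def ex_minus divide_simps) (simp add: algebra_simps)
  qed (simp add: cot_ex_def ex_minus)
  thus ?thesis by (simp add: zeta_like_def lambert_diff_def algebra_simps)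
qed

lemma zeta_like_add_1: "zeta_like \<tau> (z + 1) = zeta_like \<tau> z"
  using ex_minus[of "z + 1"] ex_minus[of z]
  by (simp add: zeta_like_def lambert_diff_def cot_ex_def ex_add)

lemma shift_to_half:
  fixes h :: "real \<Rightarrow> complex"
  assumes per: "\<And>x. \<bar>x\<bar> < 1 \<Longrightarrow> \<bar>x - 1\<bar> < 1 \<Longrightarrow> h (x - 1) = h x" and x: "\<bar>x\<bar> < 1"
  shows "\<exists>y. \<bar>y\<bar> \<le> 1 / 2 \<and> h x = h y"
proof -
  consider "\<bar>x\<bar> \<le> 1 / 2" | "x > 1 / 2" | "x < - 1 / 2" by linarith
  thus ?thesis
  proof cases
    case 2
    thus ?thesis using per[of x] x by (intro exI[of _ "x - 1"]) auto
  next
    case 3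
    thus ?thesis using per[of "x + 1"] x by (intro exI[of _ "x + 1"]) auto
  qed auto
qed

text \<open>The series converge only in strips, so the defect M is studied on the open parallelogram
  D of the points a \<tau> + b with |a|, |b| < 1 instead of the whole plane. Periods are used only
  inside D and move every point to the compact part |a|, |b| \<le> 1/2; hence the modulus has an
  interior maximum and M is constant. Oddness makes the constant 0.\<close>

theorem zeta_like_S:
  assumes \<tau>: "Im \<tau> > 0"
  assumes z: "\<bar>Im z\<bar> < Im \<tau>" "\<bar>Im (z / \<tau>)\<bar> < Im (- (1 / \<tau>))" "z \<noteq> 0"
  shows "zeta_like (- (1 / \<tau>)) (z / \<tau>) / \<tau> = zeta_like \<tau> z + 2 * of_real pi * \<i> * z / \<tau>"
proof -
  have \<tau>': "Im (- (1 / \<tau>)) > 0" and \<tau>0: "\<tau> \<noteq> 0"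
    using \<tau> Im_minus_inverse_pos[of \<tau>] by auto
  define D where "D = {z. \<bar>Im z\<bar> < Im \<tau> \<and> \<bar>Im (z / \<tau>)\<bar> < Im (- (1 / \<tau>))}"
  have coords: "Im (of_real a * \<tau> + of_real b) = a * Im \<tau>"
    "Im ((of_real a * \<tau> + of_real b) / \<tau>) = - (b * Im (- (1 / \<tau>)))" for a b
    using \<tau>0 by (simp_all add: add_divide_distrib Im_divide)
  have in_D: "of_real a * \<tau> + of_real b \<in> D \<longleftrightarrow> \<bar>a\<bar> < 1 \<and> \<bar>b\<bar> < 1" for a b
    using \<tau> \<tau>' unfolding D_def mem_Collect_eq coords
    by (simp only: abs_mult abs_minus_cancel abs_of_pos mult_less_cancel_right1) simp
  have ex_coords: "\<exists>a b. z = of_real a * \<tau> + of_real b" for z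
    using \<tau> by (intro exI[of _ "Im z / Im \<tau>"] exI[of _ "Re z - Im z / Im \<tau> * Re \<tau>"])
       (simp add: complex_eq_iff)
  have "open D"
    unfolding D_def by (intro open_Collect_conj open_Collect_less continuous_intros) (use \<tau>0 in auto)
  have "convex D"
  proof -
    have "convex ((\<lambda>z. z) -` {z. Im z < Im \<tau>} \<inter> (\<lambda>z. z) -` {z. Im z > - Im \<tau>} \<inter>
        (\<lambda>z. z / \<tau>) -` {z. Im z < Im (- (1 / \<tau>))} \<inter> (\<lambda>z. z / \<tau>) -` {z. Im z > - Im (- (1 / \<tau>))})"
      by (intro convex_Int convex_linear_vimage convex_halfspace_Im_lt convex_halfspace_Im_gt)
         (auto simp: linear_iff add_divide_distrib scaleR_conv_of_real)
    also have "\<dots> = D"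
      by (auto simp: D_def)
    finally show ?thesis .
  qed
  hence "connected D" by (rule convex_connected)
  obtain g where g: "g holomorphic_on {z. z = 0 \<or> ex z \<noteq> 1}"
    "\<And>z. z \<noteq> 0 \<Longrightarrow> ex z \<noteq> 1 \<Longrightarrow> g z = cot_ex z - 1 / z"
    using cot_ex_remove_pole by blast
  have ex_D: "ex z \<noteq> 1" "ex (z / \<tau>) \<noteq> 1" if "z \<in> D" "z \<noteq> 0" for z
  proof -
    show "ex z \<noteq> 1"
    proof
      assume "ex z = 1"
      then obtain n where "z = of_int n" by (auto simp: ex_eq_1_iff elim: Ints_cases)
      hence "z = of_real 0 * \<tau> + of_real (of_int n)" by simp
      with that in_D[of 0 "of_int n"] show False by auto
    qed
    show "ex (z / \<tau>) \<noteq> 1"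
    proof
      assume "ex (z / \<tau>) = 1"
      then obtain n where "z / \<tau> = of_int n" by (auto simp: ex_eq_1_iff elim: Ints_cases)
      hence "z = of_real (of_int n) * \<tau> + of_real 0" using \<tau>0 by (simp add: field_simps)
      with that in_D[of "of_int n" 0] show False by auto
    qed
  qed
  \<comment> \<open>The polar parts 1/z of \<open>cot_ex (z / \<tau>) / \<tau>\<close> and of
    \<open>cot_ex z\<close> cancel, so \<open>g\<close> may take the place of \<open>cot_ex\<close>
    and M is holomorphic at 0 as well.\<close>
  define M where "M = (\<lambda>z. g (z / \<tau>) / \<tau> - g z - 2 * of_real pi * \<i> *
     (lambert_diff (- (1 / \<tau>)) (z / \<tau>) / \<tau> - lambert_diff \<tau> z) - 2 * of_real pi * \<i> * z / \<tau>)"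
  have M_eq: "M z = zeta_like (- (1 / \<tau>)) (z / \<tau>) / \<tau> - zeta_like \<tau> z - 2 * of_real pi * \<i> * z / \<tau>"
    if "z \<in> D" "z \<noteq> 0" for z
    using that \<tau>0 ex_D[OF that] by (simp add: M_def g zeta_like_def field_simps)
  have "(g \<circ> (\<lambda>z. z / \<tau>)) holomorphic_on D"
    by (rule holomorphic_on_compose_gen[OF _ g(1)]) (use \<tau>0 ex_D in \<open>auto intro!: holomorphic_intros\<close>)
  hence hol: "M holomorphic_on D"
    unfolding M_def o_def
    by (intro holomorphic_intros holomorphic_on_lambert_diff \<tau> \<tau>' holomorphic_on_subset[OF g(1)])
       (use \<tau>0 ex_D in \<open>auto simp: D_def\<close>)
  have per1: "M (z - \<tau>) = M z" if "z \<in> D" "z - \<tau> \<in> D" for z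
  proof (cases "z = 0 \<or> z = \<tau>")
    case False
    have "zeta_like (- (1 / \<tau>)) ((z - \<tau>) / \<tau>) = zeta_like (- (1 / \<tau>)) (z / \<tau>)"
      using zeta_like_add_1[of _ "(z - \<tau>) / \<tau>"] \<tau>0 by (simp add: diff_divide_distrib)
    moreover have "zeta_like \<tau> z - zeta_like \<tau> (z - \<tau>) = - (2 * of_real pi * \<i>)"
      by (rule zeta_like_quasi_periodic) (use that in \<open>auto simp: D_def\<close>)
    hence "zeta_like \<tau> (z - \<tau>) = zeta_like \<tau> z + 2 * of_real pi * \<i>"
      by (simp add: algebra_simps)
    ultimately show ?thesis
      using False that \<tau>0 by (simp add: M_eq field_simps)
  next
    case True
    thus ?thesis using that in_D[of 1 0] in_D[of "-1" 0] by auto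
  qed
  have per2: "M (z - 1) = M z" if "z \<in> D" "z - 1 \<in> D" for z
  proof (cases "z = 0 \<or> z = 1")
    case False
    \<comment> \<open>In the variable z / \<tau> the shift by -1 becomes the shift by -1/\<tau>, so
      the two \<open>zeta_like\<close> terms exchange the roles of periodic and quasi-periodic
      function.\<close>
    define u where "u = (z - 1) / \<tau>"
    have "u - (- (1 / \<tau>)) = z / \<tau>"
      by (simp add: u_def diff_divide_distrib)
    moreover have "zeta_like (- (1 / \<tau>)) u - zeta_like (- (1 / \<tau>)) (u - (- (1 / \<tau>))) = - (2 * of_real pi * \<i>)"
    proof (rule zeta_like_quasi_periodic)
      have "\<bar>Im u\<bar> < Im (- (1 / \<tau>))" "\<bar>Im (u - (- (1 / \<tau>)))\<bar> < Im (- (1 / \<tau>))"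
        using that \<open>u - (- (1 / \<tau>)) = z / \<tau>\<close> by (auto simp: D_def u_def)
      thus "0 < Im u" "Im u < Im (- (1 / \<tau>))"
        unfolding minus_complex.sel by linarith+
    qed
    ultimately have u: "zeta_like (- (1 / \<tau>)) u = zeta_like (- (1 / \<tau>)) (z / \<tau>) - 2 * of_real pi * \<i>"
      by (simp add: algebra_simps)
    have "M (z - 1) = zeta_like (- (1 / \<tau>)) u / \<tau> - zeta_like \<tau> z - 2 * of_real pi * \<i> * (z - 1) / \<tau>"
      using zeta_like_add_1[of \<tau> "z - 1"] False that by (simp add: M_eq u_def)
    also have "\<dots> = M z"
      unfolding u using False that \<tau>0 by (simp add: M_eq field_simps)
    finally show ?thesis .
  next
    case True
    thus ?thesis using that in_D[of 0 1] in_D[of 0 "-1"] by auto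
  qed
  define C where "C = (\<lambda>(a, b). of_real a * \<tau> + of_real b) ` ({-1/2..1/2} \<times> {-1/2..1/2})"
  have "compact C"
    unfolding C_def case_prod_unfold by (intro compact_continuous_image compact_Times continuous_intros) auto
  have "C \<subseteq> D"
    by (auto simp: C_def in_D)
  have "continuous_on C M"
    using hol \<open>C \<subseteq> D\<close> by (meson holomorphic_on_imp_continuous_on continuous_on_subset)
  moreover have "C \<noteq> {}" by (auto simp: C_def)
  ultimately obtain \<xi> where \<xi>: "\<xi> \<in> C" "\<And>w. w \<in> C \<Longrightarrow> norm (M w) \<le> norm (M \<xi>)"
    using continuous_attains_sup[OF \<open>compact C\<close>, of "\<lambda>z. norm (M z)"] by (auto intro: continuous_intros)
  have max: "norm (M w) \<le> norm (M \<xi>)" if "w \<in> D" for w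
  proof -
    obtain a b where w: "w = of_real a * \<tau> + of_real b"
      using ex_coords by blast
    with that have ab: "\<bar>a\<bar> < 1" "\<bar>b\<bar> < 1" by (auto simp: in_D)
    have "M (of_real (x - 1) * \<tau> + of_real b) = M (of_real x * \<tau> + of_real b)"
      if "\<bar>x\<bar> < 1" "\<bar>x - 1\<bar> < 1" for x
      using per1[of "of_real x * \<tau> + of_real b"] that ab in_D[of x b] in_D[of "x - 1" b]
      by (simp add: algebra_simps)
    from shift_to_half[of "\<lambda>x. M (of_real x * \<tau> + of_real b)", OF this ab(1)]
    obtain a' where a': "\<bar>a'\<bar> \<le> 1 / 2" "M w = M (of_real a' * \<tau> + of_real b)"
      unfolding w by auto
    have "M (of_real a' * \<tau> + of_real (x - 1)) = M (of_real a' * \<tau> + of_real x)"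
      if "\<bar>x\<bar> < 1" "\<bar>x - 1\<bar> < 1" for x
      using per2[of "of_real a' * \<tau> + of_real x"] that a' in_D[of a' x] in_D[of a' "x - 1"]
      by (simp add: algebra_simps)
    from shift_to_half[of "\<lambda>x. M (of_real a' * \<tau> + of_real x)", OF this ab(2)]
    obtain b' where b': "\<bar>b'\<bar> \<le> 1 / 2" "M w = M (of_real a' * \<tau> + of_real b')"
      unfolding a'(2) by auto
    have "of_real a' * \<tau> + of_real b' \<in> C"
      using a' b' by (auto simp: C_def intro!: image_eqI[of _ _ "(a', b')"])
    thus ?thesis using \<xi> b' by simp
  qed
  have "M constant_on D"
    by (rule maximum_modulus_principle[OF hol \<open>open D\<close> \<open>connected D\<close> \<open>open D\<close> order_refl, of \<xi>])
       (use \<xi>(1) \<open>C \<subseteq> D\<close> max in auto)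
  then obtain c where c: "\<And>z. z \<in> D \<Longrightarrow> M z = c"
    by (auto simp: constant_on_def)
  have zD: "z \<in> D" "- z \<in> D"
    using z by (simp_all add: D_def)
  have "M (- z) = - M z"
    using zeta_like_minus[of \<tau> z] zeta_like_minus[of "- (1 / \<tau>)" "z / \<tau>"] z(3) \<tau>0
    by (simp add: M_eq zD field_simps)
  hence "M z = 0"
    using c[OF zD(1)] c[OF zD(2)] by simp
  thus ?thesis
    unfolding M_eq[OF zD(1) z(3)] by (simp only: diff_diff_eq right_minus_eq)
qed

section \<open>Taylor coefficients at 0 and the Eisenstein series of weights 2 and 4\<close>

text \<open>Differentiation in z multiplies by 2 \<pi> \<i> c and applies \<open>fps_theta\<close>;
  at z = 0 the argument is w = 1, where \<open>lambert_divisor\<close> turns the n-th derivative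
  into a divisor series.\<close>

lemma has_fps_expansion_lambert_ex:
  assumes "Im \<tau> > 0"
  shows "(\<lambda>z. eval_fps (lambert_fps (ex \<tau>)) (ex (c * z))) has_fps_expansion
     Abs_fps (\<lambda>n. (2 * of_real pi * \<i> * c) ^ n * eval_fps (divisor_fps n) (ex \<tau>) / fact n)"
proof -
  define q where "q = ex \<tau>"
  have q: "norm q < 1" "q \<noteq> 0"
    using assms by (simp_all add: q_def norm_ex_less_1_iff)
  define F where "F = lambert_fps q"
  define R where "R = fps_conv_radius F"
  define U where "U = {z. ereal (norm (ex (c * z))) < R}"
  have R: "R > 1"
    using fps_conv_radius_lambert_gt_1[OF q, of 0] by (simp add: R_def F_def)
  have "open U"
    unfolding U_def by (intro open_Collect_less continuous_intros continuous_on_ereal)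
  have "0 \<in> U"
    using R by (simp add: U_def one_ereal_def)
  have deriv: "((\<lambda>z. eval_fps ((fps_theta ^^ n) F) (ex (c * z))) has_field_derivative
       (2 * of_real pi * \<i> * c) * eval_fps ((fps_theta ^^ Suc n) F) (ex (c * z))) (at z)" if "z \<in> U" for z n
  proof -
    have "ereal (norm (ex (c * z))) < R"
      using that by (simp add: U_def)
    also have "\<dots> \<le> fps_conv_radius ((fps_theta ^^ n) F)"
      unfolding R_def by (rule fps_conv_radius_theta_funpow)
    finally have "((\<lambda>z. eval_fps ((fps_theta ^^ n) F) (ex z)) has_field_derivative
        (2 * of_real pi * \<i>) * eval_fps ((fps_theta ^^ Suc n) F) (ex (c * z))) (at (c * z))"
      using has_field_derivative_eval_fps_ex[of "c * z" "(fps_theta ^^ n) F"] by simp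
    moreover have "((\<lambda>z. c * z) has_field_derivative c) (at z)"
      by (auto intro!: derivative_eq_intros)
    ultimately show ?thesis
      using DERIV_chain2[where f = "\<lambda>z. eval_fps ((fps_theta ^^ n) F) (ex z)" and g = "\<lambda>z. c * z" and x = z]
      by (fastforce simp: mult_ac)
  qed
  define f where "f = (\<lambda>z. eval_fps F (ex (c * z)))"
  have "f holomorphic_on U"
    using deriv[of _ 0] \<open>open U\<close> by (auto simp: f_def holomorphic_on_open)
  hence exp: "f has_fps_expansion fps_expansion f 0"
    using \<open>open U\<close> \<open>0 \<in> U\<close> by (intro has_fps_expansion_fps_expansion)
  have "(deriv ^^ n) f z = (2 * of_real pi * \<i> * c) ^ n * eval_fps ((fps_theta ^^ n) F) (ex (c * z))"
    if "z \<in> U" for z n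
    using that
  proof (induction n arbitrary: z)
    case (Suc n)
    have "(deriv ^^ Suc n) f z =
            deriv (\<lambda>z. (2 * of_real pi * \<i> * c) ^ n * eval_fps ((fps_theta ^^ n) F) (ex (c * z))) z"
      unfolding funpow.simps o_def
    proof (rule deriv_cong_ev[OF _ refl])
      have "eventually (\<lambda>z. z \<in> U) (nhds z)"
        using \<open>open U\<close> Suc.prems by (rule eventually_nhds_in_open)
      thus "eventually (\<lambda>z. (deriv ^^ n) f z =
              (2 * of_real pi * \<i> * c) ^ n * eval_fps ((fps_theta ^^ n) F) (ex (c * z))) (nhds z)"
        by eventually_elim (rule Suc.IH)
    qed
    also have "\<dots> = (2 * of_real pi * \<i> * c) ^ n * ((2 * of_real pi * \<i> * c) * eval_fps ((fps_theta ^^ Suc n) F) (ex (c * z)))"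
      by (intro DERIV_imp_deriv DERIV_cmult deriv Suc.prems)
    finally show ?case by (simp add: mult_ac)
  qed (simp add: f_def)
  from this[OF \<open>0 \<in> U\<close>] have "fps_expansion f 0 = Abs_fps (\<lambda>n. (2 * of_real pi * \<i> * c) ^ n *
      eval_fps (divisor_fps n) (ex \<tau>) / fact n)"
    using lambert_divisor[OF q] by (simp add: fps_expansion_def F_def q_def fps_eq_iff)
  thus ?thesis
    using exp by (simp add: f_def F_def q_def)
qed

definition G2 :: "complex \<Rightarrow> complex" where
  "G2 \<tau> = 1 - 24 * eval_fps (divisor_fps 1) (ex \<tau>)"

definition G4 :: "complex \<Rightarrow> complex" where
  "G4 \<tau> = 1 + 240 * eval_fps (divisor_fps 3) (ex \<tau>)"

lemma cot_ex_eq: "ex z \<noteq> 1 \<Longrightarrow> cot_ex z * sin (of_real pi * z) = of_real pi * cos (of_real pi * z)"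
proof -
  define e where "e = exp (\<i> * of_real pi * z)"
  have e: "ex z = e * e" "e \<noteq> 0"
    by (simp_all add: ex_def e_def mult_ac flip: exp_add)
  assume "ex z \<noteq> 1"
  hence ne: "e * e - 1 \<noteq> 0"
    by (simp add: e)
  have "exp (\<i> * (of_real pi * z)) = e" "exp (- (\<i> * (of_real pi * z))) = 1 / e"
    by (simp_all add: e_def mult_ac exp_minus inverse_eq_divide)
  hence sc: "sin (of_real pi * z) = (e * e - 1) / (2 * \<i> * e)" "cos (of_real pi * z) = (e * e + 1) / (2 * e)"
    using e by (simp_all add: sin_exp_eq cos_exp_eq field_simps)
  show ?thesis
    unfolding cot_ex_def sc e(1) using e ne by simp
qed

text \<open>F is the expansion of \<alpha> cot(\<alpha> z) - \<beta> cot(\<beta> z), with the sines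
  multiplied out to avoid Laurent series. As the product of the sines starts with \<alpha> \<beta>
  z^2, the coefficients 1 and 3 of F are read off at z^3 and z^5.\<close>

lemma taylor_compare:
  fixes \<alpha> \<beta> :: complex
  assumes "fps_const \<alpha> * fps_cos \<alpha> * fps_sin \<beta> - fps_const \<beta> * fps_cos \<beta> * fps_sin \<alpha> =
             F * fps_sin \<alpha> * fps_sin \<beta>"
    and "fps_nth F 0 = 0" "fps_nth F 2 = 0" "\<alpha> \<noteq> 0" "\<beta> \<noteq> 0"
  shows "3 * fps_nth F 1 = \<beta>\<^sup>2 - \<alpha>\<^sup>2" "45 * fps_nth F 3 = \<beta> ^ 4 - \<alpha> ^ 4"
proof -
  define r1 r3 where "r1 = fps_nth F 1" and "r3 = fps_nth F 3"
  have F: "fps_nth F 0 = 0" "fps_nth F (Suc 0) = r1" "fps_nth F (Suc (Suc 0)) = 0"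
      "fps_nth F (Suc (Suc (Suc 0))) = r3"
    using assms by (simp_all add: r1_def r3_def numeral_eq_Suc)
  have "fps_nth (fps_sin c) 2 = 0" "fps_nth (fps_sin c) 3 = - (c ^ 3) / 6"
    "fps_nth (fps_sin c) 4 = 0" "fps_nth (fps_sin c) 5 = c ^ 5 / 120"
    "fps_nth (fps_cos c) 2 = - (c ^ 2) / 2" "fps_nth (fps_cos c) 3 = 0"
    "fps_nth (fps_cos c) 4 = c ^ 4 / 24" "fps_nth (fps_cos c) 5 = 0" for c :: complex
    by (simp_all add: fps_sin_def fps_cos_def fact_numeral)
  note nums = this[unfolded eval_nat_numeral BitM.simps One_nat_def numeral_One]
  have sn: "fps_nth (fps_sin c) 0 = 0" "fps_nth (fps_sin c) (Suc 0) = c"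
    "fps_nth (fps_sin c) (Suc (Suc 0)) = 0" "fps_nth (fps_sin c) (Suc (Suc (Suc 0))) = - (c ^ 3) / 6"
    "fps_nth (fps_sin c) (Suc (Suc (Suc (Suc 0)))) = 0"
    "fps_nth (fps_sin c) (Suc (Suc (Suc (Suc (Suc 0))))) = c ^ 5 / 120" for c :: complex
    unfolding nums by (simp_all add: fps_sin_def eval_nat_numeral)
  have cs: "fps_nth (fps_cos c) 0 = 1" "fps_nth (fps_cos c) (Suc 0) = 0"
    "fps_nth (fps_cos c) (Suc (Suc 0)) = - (c ^ 2) / 2" "fps_nth (fps_cos c) (Suc (Suc (Suc 0))) = 0"
    "fps_nth (fps_cos c) (Suc (Suc (Suc (Suc 0)))) = c ^ 4 / 24"
    "fps_nth (fps_cos c) (Suc (Suc (Suc (Suc (Suc 0))))) = 0" for c :: complex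
    unfolding nums by (simp_all add: fps_cos_def eval_nat_numeral)
  define P where "P = fps_sin \<alpha> * fps_sin \<beta>"
  have P: "fps_nth P 0 = 0" "fps_nth P (Suc 0) = 0" "fps_nth P (Suc (Suc 0)) = \<alpha> * \<beta>"
    "fps_nth P (Suc (Suc (Suc 0))) = 0" "fps_nth P (Suc (Suc (Suc (Suc 0)))) = - (\<alpha> * \<beta> * (\<alpha>\<^sup>2 + \<beta>\<^sup>2)) / 6"
    "fps_nth P (Suc (Suc (Suc (Suc (Suc 0))))) = 0"
    by (simp_all add: P_def fps_mult_nth sum.atLeast0_atMost_Suc sn) (simp add: field_simps power2_eq_square power3_eq_cube)
  define Q where "Q = fps_cos \<alpha> * fps_sin \<beta>"
  have Q: "fps_nth Q (Suc (Suc (Suc 0))) = - (\<beta> ^ 3) / 6 - \<alpha> ^ 2 * \<beta> / 2"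
     "fps_nth Q (Suc (Suc (Suc (Suc (Suc 0))))) = \<beta> ^ 5 / 120 + \<alpha> ^ 2 * \<beta> ^ 3 / 12 + \<alpha> ^ 4 * \<beta> / 24"
    by (simp_all add: Q_def fps_mult_nth sum.atLeast0_atMost_Suc sn cs)
  define Q' where "Q' = fps_cos \<beta> * fps_sin \<alpha>"
  have Q': "fps_nth Q' (Suc (Suc (Suc 0))) = - (\<alpha> ^ 3) / 6 - \<beta> ^ 2 * \<alpha> / 2"
     "fps_nth Q' (Suc (Suc (Suc (Suc (Suc 0))))) = \<alpha> ^ 5 / 120 + \<beta> ^ 2 * \<alpha> ^ 3 / 12 + \<beta> ^ 4 * \<alpha> / 24"
    by (simp_all add: Q'_def fps_mult_nth sn cs)
  have eq: "fps_const \<alpha> * Q - fps_const \<beta> * Q' = F * P"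
    using assms(1) by (simp add: P_def Q_def Q'_def mult.assoc)
  have e3: "\<alpha> * (- (\<beta> ^ 3) / 6 - \<alpha> ^ 2 * \<beta> / 2) - \<beta> * (- (\<alpha> ^ 3) / 6 - \<beta> ^ 2 * \<alpha> / 2) = r1 * (\<alpha> * \<beta>)"
    using arg_cong[OF eq, of "\<lambda>f. fps_nth f (Suc (Suc (Suc 0)))"]
    by (simp add: Q Q') (simp add: fps_mult_nth sum.atLeast0_atMost_Suc P F)
  have "(\<alpha> * \<beta>) * (3 * r1) = 3 * (r1 * (\<alpha> * \<beta>))"
    by simp
  also have "\<dots> = (\<alpha> * \<beta>) * (\<beta>\<^sup>2 - \<alpha>\<^sup>2)"
    unfolding e3 [symmetric] by (simp add: field_simps power2_eq_square power3_eq_cube)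
  finally have "(\<alpha> * \<beta>) * (3 * r1) = (\<alpha> * \<beta>) * (\<beta>\<^sup>2 - \<alpha>\<^sup>2)" .
  thus r1: "3 * fps_nth F 1 = \<beta>\<^sup>2 - \<alpha>\<^sup>2"
    using assms unfolding r1_def by (subst (asm) mult_cancel_left) auto
  have e5: "\<alpha> * (\<beta> ^ 5 / 120 + \<alpha> ^ 2 * \<beta> ^ 3 / 12 + \<alpha> ^ 4 * \<beta> / 24) - \<beta> * (\<alpha> ^ 5 / 120 + \<beta> ^ 2 * \<alpha> ^ 3 / 12 + \<beta> ^ 4 * \<alpha> / 24)
           = r3 * (\<alpha> * \<beta>) - r1 * (\<alpha> * \<beta> * (\<alpha>\<^sup>2 + \<beta>\<^sup>2)) / 6"
    using arg_cong[OF eq, of "\<lambda>f. fps_nth f (Suc (Suc (Suc (Suc (Suc 0)))))"]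
    by (simp add: Q Q') (simp add: fps_mult_nth sum.atLeast0_atMost_Suc P F)
  have r1': "r1 = (\<beta>\<^sup>2 - \<alpha>\<^sup>2) / 3"
    using r1 by (simp add: r1_def field_simps)
  have "(\<alpha> * \<beta>) * (45 * r3) =
      45 * (r3 * (\<alpha> * \<beta>) - r1 * (\<alpha> * \<beta> * (\<alpha>\<^sup>2 + \<beta>\<^sup>2)) / 6) + 45 * (r1 * (\<alpha> * \<beta> * (\<alpha>\<^sup>2 + \<beta>\<^sup>2)) / 6)"
    by (simp add: algebra_simps)
  also have "\<dots> = (\<alpha> * \<beta>) * (\<beta> ^ 4 - \<alpha> ^ 4)"
    unfolding e5 [symmetric] unfolding r1' by (simp add: field_simps eval_nat_numeral)
  finally have "(\<alpha> * \<beta>) * (45 * r3) = (\<alpha> * \<beta>) * (\<beta> ^ 4 - \<alpha> ^ 4)" .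
  thus "45 * fps_nth F 3 = \<beta> ^ 4 - \<alpha> ^ 4"
    using assms unfolding r3_def by (subst (asm) mult_cancel_left) auto
qed

text \<open>\<open>zeta_like_S\<close> expresses
  \<open>cot_ex (z / \<tau>) / \<tau> - cot_ex z\<close> by Lambert series; the coefficients of z
  and z^3 give weights 2 and 4. The extra term in \<open>G2_S\<close> comes from the linear term 2
  \<pi> \<i> z / \<tau>.\<close>

theorem
  assumes \<tau>: "Im \<tau> > 0"
  shows G2_S: "G2 (- (1 / \<tau>)) = \<tau>\<^sup>2 * G2 \<tau> - 6 * \<i> * \<tau> / of_real pi"
    and G4_S: "G4 (- (1 / \<tau>)) = \<tau> ^ 4 * G4 \<tau>"
proof -
  have \<tau>': "Im (- (1 / \<tau>)) > 0" and \<tau>0: "\<tau> \<noteq> 0"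
    using \<tau> Im_minus_inverse_pos[of \<tau>] by auto
  define r where "r = (\<lambda>z. 2 * of_real pi * \<i> / \<tau> * z + 2 * of_real pi * \<i> *
     (1 / \<tau> * lambert_diff (- (1 / \<tau>)) (z / \<tau>) - lambert_diff \<tau> z))"
  define H where "H = (\<lambda>\<tau> c. Abs_fps (\<lambda>n. (2 * of_real pi * \<i> * c) ^ n * eval_fps (divisor_fps n) (ex \<tau>) / fact n))"
  define F where "F = fps_const (2 * of_real pi * \<i> / \<tau>) * fps_X + fps_const (2 * of_real pi * \<i>) *
     (fps_const (1 / \<tau>) * (H (- (1 / \<tau>)) (1 / \<tau>) - H (- (1 / \<tau>)) (- (1 / \<tau>))) - (H \<tau> 1 - H \<tau> (-1)))"
  have H: "(\<lambda>z. eval_fps (lambert_fps (ex \<tau>)) (ex (c * z))) has_fps_expansion H \<tau> c" if "Im \<tau> > 0" for \<tau> c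
    unfolding H_def by (rule has_fps_expansion_lambert_ex[OF that])
  have "(\<lambda>z. lambert_diff \<tau> z) has_fps_expansion (H \<tau> 1 - H \<tau> (-1))"
    using has_fps_expansion_diff[OF H[OF \<tau>, of 1] H[OF \<tau>, of "-1"]] by (simp add: lambert_diff_def)
  moreover have "(\<lambda>z. lambert_diff (- (1 / \<tau>)) (z / \<tau>)) has_fps_expansion
      (H (- (1 / \<tau>)) (1 / \<tau>) - H (- (1 / \<tau>)) (- (1 / \<tau>)))"
    using has_fps_expansion_diff[OF H[OF \<tau>', of "1 / \<tau>"] H[OF \<tau>', of "- (1 / \<tau>)"]]
    by (simp add: lambert_diff_def)
  ultimately have F: "r has_fps_expansion F"
    unfolding r_def F_def
    by (intro has_fps_expansion_add has_fps_expansion_diff has_fps_expansion_cmult_left has_fps_expansion_fps_X)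
  define S where "S = (\<lambda>\<tau> k. eval_fps (divisor_fps k) (ex \<tau>))"
  have F_nth: "fps_nth F 0 = 0" "fps_nth F 2 = 0"
    "fps_nth F 1 = 2 * of_real pi * \<i> / \<tau> - 8 * of_real pi ^ 2 * (S (- (1 / \<tau>)) 1 / \<tau>\<^sup>2 - S \<tau> 1)"
    "fps_nth F 3 = 16 / 3 * of_real pi ^ 4 * (S (- (1 / \<tau>)) 3 / \<tau> ^ 4 - S \<tau> 3)"
  proof -
    define c where "c = 2 * of_real pi * \<i>"
    have F_nth: "fps_nth F n = (if n = 1 then c / \<tau> else 0) +
        c * (((c / \<tau>) ^ n * S (- (1 / \<tau>)) n / fact n - (- (c / \<tau>)) ^ n * S (- (1 / \<tau>)) n / fact n) / \<tau> -
             (c ^ n * S \<tau> n / fact n - (-c) ^ n * S \<tau> n / fact n))" for n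
      by (cases "n = 1") (simp_all add: F_def H_def S_def c_def)
    show "fps_nth F 0 = 0" "fps_nth F 2 = 0"
      by (simp_all add: F_nth)
    have c: "c ^ 2 = - 4 * of_real pi ^ 2" "c ^ 4 = 16 * of_real pi ^ 4"
      by (simp_all add: c_def power_mult_distrib)
    have "fps_nth F 1 = c / \<tau> + 2 * c ^ 2 * (S (- (1 / \<tau>)) 1 / \<tau>\<^sup>2 - S \<tau> 1)"
      by (simp add: F_nth power2_eq_square algebra_simps)
    thus "fps_nth F 1 = 2 * of_real pi * \<i> / \<tau> - 8 * of_real pi ^ 2 * (S (- (1 / \<tau>)) 1 / \<tau>\<^sup>2 - S \<tau> 1)"
      unfolding c by (simp add: c_def)
    have "fps_nth F 3 = c ^ 4 / 3 * (S (- (1 / \<tau>)) 3 / \<tau> ^ 4 - S \<tau> 3)"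
      by (simp add: F_nth fact_numeral power3_eq_cube power4_eq_xxxx algebra_simps)
    thus "fps_nth F 3 = 16 / 3 * of_real pi ^ 4 * (S (- (1 / \<tau>)) 3 / \<tau> ^ 4 - S \<tau> 3)"
      unfolding c by simp
  qed
  define \<alpha> \<beta> where "\<alpha> = of_real pi / \<tau>" and "\<beta> = complex_of_real pi"
  define D where "D = {z. \<bar>Im z\<bar> < Im \<tau> \<and> \<bar>Im (z / \<tau>)\<bar> < Im (- (1 / \<tau>))}"
  have "open D"
    unfolding D_def by (intro open_Collect_conj open_Collect_less continuous_intros) (use \<tau>0 in auto)
  moreover have "0 \<in> D"
    using \<tau> \<tau>' by (simp add: D_def)
  ultimately have ev: "eventually (\<lambda>z. z \<in> D) (nhds 0)"
    by (rule eventually_nhds_in_open)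
  have "\<alpha> * cos (\<alpha> * z) * sin (\<beta> * z) - \<beta> * cos (\<beta> * z) * sin (\<alpha> * z) = r z * sin (\<alpha> * z) * sin (\<beta> * z)"
    if z: "z \<in> D" for z
  proof (cases "z = 0")
    case False
    have "ex z \<noteq> 1"
    proof
      assume "ex z = 1"
      then obtain n where n: "z = of_int n" by (auto simp: ex_eq_1_iff elim: Ints_cases)
      hence "\<bar>real_of_int n\<bar> * Im (- (1 / \<tau>)) < 1 * Im (- (1 / \<tau>))"
        using z \<tau> \<tau>' by (simp add: D_def Im_divide abs_mult)
      hence "\<bar>real_of_int n\<bar> < 1"
        using \<tau>' by (subst (asm) mult_less_cancel_right_pos) auto
      with n False show False by auto
    qed
    have "ex (z / \<tau>) \<noteq> 1"
    proof
      assume "ex (z / \<tau>) = 1"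
      then obtain n where n: "z / \<tau> = of_int n" by (auto simp: ex_eq_1_iff elim: Ints_cases)
      hence n': "z = of_int n * \<tau>" using \<tau>0 by (simp add: field_simps)
      hence "\<bar>real_of_int n\<bar> * Im \<tau> < 1 * Im \<tau>"
        using z \<tau> by (simp add: D_def abs_mult)
      hence "\<bar>real_of_int n\<bar> < 1"
        using \<tau> by (subst (asm) mult_less_cancel_right_pos) auto
      with n' False show False by auto
    qed
    have "cot_ex (z / \<tau>) / \<tau> - cot_ex z = r z"
      using zeta_like_S[OF \<tau> _ _ False] z \<tau>0
      by (simp add: D_def zeta_like_def r_def field_simps)
    hence "r z * sin (\<alpha> * z) * sin (\<beta> * z) =
       (cot_ex (z / \<tau>) * sin (of_real pi * (z / \<tau>))) / \<tau> * sin (of_real pi * z) -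
       (cot_ex z * sin (of_real pi * z)) * sin (of_real pi * (z / \<tau>))"
      by (simp add: \<alpha>_def \<beta>_def field_simps flip: \<open>_ = r z\<close>)
    thus ?thesis
      unfolding cot_ex_eq[OF \<open>ex z \<noteq> 1\<close>] cot_ex_eq[OF \<open>ex (z / \<tau>) \<noteq> 1\<close>]
      by (simp add: \<alpha>_def \<beta>_def)
  qed auto
  with ev have ev': "eventually (\<lambda>z. \<alpha> * cos (\<alpha> * z) * sin (\<beta> * z) - \<beta> * cos (\<beta> * z) * sin (\<alpha> * z) =
       r z * sin (\<alpha> * z) * sin (\<beta> * z)) (nhds 0)"
    by (auto elim: eventually_mono)
  have "(\<lambda>z. \<alpha> * cos (\<alpha> * z) * sin (\<beta> * z) - \<beta> * cos (\<beta> * z) * sin (\<alpha> * z)) has_fps_expansion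
     (fps_const \<alpha> * fps_cos \<alpha> * fps_sin \<beta> - fps_const \<beta> * fps_cos \<beta> * fps_sin \<alpha>)"
    by (intro fps_expansion_intros)
  moreover have "(\<lambda>z. r z * sin (\<alpha> * z) * sin (\<beta> * z)) has_fps_expansion (F * fps_sin \<alpha> * fps_sin \<beta>)"
    by (intro fps_expansion_intros F)
  ultimately have "fps_const \<alpha> * fps_cos \<alpha> * fps_sin \<beta> - fps_const \<beta> * fps_cos \<beta> * fps_sin \<alpha> =
             F * fps_sin \<alpha> * fps_sin \<beta>"
    using fps_expansion_unique_complex has_fps_expansion_cong[OF ev' refl] by blast
  from taylor_compare[OF this F_nth(1,2)]
  have *: "3 * fps_nth F 1 = \<beta>\<^sup>2 - \<alpha>\<^sup>2" "45 * fps_nth F 3 = \<beta> ^ 4 - \<alpha> ^ 4"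
    using \<tau>0 by (simp_all add: \<alpha>_def \<beta>_def)
  have S_G: "S \<sigma> 1 = (1 - G2 \<sigma>) / 24" "S \<sigma> 3 = (G4 \<sigma> - 1) / 240" for \<sigma>
    by (simp_all add: S_def G2_def G4_def)
  have "of_real pi * (6 * \<i> * \<tau> + of_real pi * G2 (- (1 / \<tau>)) - of_real pi * \<tau>\<^sup>2 * G2 \<tau>) =
          \<tau>\<^sup>2 * (3 * fps_nth F 1 - (\<beta>\<^sup>2 - \<alpha>\<^sup>2))"
    unfolding F_nth S_G using \<tau>0 by (simp add: \<alpha>_def \<beta>_def field_simps power2_eq_square)
  also have "\<dots> = 0"
    using *(1) by simp
  finally have "6 * \<i> * \<tau> + of_real pi * G2 (- (1 / \<tau>)) - of_real pi * \<tau>\<^sup>2 * G2 \<tau> = 0"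
    by simp
  hence "of_real pi * G2 (- (1 / \<tau>)) = of_real pi * (\<tau>\<^sup>2 * G2 \<tau> - 6 * \<i> * \<tau> / of_real pi)"
    by (simp add: algebra_simps eq_neg_iff_add_eq_0)
  thus "G2 (- (1 / \<tau>)) = \<tau>\<^sup>2 * G2 \<tau> - 6 * \<i> * \<tau> / of_real pi"
    by (subst (asm) mult_cancel_left) auto
  have "of_real pi ^ 4 * (G4 (- (1 / \<tau>)) - \<tau> ^ 4 * G4 \<tau>) =
          \<tau> ^ 4 * (45 * fps_nth F 3 - (\<beta> ^ 4 - \<alpha> ^ 4))"
    unfolding F_nth S_G using \<tau>0 by (simp add: \<alpha>_def \<beta>_def field_simps power4_eq_xxxx)
  also have "\<dots> = 0"
    using *(2) by simp
  finally show "G4 (- (1 / \<tau>)) = \<tau> ^ 4 * G4 \<tau>"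
    by simp
qed

section \<open>The eta function\<close>

text \<open>This is minus the logarithm of the Euler product: the double sum of q^(m j) / j has the
  coefficient \<sigma>(n) / n at q^n.\<close>

definition log_fps :: "complex fps" where
  "log_fps = Abs_fps (\<lambda>n. fps_nth (divisor_fps 1) n / of_nat n)"

lemma fps_theta_log_fps: "fps_theta log_fps = divisor_fps 1"
  by (rule fps_ext) (auto simp: log_fps_def divisor_fps_def)

lemma fps_conv_radius_log_fps: "fps_conv_radius log_fps \<ge> 1"
proof -
  have "norm (fps_nth log_fps n) \<le> norm (fps_nth (divisor_fps 1) n)" for n
  proof (cases "n = 0")
    case False
    thus ?thesis
      using mult_left_mono[of 1 "real n" "norm (fps_nth (divisor_fps 1) n)"]
      by (simp add: log_fps_def norm_divide field_simps)
  qed (simp add: log_fps_def)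
  hence "fps_conv_radius log_fps \<ge> fps_conv_radius (divisor_fps 1)"
    unfolding fps_conv_radius_def by (rule conv_radius_geI_bound)
  thus ?thesis using fps_conv_radius_divisor[of 1] by order
qed

lemma norm_ex_less_radius:
  assumes "Im \<tau> > 0" "fps_conv_radius F \<ge> 1"
  shows "ereal (norm (ex \<tau>)) < fps_conv_radius F"
proof -
  have "ereal (norm (ex \<tau>)) < 1"
    using assms by (simp add: norm_ex_less_1_iff one_ereal_def)
  thus ?thesis using assms(2) by order
qed

lemma eval_fps_has_sum:
  assumes "Im \<tau> > 0" "fps_conv_radius F \<ge> 1"
  shows "((\<lambda>n. fps_nth F n * ex \<tau> ^ n) has_sum eval_fps F (ex \<tau>)) UNIV"
  using norm_ex_less_radius[OF assms]
  by (intro norm_summable_imp_has_sum norm_summable_fps sums_eval_fps)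

lemma fps_conv_radius_geI_ex:
  assumes "\<And>\<tau>. Im \<tau> > 0 \<Longrightarrow> summable (\<lambda>n. fps_nth F n * ex \<tau> ^ n)"
  shows "fps_conv_radius F \<ge> 1"
  unfolding fps_conv_radius_def
proof (rule conv_radius_geI_ex)
  fix r :: real assume r: "0 < r" "ereal r < 1"
  define \<tau> where "\<tau> = - \<i> * of_real (ln r) / (2 * of_real pi)"
  have "ln r < 0" using r by (simp add: one_ereal_def)
  hence "Im \<tau> > 0"
    by (simp add: \<tau>_def divide_neg_pos)
  from assms[OF this] show "\<exists>z. norm z = r \<and> summable (\<lambda>n. fps_nth F n * z ^ n)"
    using r by (intro exI[of _ "ex \<tau>"]) (auto simp: norm_ex \<tau>_def)
qed

definition eta :: "complex \<Rightarrow> complex" where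
  "eta \<tau> = ex (\<tau> / 24) * exp (- eval_fps log_fps (ex \<tau>))"

lemma eta_nonzero [simp]: "eta \<tau> \<noteq> 0"
  by (simp add: eta_def)

lemma eta_add_1: "eta (\<tau> + 1) = ex (1 / 24) * eta \<tau>"
  by (simp add: eta_def ex_add add_divide_distrib)

lemma has_field_derivative_eta:
  assumes "Im \<tau> > 0"
  shows "(eta has_field_derivative of_real pi * \<i> / 12 * G2 \<tau> * eta \<tau>) (at \<tau>)"
proof -
  note [derivative_intros] = has_field_derivative_eval_fps_ex[OF norm_ex_less_radius[OF assms fps_conv_radius_log_fps],
      unfolded fps_theta_log_fps]
  have "((\<lambda>\<tau>. ex (\<tau> / 24) * exp (- eval_fps log_fps (ex \<tau>))) has_field_derivative
          of_real pi * \<i> / 12 * G2 \<tau> * eta \<tau>) (at \<tau>)"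
    by (auto intro!: derivative_eq_intros simp: eta_def G2_def algebra_simps)
  thus ?thesis unfolding eta_def [abs_def] .
qed

lemma holomorphic_on_eta: "eta holomorphic_on uhp"
  unfolding holomorphic_on_open[OF open_uhp] in_uhp_iff
  by (intro ballI exI) (rule has_field_derivative_eta, simp)

lemma not_nonpos_Reals_uhp: "Im \<tau> > 0 \<Longrightarrow> - (\<i> * \<tau>) \<notin> \<real>\<^sub>\<le>\<^sub>0"
  by (auto simp: complex_nonpos_Reals_iff)

text \<open>The logarithmic derivative of \<open>eta\<close> is a multiple of \<open>G2\<close>, and
  the anomalous term of \<open>G2_S\<close> accounts exactly for that of the square root. So the
  quotient h is constant, and the fixed point \<i> of the inversion gives the constant 1.\<close>

theorem eta_S:
  assumes "Im \<tau> > 0"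
  shows "eta (- (1 / \<tau>)) = csqrt (- (\<i> * \<tau>)) * eta \<tau>"
proof -
  define h where "h = (\<lambda>\<tau>. eta (- (1 / \<tau>)) / (csqrt (- (\<i> * \<tau>)) * eta \<tau>))"
  have "(h has_field_derivative 0) (at \<tau>)" if \<tau>: "Im \<tau> > 0" for \<tau>
  proof -
    define c where "c = csqrt (- (\<i> * \<tau>))"
    have \<tau>': "Im (- (1 / \<tau>)) > 0" "\<tau> \<noteq> 0" "c \<noteq> 0"
      using \<tau> Im_minus_inverse_pos[of \<tau>] by (auto simp: c_def)
    have c2: "c * c = - (\<i> * \<tau>)"
      by (simp add: c_def flip: power2_eq_square)
    define d where "d = of_real pi * \<i> / 12 * G2 (- (1 / \<tau>)) * eta (- (1 / \<tau>)) / \<tau>\<^sup>2"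
    have d1: "((\<lambda>\<tau>. eta (- (1 / \<tau>))) has_field_derivative d) (at \<tau>)"
    proof -
      have "((\<lambda>\<tau>. - (1 / \<tau>)) has_field_derivative 1 / \<tau>\<^sup>2) (at \<tau>)"
        using \<tau>' by (auto intro!: derivative_eq_intros simp: power2_eq_square)
      from DERIV_chain2[OF has_field_derivative_eta[OF \<tau>'(1)] this] show ?thesis
        by (simp add: d_def)
    qed
    have d2: "((\<lambda>\<tau>. csqrt (- (\<i> * \<tau>))) has_field_derivative (- \<i> / (2 * c))) (at \<tau>)"
      unfolding c_def by (rule derivative_eq_intros refl not_nonpos_Reals_uhp \<tau>)+ simp
    have "((\<lambda>\<tau>. eta (- (1 / \<tau>)) / (csqrt (- (\<i> * \<tau>)) * eta \<tau>)) has_field_derivative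
            (d * (c * eta \<tau>) - eta (- (1 / \<tau>)) * ((- \<i> / (2 * c)) * eta \<tau> +
              (of_real pi * \<i> / 12 * G2 \<tau> * eta \<tau>) * c)) / ((c * eta \<tau>) * (c * eta \<tau>))) (at \<tau>)"
      using \<tau>' unfolding c_def
      by (intro DERIV_divide DERIV_mult d1 d2[unfolded c_def] has_field_derivative_eta \<tau>) auto
    also have "d * (c * eta \<tau>) - eta (- (1 / \<tau>)) * ((- \<i> / (2 * c)) * eta \<tau> +
              (of_real pi * \<i> / 12 * G2 \<tau> * eta \<tau>) * c) =
         eta (- (1 / \<tau>)) * eta \<tau> / c * (of_real pi * \<i> / 12 * (G2 (- (1 / \<tau>)) / \<tau>\<^sup>2 - G2 \<tau>) * (c * c) + \<i> / 2)"
      using \<tau>' by (simp add: d_def divide_simps) (simp add: algebra_simps)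
    also have "of_real pi * \<i> / 12 * (G2 (- (1 / \<tau>)) / \<tau>\<^sup>2 - G2 \<tau>) * (c * c) + \<i> / 2 = 0"
      unfolding G2_S[OF \<tau>] c2 using \<tau>' by (simp add: divide_simps power2_eq_square)
    finally show ?thesis by (simp add: h_def)
  qed
  hence "\<exists>c. \<forall>\<tau>\<in>uhp. h \<tau> = c"
    by (intro has_field_derivative_zero_constant convex_uhp) (auto intro: has_field_derivative_at_within)
  then obtain c where c: "\<And>\<tau>. \<tau> \<in> uhp \<Longrightarrow> h \<tau> = c" by blast
  have "h \<i> = 1"
    by (simp add: h_def divide_i)
  hence "h \<tau> = 1"
    using c[of \<i>] c[of \<tau>] assms by simp
  moreover have "\<tau> \<noteq> 0" using assms by auto
  ultimately show ?thesis
    by (simp add: h_def field_simps)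
qed

lemma eta_24: "eta \<tau> ^ 24 = ex \<tau> * exp (- eval_fps log_fps (ex \<tau>)) ^ 24"
  by (simp add: eta_def power_mult_distrib flip: ex_mult_nat)

lemma eta_24_S: "Im \<tau> > 0 \<Longrightarrow> eta (- (1 / \<tau>)) ^ 24 = \<tau> ^ 12 * eta \<tau> ^ 24"
proof -
  have "csqrt (- (\<i> * \<tau>)) ^ 24 = (csqrt (- (\<i> * \<tau>)) ^ 2) ^ 12"
    unfolding power_mult [symmetric] by simp
  also have "\<dots> = \<tau> ^ 12"
    by (simp add: power_mult_distrib)
  finally show "Im \<tau> > 0 \<Longrightarrow> ?thesis"
    by (simp add: eta_S power_mult_distrib)
qed

section \<open>Integer power series\<close>

definition cfps :: "int fps \<Rightarrow> complex fps" where
  "cfps f = Abs_fps (\<lambda>n. of_int (fps_nth f n))"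

lemma cfps_nth [simp]: "fps_nth (cfps f) n = of_int (fps_nth f n)"
  by (simp add: cfps_def)

lemma cfps_1 [simp]: "cfps 1 = 1"
  and cfps_diff: "cfps (f - g) = cfps f - cfps g"
  and cfps_minus: "cfps (- f) = - cfps f"
  and cfps_mult: "cfps (f * g) = cfps f * cfps g"
  and cfps_const: "cfps (fps_const c) = fps_const (of_int c)"
  and cfps_X: "cfps fps_X = fps_X"
  and cfps_deriv: "cfps (fps_deriv f) = fps_deriv (cfps f)"
  by (rule fps_ext; simp add: fps_mult_nth fps_X_nth)+

lemma cfps_power: "cfps (f ^ n) = cfps f ^ n"
  by (induction n) (simp_all add: cfps_mult)

lemma cfps_inj: "cfps f = cfps g \<longleftrightarrow> f = g"
  by (auto simp: fps_eq_iff)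

text \<open>As S has no constant term, the coefficient of the equation at q^n expresses n times the
  n-th coefficient of F by the earlier ones. This serves to identify the formal product
  \<open>qq_inf\<close> with the exponential of a convergent series.\<close>

lemma fps_theta_eq_unique:
  assumes "fps_theta F = F * S" "fps_theta G = G * S" "fps_nth F 0 = fps_nth G 0" "fps_nth S 0 = 0"
  shows "F = G"
proof (rule fps_ext)
  fix n
  show "fps_nth F n = fps_nth G n"
  proof (induction n rule: less_induct)
    case (less n)
    show ?case
    proof (cases "n = 0")
      case False
      have "fps_nth (F * S) n = fps_nth (G * S) n"
        unfolding fps_mult_nth
      proof (rule sum.cong[OF refl])
        fix i assume "i \<in> {0..n}"
        thus "fps_nth F i * fps_nth S (n - i) = fps_nth G i * fps_nth S (n - i)"
          using less.IH[of i] assms(4) by (cases "i = n") auto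
      qed
      hence "of_nat n * fps_nth F n = of_nat n * fps_nth G n"
        by (simp flip: fps_nth_theta add: assms)
      thus ?thesis using False by simp
    qed (use assms in simp)
  qed
qed

lemma exp_log_fps:
  fixes c :: complex
  defines "F \<equiv> fps_expansion (\<lambda>w. exp (c * eval_fps log_fps w)) 0"
  shows "fps_conv_radius F \<ge> 1" "norm w < 1 \<Longrightarrow> eval_fps F w = exp (c * eval_fps log_fps w)"
    "fps_nth F 0 = 1" "fps_theta F = F * (fps_const c * divisor_fps 1)"
proof -
  define h where "h = (\<lambda>w. exp (c * eval_fps log_fps w))"
  have "(eval_fps log_fps) holomorphic_on eball 0 1"
    by (intro holomorphic_on_eval_fps eball_mono fps_conv_radius_log_fps)
  hence hol: "h holomorphic_on eball 0 1"
    unfolding h_def by (intro holomorphic_intros eball_mono fps_conv_radius_log_fps)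
  show rad: "fps_conv_radius F \<ge> 1"
    unfolding F_def h_def[symmetric] by (rule conv_radius_fps_expansion[OF hol])
  show eval: "eval_fps F w = exp (c * eval_fps log_fps w)" if "norm w < 1" for w
    unfolding F_def h_def[symmetric]
    by (subst eval_fps_expansion'[OF hol]) (use that in \<open>simp_all add: h_def one_ereal_def\<close>)
  show "fps_nth F 0 = 1"
    using eval[of 0] by (simp add: eval_fps_at_0 log_fps_def)
  have F: "h has_fps_expansion F"
    unfolding F_def h_def[symmetric]
    by (rule has_fps_expansion_fps_expansion[of "eball 0 1"]) (use hol in \<open>auto simp: zero_ereal_def one_ereal_def\<close>)
  have rad': "fps_conv_radius (fps_deriv log_fps) > 0"
    by (rule less_le_trans[OF _ order_trans[OF fps_conv_radius_log_fps fps_conv_radius_deriv]]) simp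
  have h': "deriv h has_fps_expansion fps_deriv F"
    by (rule has_fps_expansion_deriv[OF F])
  have rhs: "(\<lambda>w. h w * (c * eval_fps (fps_deriv log_fps) w)) has_fps_expansion
      F * (fps_const c * fps_deriv log_fps)"
    by (intro fps_expansion_intros F eval_fps_has_fps_expansion rad')
  have "eventually (\<lambda>w. w \<in> ball 0 1) (nhds (0::complex))"
    by (intro eventually_nhds_in_open) auto
  hence ev: "eventually (\<lambda>w. deriv h w = h w * (c * eval_fps (fps_deriv log_fps) w)) (nhds 0)"
  proof eventually_elim
    case (elim w)
    have "ereal (norm w) < fps_conv_radius log_fps"
      by (rule less_le_trans[OF _ fps_conv_radius_log_fps]) (use elim in \<open>simp add: one_ereal_def\<close>)
    hence "(h has_field_derivative h w * (c * eval_fps (fps_deriv log_fps) w)) (at w)"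
      unfolding h_def by (auto intro!: derivative_eq_intros has_field_derivative_eval_fps simp: mult_ac)
    thus ?case by (rule DERIV_imp_deriv)
  qed
  have "deriv h has_fps_expansion F * (fps_const c * fps_deriv log_fps)"
    using rhs has_fps_expansion_cong[OF ev refl] by simp
  hence "fps_deriv F = F * (fps_const c * fps_deriv log_fps)"
    by (rule fps_expansion_unique_complex[OF h'])
  thus "fps_theta F = F * (fps_const c * divisor_fps 1)"
    unfolding fps_theta_def fps_theta_log_fps[unfolded fps_theta_def, symmetric] by (simp only: mult_ac)
qed

definition sigma1_fps :: "int fps" where
  "sigma1_fps = Abs_fps (\<lambda>n. int (\<Sum>d | d dvd n. d))"

lemma cfps_sigma1: "cfps sigma1_fps = divisor_fps 1"
  by (rule fps_ext) (simp add: sigma1_fps_def divisor_fps_def)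

lemma qq_inf_nth_eq_prod:
  assumes "n \<le> m"
  shows "fps_nth (\<Prod>i\<le>m. 1 - fps_X ^ Suc i) n = fps_nth qq_inf n"
proof -
  define P where "P = (\<lambda>m. \<Prod>i\<le>m. 1 - fps_X ^ Suc i :: int fps)"
  have stable: "fps_nth (P k) n = fps_nth (P n) n" if "n \<le> k" for k n
    using that
  proof (induction k rule: dec_induct)
    case (step k)
    have "P (Suc k) = P k * (1 - fps_X ^ Suc (Suc k))"
      by (simp add: P_def)
    thus ?case
      using step nth_one_minus_X_power_mult[of n "Suc (Suc k)" "P k"] by simp
  qed auto
  have "P \<longlonglongrightarrow> Abs_fps (\<lambda>n. fps_nth (P n) n)"
    by (rule tendsto_fpsI) (auto simp: eventually_sequentially intro!: exI stable)
  moreover have "P \<longlonglongrightarrow> qq_inf"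
    using has_prod_imp_tendsto[OF qq_inf_has_prod] by (simp add: P_def)
  ultimately have "qq_inf = Abs_fps (\<lambda>n. fps_nth (P n) n)"
    using LIMSEQ_unique by blast
  hence "fps_nth qq_inf n = fps_nth (P n) n"
    by (metis fps_nth_Abs_fps)
  thus ?thesis
    using stable[OF assms] by (simp only: P_def)
qed

text \<open>With respect to q d/dq, the factor 1 - q^k has logarithmic derivative -k q^k / (1 -
  q^k); here \<open>B k\<close> is q^k / (1 - q^k). The sum of k \<open>B k\<close> is the
  \<sigma>-series, and each coefficient involves only finitely many factors, so partial products
  suffice.\<close>

lemma qq_inf_deriv: "fps_X * fps_deriv qq_inf = - (qq_inf * sigma1_fps)"
proof -
  define P where "P = (\<lambda>m. \<Prod>i\<le>m. 1 - fps_X ^ Suc i :: int fps)"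
  define B where "B = (\<lambda>k. Abs_fps (\<lambda>n. if k dvd n \<and> n > 0 then 1 else 0) :: int fps)"
  have B: "(1 - fps_X ^ Suc k) * B (Suc k) = fps_X ^ Suc k" for k
  proof (rule fps_ext)
    fix n
    have "fps_nth ((1 - fps_X ^ Suc k) * B (Suc k)) n =
        fps_nth (B (Suc k)) n - (if n < Suc k then 0 else fps_nth (B (Suc k)) (n - Suc k))"
      by (simp add: left_diff_distrib fps_X_power_mult_nth del: power_Suc)
    also have "\<dots> = fps_nth (fps_X ^ Suc k) n"
      by (auto simp: B_def fps_X_power_nth dvd_minus_self simp del: power_Suc dest: dvd_imp_le)
    finally show "fps_nth ((1 - fps_X ^ Suc k) * B (Suc k)) n = fps_nth (fps_X ^ Suc k) n" .
  qed
  have D: "fps_X * fps_deriv (1 - fps_X ^ Suc k :: int fps) = - ((1 - fps_X ^ Suc k) * (fps_const (int (Suc k)) * B (Suc k)))" for k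
  proof -
    have "fps_X * fps_deriv (1 - fps_X ^ Suc k :: int fps) = - (fps_const (int (Suc k)) * fps_X ^ Suc k)"
    proof (rule fps_ext)
      fix n
      show "fps_nth (fps_X * fps_deriv (1 - fps_X ^ Suc k :: int fps)) n =
              fps_nth (- (fps_const (int (Suc k)) * fps_X ^ Suc k)) n"
        unfolding fps_mult_fps_X_deriv_shift by (auto simp: fps_X_power_nth simp del: power_Suc)
    qed
    also have "\<dots> = - ((1 - fps_X ^ Suc k) * (fps_const (int (Suc k)) * B (Suc k)))"
      unfolding mult.left_commute[of "1 - fps_X ^ Suc k"] B ..
    finally show ?thesis .
  qed
  have P: "fps_X * fps_deriv (P m) = - (P m * (\<Sum>k\<le>m. fps_const (int (Suc k)) * B (Suc k)))" for m
  proof (induction m)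
    case 0
    show ?case using D[of 0] by (simp add: P_def)
  next
    case (Suc m)
    have "P (Suc m) = P m * (1 - fps_X ^ Suc (Suc m))"
      by (simp add: P_def)
    hence "fps_X * fps_deriv (P (Suc m)) =
        P m * (fps_X * fps_deriv (1 - fps_X ^ Suc (Suc m))) + (fps_X * fps_deriv (P m)) * (1 - fps_X ^ Suc (Suc m))"
      by (simp only: fps_deriv_mult distrib_left mult_ac)
    also have "\<dots> = - (P (Suc m) * (\<Sum>k\<le>Suc m. fps_const (int (Suc k)) * B (Suc k)))"
    proof -
      have "p * - (u * v) + - (p * s) * u = - (p * u * (s + v))" for p u v s :: "int fps"
        by (simp add: algebra_simps)
      thus ?thesis unfolding D Suc.IH \<open>P (Suc m) = _\<close> sum.atMost_Suc .
    qed
    finally show ?case .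
  qed
  have S: "fps_nth (\<Sum>k\<le>m. fps_const (int (Suc k)) * B (Suc k)) n = fps_nth sigma1_fps n" if "n \<le> m" for n m
  proof -
    have "fps_nth (\<Sum>k\<le>m. fps_const (int (Suc k)) * B (Suc k)) n = (\<Sum>k\<le>m. if Suc k dvd n \<and> n > 0 then int (Suc k) else 0)"
      by (simp add: fps_sum_nth B_def if_distrib cong: if_cong del: of_nat_Suc)
    also have "\<dots> = (\<Sum>d\<in>{Suc 0..Suc m}. if d dvd n \<and> n > 0 then int d else 0)"
      unfolding sum.atLeast1_atMost_eq lessThan_Suc_atMost ..
    also have "\<dots> = (\<Sum>d\<in>{d\<in>{Suc 0..Suc m}. d dvd n \<and> n > 0}. int d)"
      by (rule sum.inter_filter [symmetric]) simp
    also have "\<dots> = fps_nth sigma1_fps n"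
    proof (cases "n = 0")
      case False
      hence "{d\<in>{Suc 0..Suc m}. d dvd n \<and> n > 0} = {d. d dvd n}"
        using that by (auto dest: dvd_imp_le intro!: Suc_leI Nat.gr0I)
      thus ?thesis by (simp add: sigma1_fps_def)
    qed (simp add: sigma1_fps_def)
    finally show ?thesis .
  qed
  show ?thesis
  proof (rule fps_ext)
    fix n
    have "fps_nth (fps_X * fps_deriv qq_inf) n = fps_nth (fps_X * fps_deriv (P n)) n"
      unfolding fps_mult_fps_X_deriv_shift P_def fps_nth_Abs_fps qq_inf_nth_eq_prod[OF order_refl] ..
    also have "\<dots> = - fps_nth (P n * (\<Sum>k\<le>n. fps_const (int (Suc k)) * B (Suc k))) n"
      unfolding P by simp
    also have "fps_nth (P n * (\<Sum>k\<le>n. fps_const (int (Suc k)) * B (Suc k))) n = fps_nth (qq_inf * sigma1_fps) n"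
      unfolding fps_mult_nth
    proof (rule sum.cong[OF refl])
      fix i assume "i \<in> {0..n}"
      hence "i \<le> n" "n - i \<le> n" by auto
      thus "fps_nth (P n) i * fps_nth (\<Sum>k\<le>n. fps_const (int (Suc k)) * B (Suc k)) (n - i) =
              fps_nth qq_inf i * fps_nth sigma1_fps (n - i)"
        by (simp only: S) (simp only: P_def qq_inf_nth_eq_prod)
    qed
    finally show "fps_nth (fps_X * fps_deriv qq_inf) n = fps_nth (- (qq_inf * sigma1_fps)) n"
      by simp
  qed
qed

definition inv_qq :: "int fps" where
  "inv_qq = fps_right_inverse qq_inf 1"

lemma qq_inf_inv_qq: "qq_inf * inv_qq = 1"
  unfolding inv_qq_def by (rule fps_right_inverse) (simp add: qq_inf_nth_0)

lemma cfps_qq_inf: "cfps qq_inf = fps_expansion (\<lambda>w. exp (- eval_fps log_fps w)) 0"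
proof -
  have "fps_theta (cfps qq_inf) = cfps qq_inf * (fps_const (-1) * divisor_fps 1)"
    using arg_cong[OF qq_inf_deriv, of cfps]
    by (simp add: fps_theta_def cfps_mult cfps_deriv cfps_X cfps_minus cfps_sigma1 flip: fps_const_neg)
  thus ?thesis
    using exp_log_fps(4)[of "-1", unfolded mult_minus1]
    by (rule fps_theta_eq_unique)
       (simp_all add: exp_log_fps(3)[of "-1", unfolded mult_minus1] qq_inf_nth_0 divisor_fps_def)
qed

lemma cfps_inv_qq: "cfps inv_qq = fps_expansion (\<lambda>w. exp (eval_fps log_fps w)) 0"
proof -
  have "fps_X * (qq_inf * fps_deriv inv_qq + fps_deriv qq_inf * inv_qq) = 0"
    using arg_cong[OF qq_inf_inv_qq, of fps_deriv] by simp
  hence "qq_inf * (fps_X * fps_deriv inv_qq) = - (fps_X * fps_deriv qq_inf) * inv_qq"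
    by (simp add: algebra_simps eq_neg_iff_add_eq_0)
  also have "\<dots> = qq_inf * (inv_qq * sigma1_fps)"
    unfolding qq_inf_deriv by (simp add: algebra_simps)
  finally have "fps_X * fps_deriv inv_qq = inv_qq * sigma1_fps"
  proof -
    assume "qq_inf * (fps_X * fps_deriv inv_qq) = qq_inf * (inv_qq * sigma1_fps)"
    hence "inv_qq * (qq_inf * (fps_X * fps_deriv inv_qq)) = inv_qq * (qq_inf * (inv_qq * sigma1_fps))"
      by (rule arg_cong)
    thus ?thesis
      by (simp only: mult.assoc [symmetric] mult.commute[of inv_qq qq_inf] qq_inf_inv_qq mult_1_left)
  qed
  hence "fps_theta (cfps inv_qq) = cfps inv_qq * (fps_const 1 * divisor_fps 1)"
    by (simp only: fps_theta_def cfps_sigma1 [symmetric] cfps_X [symmetric] cfps_deriv [symmetric]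
          cfps_mult [symmetric] fps_const_1_eq_1 mult_1_left)
  thus ?thesis
    using exp_log_fps(4)[of 1, unfolded mult_1_left]
    by (rule fps_theta_eq_unique)
       (simp_all add: exp_log_fps(3)[of 1, unfolded mult_1_left] inv_qq_def divisor_fps_def)
qed

lemma fps_conv_radius_qq_inf: "fps_conv_radius (cfps qq_inf) \<ge> 1"
  and eval_qq_inf: "norm w < 1 \<Longrightarrow> eval_fps (cfps qq_inf) w = exp (- eval_fps log_fps w)"
  and fps_conv_radius_inv_qq: "fps_conv_radius (cfps inv_qq) \<ge> 1"
  and eval_inv_qq: "norm w < 1 \<Longrightarrow> eval_fps (cfps inv_qq) w = exp (eval_fps log_fps w)"
  unfolding cfps_qq_inf cfps_inv_qq
  by (rule exp_log_fps(1)[of "-1", unfolded mult_minus1] exp_log_fps(1)[of 1, unfolded mult_1_left]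
        exp_log_fps(2)[of _ "-1", unfolded mult_minus1] exp_log_fps(2)[of _ 1, unfolded mult_1_left]; assumption)+

lemma cfps_E4: "cfps E4 = 1 + 240 * divisor_fps 3"
proof (rule fps_ext)
  fix n
  show "fps_nth (cfps E4) n = fps_nth (1 + 240 * divisor_fps 3) n"
    by (cases "n = 0") (auto simp: E4_def divisor_fps_def sigma3_def fps_mult_numeral_left)
qed

lemma fps_conv_radius_addI:
  fixes f g :: "complex fps"
  shows "fps_conv_radius f \<ge> r \<Longrightarrow> fps_conv_radius g \<ge> r \<Longrightarrow> fps_conv_radius (f + g) \<ge> r"
  using fps_conv_radius_add[of f g] by (meson min.boundedI order_trans)

lemma fps_conv_radius_diffI:
  fixes f g :: "complex fps"
  shows "fps_conv_radius f \<ge> r \<Longrightarrow> fps_conv_radius g \<ge> r \<Longrightarrow> fps_conv_radius (f - g) \<ge> r"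
  using fps_conv_radius_diff[of f g] by (meson min.boundedI order_trans)

lemma fps_conv_radius_multI:
  fixes f g :: "complex fps"
  shows "fps_conv_radius f \<ge> r \<Longrightarrow> fps_conv_radius g \<ge> r \<Longrightarrow> fps_conv_radius (f * g) \<ge> r"
  using fps_conv_radius_mult[of f g] by (meson min.boundedI order_trans)

lemma fps_conv_radius_powerI:
  fixes f :: "complex fps"
  shows "fps_conv_radius f \<ge> r \<Longrightarrow> fps_conv_radius (f ^ n) \<ge> r"
  using fps_conv_radius_power[of f n] by (meson order_trans)

lemma fps_conv_radius_E4: "fps_conv_radius (cfps E4) \<ge> 1"
  unfolding cfps_E4
  by (intro fps_conv_radius_addI fps_conv_radius_multI fps_conv_radius_divisor) simp_all

lemma eval_E4:
  assumes "Im \<tau> > 0"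
  shows "eval_fps (cfps E4) (ex \<tau>) = G4 \<tau>"
proof -
  have "fps_conv_radius (240 * divisor_fps 3) \<ge> 1"
    by (intro fps_conv_radius_multI fps_conv_radius_divisor) simp_all
  thus ?thesis
    unfolding cfps_E4 G4_def
    using norm_ex_less_radius[OF assms, of "240 * divisor_fps 3"]
      norm_ex_less_radius[OF assms fps_conv_radius_divisor[of 3]]
    by (simp add: eval_fps_add eval_fps_mult)
qed

section \<open>Weakly holomorphic modular forms of weight 4\<close>

lemma periodic_int:
  assumes "\<And>\<tau>. Im \<tau> > 0 \<Longrightarrow> g (\<tau> + 1) = g \<tau>" "Im \<tau> > 0"
  shows "g (\<tau> + of_int k) = (g \<tau> :: complex)"
proof (induction k rule: int_induct[of _ 0])
  case (step1 k)
  thus ?case using assms(1)[of "\<tau> + of_int k"] assms(2) by (simp add: add_ac)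
next
  case (step2 k)
  thus ?case using assms(1)[of "\<tau> + of_int (k - 1)"] assms(2) by (simp add: add_ac)
qed simp

text \<open>Translations and the inversion move every point into the half-strip |Re| \<le> 1/2, Im
  \<ge> 1/2, which is larger than a fundamental domain but good enough: near the cusp g is smaller
  than at \<tau>, so the supremum is attained on a compact rectangle and g is constant. A nonzero
  constant contradicts the decay at the cusp.\<close>

lemma modular_function_vanish:
  assumes hol: "g holomorphic_on uhp"
  assumes T: "\<And>\<tau>. Im \<tau> > 0 \<Longrightarrow> g (\<tau> + 1) = g \<tau>"
  assumes S: "\<And>\<tau>. Im \<tau> > 0 \<Longrightarrow> g (- (1 / \<tau>)) = g \<tau>"
  assumes cusp: "\<And>\<epsilon>. \<epsilon> > 0 \<Longrightarrow> \<exists>Y. \<forall>\<tau>. Im \<tau> > Y \<longrightarrow> norm (g \<tau>) < \<epsilon>"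
  assumes \<tau>: "Im \<tau> > 0"
  shows "g \<tau> = 0"
proof (rule ccontr)
  assume nz: "g \<tau> \<noteq> 0"
  have shift: "\<exists>\<sigma>. Im \<sigma> = Im \<tau> \<and> \<bar>Re \<sigma>\<bar> \<le> 1 / 2 \<and> g \<sigma> = g \<tau>" if "Im \<tau> > 0" for \<tau>
    using periodic_int[of g \<tau> "- round (Re \<tau>)"] T that of_int_round_abs_le[of "Re \<tau>"]
    by (intro exI[of _ "\<tau> + of_int (- round (Re \<tau>))"]) (auto simp: abs_minus_commute)
  \<comment> \<open>Induction on the height: if |Re| \<le> 1/2 and Im < 1/2, then the squared
    modulus is at most 1/2 and the inversion at least doubles the imaginary part.\<close>
  have reduce: "\<exists>\<sigma>. Im \<sigma> \<ge> 1 / 2 \<and> \<bar>Re \<sigma>\<bar> \<le> 1 / 2 \<and> g \<sigma> = g \<tau>"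
    if "Im \<tau> \<ge> 1 / 2 / 2 ^ n" for \<tau> n
    using that
  proof (induction n arbitrary: \<tau>)
    case 0
    moreover from 0 obtain \<sigma> where "Im \<sigma> = Im \<tau>" "\<bar>Re \<sigma>\<bar> \<le> 1 / 2" "g \<sigma> = g \<tau>"
      using shift[of \<tau>] by auto
    ultimately show ?case by (intro exI[of _ \<sigma>]) simp
  next
    case (Suc n)
    have pos: "Im \<tau> > 0"
      by (rule less_le_trans[OF _ Suc.prems]) simp
    obtain \<sigma> where \<sigma>: "Im \<sigma> = Im \<tau>" "\<bar>Re \<sigma>\<bar> \<le> 1 / 2" "g \<sigma> = g \<tau>"
      using shift[OF pos] by blast
    show ?case
    proof (cases "Im \<sigma> \<ge> 1 / 2")
      case False
      have "(Re \<sigma>)\<^sup>2 \<le> (1 / 2)\<^sup>2" "(Im \<sigma>)\<^sup>2 \<le> (1 / 2)\<^sup>2"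
        using \<sigma> False pos by (simp_all add: abs_le_square_iff [symmetric])
      hence "(norm \<sigma>)\<^sup>2 \<le> 1 / 2"
        unfolding cmod_power2 by (simp add: power_divide)
      moreover have "\<sigma> \<noteq> 0" using \<sigma>(1) pos by auto
      ultimately have *: "Im \<sigma> / (1 / 2) \<le> Im \<sigma> / (norm \<sigma>)\<^sup>2"
        using \<sigma>(1) pos by (intro divide_left_mono) auto
      have "1 / 2 / 2 ^ n \<le> Im \<sigma> / (1 / 2)"
        using Suc.prems \<sigma>(1) by (simp add: field_simps)
      also note *
      also have "Im \<sigma> / (norm \<sigma>)\<^sup>2 = Im (- (1 / \<sigma>))"
        by (rule Im_minus_inverse [symmetric])
      finally have "Im (- (1 / \<sigma>)) \<ge> 1 / 2 / 2 ^ n" .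
      from Suc.IH[OF this] show ?thesis
        using S[of \<sigma>] \<sigma> pos by simp
    qed (use \<sigma> in \<open>intro exI[of _ \<sigma>], simp\<close>)
  qed
  have reduce': "\<exists>\<sigma>. Im \<sigma> \<ge> 1 / 2 \<and> \<bar>Re \<sigma>\<bar> \<le> 1 / 2 \<and> g \<sigma> = g \<tau>" if pos: "Im \<tau> > 0" for \<tau>
  proof -
    obtain n where "(1 / 2) ^ n < Im \<tau>"
      using real_arch_pow_inv[OF pos, of "1 / 2"] by auto
    hence "Im \<tau> \<ge> 1 / 2 / 2 ^ n"
      by (simp add: power_divide field_simps)
    thus ?thesis by (rule reduce)
  qed
  obtain Y where Y: "\<And>\<sigma>. Im \<sigma> > Y \<Longrightarrow> norm (g \<sigma>) < norm (g \<tau>)"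
    using cusp[of "norm (g \<tau>)"] nz by auto
  define K where "K = cbox (Complex (-1/2) (1/2)) (Complex (1/2) (max Y 1))"
  have K: "z \<in> K \<longleftrightarrow> \<bar>Re z\<bar> \<le> 1 / 2 \<and> Im z \<ge> 1 / 2 \<and> Im z \<le> max Y 1" for z
    by (auto simp: K_def in_cbox_complex_iff)
  have "K \<subseteq> uhp" by (auto simp: K)
  have compact: "compact K"
    unfolding K_def by (rule compact_cbox)
  have "\<i> \<in> K"
    by (simp add: K)
  hence nonempty: "K \<noteq> {}" by blast
  have "continuous_on K (\<lambda>z. norm (g z))"
    by (intro continuous_on_norm continuous_on_subset[OF holomorphic_on_imp_continuous_on[OF hol] \<open>K \<subseteq> uhp\<close>])
  from continuous_attains_sup[OF compact nonempty this]
  obtain \<xi> where \<xi>: "\<xi> \<in> K" "\<And>z. z \<in> K \<Longrightarrow> norm (g z) \<le> norm (g \<xi>)"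
    by blast
  have in_K: "norm (g z) \<le> norm (g \<xi>) \<or> norm (g z) < norm (g \<tau>)" if z: "Im z > 0" for z
  proof -
    obtain \<sigma> where \<sigma>: "Im \<sigma> \<ge> 1 / 2" "\<bar>Re \<sigma>\<bar> \<le> 1 / 2" "g \<sigma> = g z"
      using reduce'[OF z] by blast
    show ?thesis
    proof (cases "Im \<sigma> \<le> max Y 1")
      case True
      thus ?thesis using \<xi>(2)[of \<sigma>] \<sigma> by (auto simp: K)
    next
      case False
      thus ?thesis using Y[of \<sigma>] \<sigma> by simp
    qed
  qed
  have max: "norm (g z) \<le> norm (g \<xi>)" if "z \<in> uhp" for z
    using in_K[of z] in_K[OF \<tau>] that by auto
  have "g constant_on uhp"
    by (rule maximum_modulus_principle[OF hol open_uhp connected_uhp open_uhp order_refl, of \<xi>])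
       (use \<xi>(1) \<open>K \<subseteq> uhp\<close> max in auto)
  hence "g (\<i> * of_real (max Y 1 + 1)) = g \<tau>"
    using \<tau> unfolding constant_on_def by (auto simp: max_def)
  moreover have "norm (g (\<i> * of_real (max Y 1 + 1))) < norm (g \<tau>)"
    by (rule Y) auto
  ultimately show False by simp
qed

text \<open>The cube of q F divided by \<Delta> = \<open>eta ^ 24\<close> has weight 12 - 12 = 0 and
  is holomorphic because \<Delta> has no zeros. It is q^2 times a function regular at q = 0, so it
  vanishes at the cusp and hence everywhere.\<close>

lemma weight_4_cusp_form_vanish:
  assumes F: "fps_conv_radius F \<ge> 1"
  assumes S: "\<And>\<tau>. Im \<tau> > 0 \<Longrightarrow>
    ex (- (1 / \<tau>)) * eval_fps F (ex (- (1 / \<tau>))) = \<tau> ^ 4 * (ex \<tau> * eval_fps F (ex \<tau>))"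
  shows "F = 0"
proof -
  define k where "k = (\<lambda>w. eval_fps F w ^ 3 / exp (- eval_fps log_fps w) ^ 24)"
  define g where "g = (\<lambda>\<tau>. (ex \<tau> * eval_fps F (ex \<tau>)) ^ 3 / eta \<tau> ^ 24)"
  have g_eq: "g \<tau> = ex \<tau> ^ 2 * k (ex \<tau>)" for \<tau>
    by (simp add: g_def k_def eta_24 power_mult_distrib power2_eq_square power3_eq_cube)
  have "g \<tau> = 0" if \<tau>: "Im \<tau> > 0" for \<tau>
  proof (rule modular_function_vanish[OF _ _ _ _ \<tau>])
    have "(eval_fps F \<circ> ex) holomorphic_on uhp"
      by (rule holomorphic_on_compose_gen[OF _ holomorphic_on_eval_fps[of "eball 0 1"]])
         (use eball_mono[OF F] in \<open>auto intro!: holomorphic_intros simp: norm_ex_less_1_iff one_ereal_def\<close>)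
    thus "g holomorphic_on uhp"
      unfolding g_def o_def by (intro holomorphic_intros holomorphic_on_eta) auto
  next
    fix \<tau> :: complex assume "Im \<tau> > 0"
    show "g (\<tau> + 1) = g \<tau>"
      by (simp add: g_eq ex_add)
  next
    fix \<tau> :: complex assume \<tau>: "Im \<tau> > 0"
    moreover have "\<tau> \<noteq> 0" using \<tau> by auto
    ultimately show "g (- (1 / \<tau>)) = g \<tau>"
      unfolding g_def S[OF \<tau>] eta_24_S[OF \<tau>] by (simp add: power_mult_distrib flip: power_mult)
  next
    fix \<epsilon> :: real assume \<epsilon>: "\<epsilon> > 0"
    have "isCont (\<lambda>w. w ^ 2 * k w) 0"
      unfolding k_def
      by (intro continuous_intros continuous_at_imp_continuous_within)
         (use less_le_trans[OF _ F] less_le_trans[OF _ fps_conv_radius_log_fps] in \<open>auto intro!: continuous_intros\<close>)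
    hence "\<exists>\<delta>>0. \<forall>w. dist w 0 < \<delta> \<longrightarrow> dist (w ^ 2 * k w) (0 ^ 2 * k 0) < \<epsilon>"
      using \<epsilon> by (auto simp: continuous_at_eps_delta)
    then obtain \<delta> where \<delta>: "\<delta> > 0" "\<And>w. norm w < \<delta> \<Longrightarrow> norm (w ^ 2 * k w) < \<epsilon>"
      by auto
    have "norm (g \<tau>) < \<epsilon>" if "Im \<tau> > - ln \<delta> / (2 * pi)" for \<tau>
    proof -
      have "- 2 * pi * Im \<tau> < ln \<delta>"
        using that by (simp add: field_simps)
      hence "norm (ex \<tau>) < \<delta>"
        unfolding norm_ex using \<delta>(1) by (metis exp_less_cancel_iff exp_ln)
      thus ?thesis unfolding g_eq by (rule \<delta>(2))
    qed
    thus "\<exists>Y. \<forall>\<tau>. Im \<tau> > Y \<longrightarrow> norm (g \<tau>) < \<epsilon>" by blast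
  qed
  hence zero: "eval_fps F (ex \<tau>) = 0" if "Im \<tau> > 0" for \<tau>
    using that by (auto simp: g_def)
  have zero': "eval_fps F w = 0" if "norm w < 1" "w \<noteq> 0" for w
  proof -
    have "w = ex (ln w / (2 * of_real pi * \<i>))"
      using that by (simp add: ex_def)
    moreover from this have "Im (ln w / (2 * of_real pi * \<i>)) > 0"
      using that norm_ex_less_1_iff by metis
    ultimately show ?thesis using zero by metis
  qed
  have "eventually (\<lambda>w. w \<in> ball 0 1 - {0}) (at (0::complex))"
    by (intro eventually_at_in_open) auto
  hence ev0: "eventually (\<lambda>w. eval_fps F w = 0) (at 0)"
    by eventually_elim (use zero' in auto)
  have "isCont (eval_fps F) 0"
    by (intro continuous_intros less_le_trans[OF _ F]) auto
  hence "(eval_fps F \<longlongrightarrow> eval_fps F 0) (at 0)"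
    by (simp add: isCont_def)
  hence "eval_fps F 0 = 0"
    by (rule tendsto_unique[rotated]) (auto intro: tendsto_eventually[OF ev0])
  with ev0 have "eventually (\<lambda>w. eval_fps F w = 0) (nhds 0)"
    by (simp add: eventually_nhds_conv_at)
  hence "eval_fps F has_fps_expansion 0"
    by (subst has_fps_expansion_cong[of _ "\<lambda>_. 0"]) auto
  moreover have "eval_fps F has_fps_expansion F"
    by (intro eval_fps_has_fps_expansion less_le_trans[OF _ F]) auto
  ultimately show ?thesis
    using fps_expansion_unique_complex by blast
qed

text \<open>\<open>wform N g\<close> says that \<open>q\<^sup>-\<^sup>N g(q)\<close> is modular of weight 4 for the full modular group.\<close>

definition wform :: "nat \<Rightarrow> int fps \<Rightarrow> bool" where
  "wform N g \<longleftrightarrow> fps_conv_radius (cfps g) \<ge> 1 \<and>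
     (\<forall>\<tau>. Im \<tau> > 0 \<longrightarrow> eval_fps (cfps g) (ex (- (1 / \<tau>))) / ex (- (1 / \<tau>)) ^ N =
        \<tau> ^ 4 * (eval_fps (cfps g) (ex \<tau>) / ex \<tau> ^ N))"

lemma wform_diff_cmult:
  assumes "wform N g" "wform N h"
  shows "wform N (g - fps_const c * h)"
proof -
  have rad: "fps_conv_radius (cfps g) \<ge> 1" "fps_conv_radius (cfps h) \<ge> 1"
    using assms by (auto simp: wform_def)
  have rad': "fps_conv_radius (fps_const (of_int c) * cfps h) \<ge> 1"
    by (intro fps_conv_radius_multI rad) simp_all
  have eval: "eval_fps (cfps (g - fps_const c * h)) (ex \<tau>) =
      eval_fps (cfps g) (ex \<tau>) - of_int c * eval_fps (cfps h) (ex \<tau>)" if "Im \<tau> > 0" for \<tau>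
    using norm_ex_less_radius[OF that rad(1)] norm_ex_less_radius[OF that rad(2)]
      norm_ex_less_radius[OF that rad']
    by (simp add: cfps_diff cfps_mult cfps_const eval_fps_diff eval_fps_mult)
  have "fps_conv_radius (cfps (g - fps_const c * h)) \<ge> 1"
    unfolding cfps_diff cfps_mult cfps_const by (intro fps_conv_radius_diffI rad rad')
  moreover have "eval_fps (cfps (g - fps_const c * h)) (ex (- (1 / \<tau>))) / ex (- (1 / \<tau>)) ^ N =
        \<tau> ^ 4 * (eval_fps (cfps (g - fps_const c * h)) (ex \<tau>) / ex \<tau> ^ N)" if \<tau>: "Im \<tau> > 0" for \<tau>
  proof -
    have "eval_fps (cfps g) (ex (- (1 / \<tau>))) / ex (- (1 / \<tau>)) ^ N =
        \<tau> ^ 4 * (eval_fps (cfps g) (ex \<tau>) / ex \<tau> ^ N)"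
      and "eval_fps (cfps h) (ex (- (1 / \<tau>))) / ex (- (1 / \<tau>)) ^ N =
        \<tau> ^ 4 * (eval_fps (cfps h) (ex \<tau>) / ex \<tau> ^ N)"
      using assms \<tau> by (auto simp: wform_def)
    thus ?thesis
      unfolding eval[OF \<tau>] eval[OF Im_minus_inverse_pos[OF \<tau>]] diff_divide_distrib times_divide_eq_right [symmetric]
      by (simp only: right_diff_distrib mult.left_commute)
  qed
  ultimately show ?thesis by (simp add: wform_def)
qed

lemma wform_X_mult:
  assumes "wform (Suc N) (fps_X * g)"
  shows "wform N g"
proof -
  have "cfps g = fps_shift 1 (cfps (fps_X * g))"
    by (rule fps_ext) simp
  hence rad: "fps_conv_radius (cfps g) \<ge> 1"
    using assms by (simp add: wform_def)
  have eval: "eval_fps (cfps (fps_X * g)) (ex \<tau>) / ex \<tau> ^ Suc N = eval_fps (cfps g) (ex \<tau>) / ex \<tau> ^ N"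
    if "Im \<tau> > 0" for \<tau>
    using norm_ex_less_radius[OF that rad] by (simp add: cfps_mult cfps_X eval_fps_mult)
  show ?thesis
    unfolding wform_def
  proof (intro conjI allI impI rad)
    fix \<tau> :: complex assume \<tau>: "Im \<tau> > 0"
    have "eval_fps (cfps (fps_X * g)) (ex (- (1 / \<tau>))) / ex (- (1 / \<tau>)) ^ Suc N =
        \<tau> ^ 4 * (eval_fps (cfps (fps_X * g)) (ex \<tau>) / ex \<tau> ^ Suc N)"
      using assms \<tau> unfolding wform_def by blast
    thus "eval_fps (cfps g) (ex (- (1 / \<tau>))) / ex (- (1 / \<tau>)) ^ N =
        \<tau> ^ 4 * (eval_fps (cfps g) (ex \<tau>) / ex \<tau> ^ N)"
      unfolding eval[OF \<tau>] eval[OF Im_minus_inverse_pos[OF \<tau>]] .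
  qed
qed

text \<open>This is \<open>E4 ^ (3 * N + 1) / \<Delta> ^ N\<close>, of weight 4 (3 N + 1) - 12 N =
  4, with a pole of exact order N and leading coefficient 1.\<close>

lemma wform_basis: "wform N (E4 ^ (3 * N + 1) * inv_qq ^ (24 * N))"
proof -
  have rad: "fps_conv_radius (cfps E4 ^ n) \<ge> 1" "fps_conv_radius (cfps inv_qq ^ n) \<ge> 1" for n
    by (intro fps_conv_radius_powerI fps_conv_radius_E4 fps_conv_radius_inv_qq)+
  have eval: "eval_fps (cfps (E4 ^ (3 * N + 1) * inv_qq ^ (24 * N))) (ex \<tau>) / ex \<tau> ^ N =
          G4 \<tau> ^ (3 * N + 1) / (eta \<tau> ^ 24) ^ N" if "Im \<tau> > 0" for \<tau>
  proof -
    have "eval_fps (cfps inv_qq) (ex \<tau>) = 1 / exp (- eval_fps log_fps (ex \<tau>))"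
      using that by (simp add: eval_inv_qq norm_ex_less_1_iff exp_minus inverse_eq_divide)
    hence "eval_fps (cfps (E4 ^ (3 * N + 1) * inv_qq ^ (24 * N))) (ex \<tau>) =
            G4 \<tau> ^ (3 * N + 1) * (1 / exp (- eval_fps log_fps (ex \<tau>))) ^ (24 * N)"
      using norm_ex_less_radius[OF that rad(1)] norm_ex_less_radius[OF that rad(2)]
        norm_ex_less_radius[OF that fps_conv_radius_E4] norm_ex_less_radius[OF that fps_conv_radius_inv_qq]
      by (simp only: cfps_mult cfps_power eval_fps_mult eval_fps_power eval_E4[OF that])
    thus ?thesis
      by (simp add: eta_24 power_mult_distrib power_divide mult.commute flip: power_mult)
  qed
  have "G4 (- (1 / \<tau>)) ^ (3 * N + 1) / (eta (- (1 / \<tau>)) ^ 24) ^ N =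
          \<tau> ^ 4 * (G4 \<tau> ^ (3 * N + 1) / (eta \<tau> ^ 24) ^ N)" if "Im \<tau> > 0" for \<tau>
  proof -
    have "\<tau> \<noteq> 0" using that by auto
    moreover have "(\<tau> ^ 4) ^ (3 * N + 1) = \<tau> ^ 4 * (\<tau> ^ 12) ^ N"
      by (simp add: algebra_simps flip: power_mult power_add)
    ultimately show ?thesis
      unfolding G4_S[OF that] eta_24_S[OF that] by (simp only: power_mult_distrib) simp
  qed
  moreover have "fps_conv_radius (cfps (E4 ^ (3 * N + 1) * inv_qq ^ (24 * N))) \<ge> 1"
    unfolding cfps_mult cfps_power by (intro fps_conv_radius_multI rad)
  ultimately show ?thesis
    unfolding wform_def using eval eval[OF Im_minus_inverse_pos] by simp
qed

lemma E4_nth_0: "fps_nth E4 0 = 1"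
  by (simp add: E4_def fps_mult_numeral_left)

lemma inv_qq_nth_0: "fps_nth inv_qq 0 = 1"
  by (simp add: inv_qq_def)

lemma fps_nth_power_0_eq_1: "fps_nth f 0 = (1::int) \<Longrightarrow> fps_nth (f ^ n) 0 = 1"
  by (simp add: fps_nth_power_0)

text \<open>The basis form times the leading coefficient of g is subtracted. As the basis form has
  leading coefficient 1, everything stays integral and divisible by M, and the pole order drops by
  one. At N = 0 the difference is a cusp form of weight 4, hence 0.\<close>

theorem wform_dvd:
  assumes "wform N g" "\<And>n. n \<le> N \<Longrightarrow> M dvd fps_nth g n"
  shows "M dvd fps_nth g n"
  using assms
proof (induction N arbitrary: g n)
  case 0
  define h where "h = g - fps_const (fps_nth g 0) * (E4 ^ (3 * 0 + 1) * inv_qq ^ (24 * 0))"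
  have h: "wform 0 h"
    unfolding h_def by (intro wform_diff_cmult 0 wform_basis)
  have h0: "fps_nth h 0 = 0"
    by (simp add: h_def E4_nth_0)
  define F where "F = fps_shift 1 (cfps h)"
  have hF: "cfps h = fps_X * F"
    using h0 by (intro fps_ext) (auto simp: F_def gr0_conv_Suc)
  have F: "fps_conv_radius F \<ge> 1"
    using h by (simp add: F_def wform_def)
  have eval: "eval_fps (cfps h) (ex \<tau>) = ex \<tau> * eval_fps F (ex \<tau>)" if "Im \<tau> > 0" for \<tau>
    unfolding hF using norm_ex_less_radius[OF that F] by (simp add: eval_fps_mult)
  have "F = 0"
  proof (rule weight_4_cusp_form_vanish[OF F])
    fix \<tau> :: complex assume \<tau>: "Im \<tau> > 0"
    show "ex (- (1 / \<tau>)) * eval_fps F (ex (- (1 / \<tau>))) = \<tau> ^ 4 * (ex \<tau> * eval_fps F (ex \<tau>))"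
      using h \<tau> eval[OF \<tau>] eval[OF Im_minus_inverse_pos[OF \<tau>]] by (simp add: wform_def)
  qed
  have "h = 0"
  proof -
    have "cfps h = cfps 0"
      unfolding hF \<open>F = 0\<close> by (rule fps_ext) simp
    thus ?thesis by (simp only: cfps_inj)
  qed
  hence "g = fps_const (fps_nth g 0) * E4"
    by (simp add: h_def)
  hence "fps_nth g n = fps_nth g 0 * fps_nth E4 n"
    by (metis fps_mult_left_const_nth)
  thus ?case using 0(2)[of 0] by (simp del: fps_mult_left_const_nth)
next
  case (Suc N)
  define b where "b = E4 ^ (3 * Suc N + 1) * inv_qq ^ (24 * Suc N)"
  define h where "h = g - fps_const (fps_nth g 0) * b"
  have h: "wform (Suc N) h"
    unfolding h_def b_def by (intro wform_diff_cmult Suc.prems wform_basis)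
  have h0: "fps_nth h 0 = 0"
    by (simp add: h_def b_def fps_nth_power_0_eq_1 E4_nth_0 inv_qq_nth_0 del: power_Suc)
  have hX: "h = fps_X * fps_shift 1 h"
    using h0 by (intro fps_ext) (auto simp: gr0_conv_Suc)
  hence "wform N (fps_shift 1 h)"
    using h wform_X_mult by metis
  moreover have dvd: "M dvd fps_nth h n" if "n \<le> Suc N" for n
    using Suc.prems(2)[of n] Suc.prems(2)[of 0] that by (simp add: h_def)
  hence "M dvd fps_nth (fps_shift 1 h) n" if "n \<le> N" for n
    using that dvd[of "Suc n"] by simp
  ultimately have "M dvd fps_nth (fps_shift 1 h) n" for n
    using Suc.IH by blast
  hence "M dvd fps_nth h n" for n
    using h0 by (subst hX) (auto simp: gr0_conv_Suc)
  moreover have "fps_nth g n = fps_nth h n + fps_nth g 0 * fps_nth b n"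
    by (simp add: h_def)
  ultimately show ?case using Suc.prems(2)[of 0] by (simp add: dvd_add)
qed

section \<open>The eta multiplier on the 11-isogenies\<close>

text \<open>S and T generate the modular group: this is the Euclidean algorithm on the first column,
  by induction on |c|.\<close>

lemma sl2_induct:
  fixes P :: "int \<Rightarrow> int \<Rightarrow> int \<Rightarrow> int \<Rightarrow> bool"
  assumes det: "a * d - b * c = 1"
  assumes I: "P 1 0 0 1"
  assumes T: "\<And>a b c d. a * d - b * c = 1 \<Longrightarrow> P a b c d \<Longrightarrow> P (a + c) (b + d) c d"
  assumes T': "\<And>a b c d. a * d - b * c = 1 \<Longrightarrow> P a b c d \<Longrightarrow> P (a - c) (b - d) c d"
  assumes S: "\<And>a b c d. a * d - b * c = 1 \<Longrightarrow> P a b c d \<Longrightarrow> P (- c) (- d) a b"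
  shows "P a b c d"
proof -
  have T_pow: "P (a + q * c) (b + q * d) c d" if "a * d - b * c = 1" "P a b c d" for a b c d q
  proof (induction q rule: int_induct[of _ 0])
    case (step1 q)
    have "P ((a + q * c) + c) ((b + q * d) + d) c d"
      by (rule T[OF _ step1(2)]) (use that in \<open>simp add: algebra_simps\<close>)
    thus ?case by (simp add: algebra_simps)
  next
    case (step2 q)
    have "P ((a + q * c) - c) ((b + q * d) - d) c d"
      by (rule T'[OF _ step2(2)]) (use that in \<open>simp add: algebra_simps\<close>)
    thus ?case by (simp add: algebra_simps)
  qed (use that in simp)
  show ?thesis
    using det
  proof (induction "nat \<bar>c\<bar>" arbitrary: a b c d rule: less_induct)
    case less
    show ?case
    proof (cases "c = 0")
      case True
      hence ad: "a * d = 1" using less.prems by simp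
      then consider "a = 1" "d = 1" | "a = -1" "d = -1"
        by (auto simp: zmult_eq_1_iff)
      thus ?thesis
      proof cases
        case 1
        thus ?thesis using T_pow[of 1 1 0 0 b] I True by simp
      next
        case 2
        have "P (-1) 0 0 (-1)"
          using S[OF _ S[OF _ I]] by simp
        thus ?thesis using T_pow[of "-1" "-1" 0 0 "-b"] 2 True by simp
      qed
    next
      case False
      define q where "q = a div c"
      have aq: "a - q * c = a mod c"
        by (simp add: q_def minus_div_mult_eq_mod)
      have det': "(- c) * (b - q * d) - (- d) * (a - q * c) = 1"
        using less.prems by (simp add: algebra_simps)
      have "nat \<bar>a - q * c\<bar> < nat \<bar>c\<bar>"
        unfolding aq using False abs_mod_less[of c a] by simp
      from less.hyps[OF this det'] have "P (- c) (- d) (a - q * c) (b - q * d)" .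
      \<comment> \<open>Three more applications of S undo the first one, because S^4 is the identity
        matrix.\<close>
      from S[OF det' this] have 1: "P (- (a - q * c)) (- (b - q * d)) (- c) (- d)" .
      have 2: "P (- (- c)) (- (- d)) (- (a - q * c)) (- (b - q * d))"
        by (rule S[OF _ 1]) (use less.prems in \<open>simp add: algebra_simps\<close>)
      have "P (- (- (a - q * c))) (- (- (b - q * d))) (- (- c)) (- (- d))"
        by (rule S[OF _ 2]) (use less.prems in \<open>simp add: algebra_simps\<close>)
      hence "P (a - q * c) (b - q * d) c d" by simp
      from T_pow[OF _ this, of q] show ?thesis
        using less.prems by (simp add: algebra_simps)
    qed
  qed
qed

definition moebius :: "int \<Rightarrow> int \<Rightarrow> int \<Rightarrow> int \<Rightarrow> complex \<Rightarrow> complex" where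
  "moebius a b c d \<tau> = (of_int a * \<tau> + of_int b) / (of_int c * \<tau> + of_int d)"

lemma moebius_denom_nonzero:
  assumes "a * d - b * c = 1" "Im \<tau> > 0"
  shows "of_int c * \<tau> + of_int d \<noteq> 0"
proof
  assume *: "of_int c * \<tau> + of_int d = 0"
  from arg_cong[OF this, of Im] assms(2) have "c = 0" by simp
  moreover from this * have "d = 0" by simp
  ultimately show False using assms(1) by simp
qed

lemma moebius_I [simp]: "moebius 1 0 0 1 \<tau> = \<tau>"
  by (simp add: moebius_def)

lemma moebius_T:
  assumes "a * d - b * c = 1" "Im \<tau> > 0"
  shows "moebius (a + c) (b + d) c d \<tau> = moebius a b c d \<tau> + 1"
  using moebius_denom_nonzero[OF assms] by (simp add: moebius_def divide_simps) (simp add: algebra_simps)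

lemma moebius_T':
  assumes "a * d - b * c = 1" "Im \<tau> > 0"
  shows "moebius (a - c) (b - d) c d \<tau> = moebius a b c d \<tau> - 1"
  using moebius_denom_nonzero[OF assms] by (simp add: moebius_def divide_simps) (simp add: algebra_simps)

lemma moebius_S: "moebius (- c) (- d) a b \<tau> = - (1 / moebius a b c d \<tau>)"
proof -
  have "moebius (- c) (- d) a b \<tau> = - ((of_int c * \<tau> + of_int d) / (of_int a * \<tau> + of_int b))"
    by (simp add: moebius_def minus_divide_left)
  thus ?thesis by (simp add: moebius_def)
qed

lemma Im_moebius_pos:
  assumes "a * d - b * c = 1" "Im \<tau> > 0"
  shows "Im (moebius a b c d \<tau>) > 0"
  using assms(1)
proof (rule sl2_induct[where P = "\<lambda>a b c d. Im (moebius a b c d \<tau>) > 0"])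
  fix a b c d :: int assume *: "a * d - b * c = 1" "Im (moebius a b c d \<tau>) > 0"
  show "Im (moebius (a + c) (b + d) c d \<tau>) > 0"
    using * by (simp add: moebius_T assms(2))
  show "Im (moebius (a - c) (b - d) c d \<tau>) > 0"
    using * by (simp add: moebius_T' assms(2))
  show "Im (moebius (- c) (- d) a b \<tau>) > 0"
    unfolding moebius_S by (rule Im_minus_inverse_pos[OF *(2)])
qed (use assms(2) in simp)

lemma modular_form_sl2:
  fixes f :: "complex \<Rightarrow> complex"
  assumes T: "\<And>\<tau>. Im \<tau> > 0 \<Longrightarrow> f (\<tau> + 1) = f \<tau>"
  assumes S: "\<And>\<tau>. Im \<tau> > 0 \<Longrightarrow> f (- (1 / \<tau>)) = \<tau> ^ k * f \<tau>"
  assumes det: "a * d - b * c = 1" and \<tau>: "Im \<tau> > 0"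
  shows "f (moebius a b c d \<tau>) = (of_int c * \<tau> + of_int d) ^ k * f \<tau>"
  using det
proof (rule sl2_induct[where P = "\<lambda>a b c d. f (moebius a b c d \<tau>) = (of_int c * \<tau> + of_int d) ^ k * f \<tau>"])
  fix a b c d :: int assume *: "a * d - b * c = 1" "f (moebius a b c d \<tau>) = (of_int c * \<tau> + of_int d) ^ k * f \<tau>"
  note Im = Im_moebius_pos[OF *(1) \<tau>]
  show "f (moebius (a + c) (b + d) c d \<tau>) = (of_int c * \<tau> + of_int d) ^ k * f \<tau>"
    unfolding moebius_T[OF *(1) \<tau>] T[OF Im] by (rule *(2))
  show "f (moebius (a - c) (b - d) c d \<tau>) = (of_int c * \<tau> + of_int d) ^ k * f \<tau>"
    unfolding moebius_T'[OF *(1) \<tau>] *(2) [symmetric] using T[of "moebius a b c d \<tau> - 1"] Im by simp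
  show "f (moebius (- c) (- d) a b \<tau>) = (of_int a * \<tau> + of_int b) ^ k * f \<tau>"
  proof -
    have "moebius a b c d \<tau> * (of_int c * \<tau> + of_int d) = of_int a * \<tau> + of_int b"
      using moebius_denom_nonzero[OF *(1) \<tau>] by (simp add: moebius_def)
    thus ?thesis
      unfolding moebius_S S[OF Im] *(2) mult.assoc [symmetric] power_mult_distrib [symmetric] by simp
  qed
qed simp

text \<open>In matrices, \<open>[1, x; 0, p] * S = [x, -m; p, -y] * [1, y; 0, p]\<close>: up to an
  element of the modular group, the inversion sends one isogeny of degree p to another.\<close>

lemma moebius_isogeny:
  assumes "1 + x * y = p * m" "p > 0" "Im \<tau> > 0"
  shows "moebius x (- m) p (- y) ((\<tau> + of_int y) / of_int p) = (- (1 / \<tau>) + of_int x) / of_int p"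
proof -
  have nz: "(of_int p :: complex) \<noteq> 0" "\<tau> \<noteq> 0" using assms by auto
  have "of_int (- m) = - (of_int (p * m) / (of_int p :: complex))"
    using nz by simp
  also have "\<dots> = - ((1 + of_int x * of_int y) / of_int p)"
    unfolding assms(1) [symmetric] by simp
  finally have m: "of_int (- m) = - ((1 + of_int x * of_int y) / (of_int p :: complex))" .
  have num: "of_int x * ((\<tau> + of_int y) / of_int p) + of_int (- m) = (of_int x * \<tau> - 1) / of_int p"
    unfolding m using nz by (simp add: field_simps)
  have denom: "of_int p * ((\<tau> + of_int y) / of_int p) + of_int (- y) = \<tau>"
    using nz by simp
  show ?thesis
    unfolding moebius_def denom num using nz by (simp add: field_simps)
qed

lemma modular_form_isogeny:
  fixes f :: "complex \<Rightarrow> complex"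
  assumes T: "\<And>\<tau>. Im \<tau> > 0 \<Longrightarrow> f (\<tau> + 1) = f \<tau>"
  assumes S: "\<And>\<tau>. Im \<tau> > 0 \<Longrightarrow> f (- (1 / \<tau>)) = \<tau> ^ k * f \<tau>"
  assumes "1 + x * y = p * m" "p > 0" "Im \<tau> > 0"
  shows "f ((- (1 / \<tau>) + of_int x) / of_int p) = \<tau> ^ k * f ((\<tau> + of_int y) / of_int p)"
proof -
  define u where "u = (\<tau> + of_int y) / of_int p"
  have u: "Im u > 0" using assms by (simp add: u_def)
  have det: "x * (- y) - (- m) * p = 1" using assms(3) by (simp add: mult.commute)
  have denom: "of_int p * u + of_int (- y) = \<tau>" using assms(4) by (simp add: u_def)
  have "f (moebius x (- m) p (- y) u) = \<tau> ^ k * f u"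
    using modular_form_sl2[where f = f and k = k, OF T S det u] unfolding denom .
  thus ?thesis
    unfolding u_def moebius_isogeny[OF assms(3-5)] .
qed

section \<open>Eta on isogenies of degree 11: the branch of the square root\<close>

definition sqi :: "complex \<Rightarrow> complex" where
  "sqi \<tau> = csqrt (- (\<i> * \<tau>))"

lemma sqi_squared: "sqi \<tau> ^ 2 = - (\<i> * \<tau>)"
  by (simp add: sqi_def)

lemma sqi_nonzero: "Im \<tau> > 0 \<Longrightarrow> sqi \<tau> \<noteq> 0"
  by (auto simp: sqi_def)

text \<open>-\<i> \<tau> has positive real part, so its principal root lies within \<pi>/4 of the
  positive axis. This later decides the sign of a product of square roots.\<close>

lemma sqi_sector:
  assumes "Im \<tau> > 0"
  shows "\<bar>Im (sqi \<tau>)\<bar> < Re (sqi \<tau>)"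
proof -
  have lt: "(Im (sqi \<tau>))\<^sup>2 < (Re (sqi \<tau>))\<^sup>2"
    using arg_cong[OF sqi_squared[of \<tau>], of Re] assms by (simp add: Re_power2)
  have nonneg: "Re (sqi \<tau>) \<ge> 0"
    unfolding sqi_def using csqrt_principal[of "- (\<i> * \<tau>)"] by auto
  have "\<bar>Im (sqi \<tau>)\<bar> ^ 2 < Re (sqi \<tau>) ^ 2"
    using lt by simp
  thus ?thesis
    using nonneg by (rule power_less_imp_less_base)
qed

lemma sqi_cmult:
  assumes "r > 0"
  shows "sqi (of_real r * \<tau>) = of_real (sqrt r) * sqi \<tau>"
  unfolding sqi_def
proof (rule csqrt_unique)
  have "complex_of_real (sqrt r) ^ 2 = of_real r"
    using assms by (simp flip: of_real_power)
  thus "(of_real (sqrt r) * csqrt (- (\<i> * \<tau>)))\<^sup>2 = - (\<i> * (of_real r * \<tau>))"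
    by (simp only: power_mult_distrib power2_csqrt) simp
  show "0 < Re (of_real (sqrt r) * csqrt (- (\<i> * \<tau>))) \<or>
      Re (of_real (sqrt r) * csqrt (- (\<i> * \<tau>))) = 0 \<and> 0 \<le> Im (of_real (sqrt r) * csqrt (- (\<i> * \<tau>)))"
  proof -
    define w where "w = csqrt (- (\<i> * \<tau>))"
    show ?thesis
      using csqrt_principal[of "- (\<i> * \<tau>)"] assms unfolding w_def [symmetric] by auto
  qed
qed

lemma eta_S': "Im \<tau> > 0 \<Longrightarrow> eta (- (1 / \<tau>)) = sqi \<tau> * eta \<tau>"
  unfolding sqi_def by (rule eta_S)

lemma eta_add_int: "eta (\<tau> + of_int n) = ex (of_int n / 24) * eta \<tau>"
proof (induction n rule: int_induct[of _ 0])
  case (step1 n)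
  thus ?case using eta_add_1[of "\<tau> + of_int n"]
    by (simp add: add_divide_distrib ex_add add_ac)
next
  case (step2 n)
  have "of_int n / 24 = 1 / 24 + of_int (n - 1) / (24 :: complex)"
    by (simp add: field_simps)
  hence "ex (1 / 24) * (ex (of_int (n - 1) / 24) * eta \<tau>) = eta (\<tau> + of_int n)"
    by (simp only: step2 ex_add mult.assoc)
  also have "\<dots> = ex (1 / 24) * eta (\<tau> + of_int (n - 1))"
    using eta_add_1[of "\<tau> + of_int (n - 1)"] by simp
  finally show ?case
    by (subst (asm) mult_cancel_left) simp
qed simp

text \<open>
  The transformation of \<open>eta\<close> under the matrix \<open>S T\<^sup>b S T\<^sup>c S\<close> with \<open>b c = 12\<close>, whose lower left
  entry is 11. As \<open>12 = 1 (mod 11)\<close> and every residue class mod 11 contains a divisor of 12,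
  these matrices suffice to treat all cusps.
\<close>

lemma eta_word:
  fixes b c :: int
  assumes bc: "b * c = 12" and \<tau>: "Im \<tau> > 0"
  shows "eta ((- (1 / \<tau>) - of_int c) / 11) =
           ex (of_int (b + c) / 24) * (- of_int (sgn c) * \<i>) * sqi \<tau> * eta ((\<tau> + of_int b) / 11)"
proof -
  define u where "u = (\<tau> + of_int b) / 11"
  define u2 where "u2 = - (1 / u) + of_int c"
  define u4 where "u4 = - (1 / u2) + of_int b"
  have u: "Im u > 0" using \<tau> by (simp add: u_def)
  have u2: "Im u2 > 0" using Im_minus_inverse_pos[OF u] by (simp add: u2_def)
  have u4: "Im u4 > 0" using Im_minus_inverse_pos[OF u2] by (simp add: u4_def)
  have nz: "u \<noteq> 0" "u2 \<noteq> 0" "u4 \<noteq> 0" "\<tau> \<noteq> 0"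
    using u u2 u4 \<tau> by auto
  have bc': "of_int b * of_int c = (12::complex)"
    using bc by (metis of_int_mult of_int_numeral)
  have u2u: "u2 * u = of_int c * u - 1"
    using nz by (simp add: u2_def field_simps)
  \<comment> \<open>Here b c = 12 enters: the product is (b c - 1) u - b = 11 u - b =
    \<tau>.\<close>
  have "u4 * u2 * u = of_int b * (u2 * u) - u"
    using nz by (simp add: u4_def field_simps)
  also have "\<dots> = (of_int b * of_int c) * u - of_int b - u"
    unfolding u2u by (simp add: algebra_simps)
  also have "\<dots> = \<tau>"
    unfolding bc' by (simp add: u_def field_simps)
  finally have u4u2u: "u4 * u2 * u = \<tau>" .
  define X Y V where "X = sqi u2 * sqi u" and "Y = sqi u4" and "V = sqi \<tau>"
  have "eta u4 = ex (of_int b / 24) * eta (- (1 / u2))" "eta u2 = ex (of_int c / 24) * eta (- (1 / u))"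
    unfolding u4_def u2_def by (rule eta_add_int)+
  hence "eta (- (1 / u4)) = ex (of_int (b + c) / 24) * (X * Y) * eta u"
    unfolding eta_S'[OF u4] eta_S'[OF u2] eta_S'[OF u] X_def Y_def
    by (simp add: ex_add add_divide_distrib)
  moreover have "- (1 / u4) = (- (1 / \<tau>) - of_int c) / 11"
  proof -
    have "- (1 / u4) = - (u2 * u) / \<tau>"
      using nz by (simp add: u4u2u [symmetric])
    also have "\<dots> = (- (1 / \<tau>) - of_int c) / 11"
      unfolding u2u using nz by (simp add: u_def field_simps bc')
    finally show ?thesis .
  qed
  \<comment> \<open>The square of X Y is known, so only the sign is open. For c > 0, X lies in the
    fourth quadrant and Y within \<pi>/4 of the positive axis; hence Re (X Y) > Im (X Y), which
    rules out \<i> V. The case c < 0 is the mirror image.\<close>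
  moreover have "X * Y = - of_int (sgn c) * \<i> * V"
  proof -
    have X2: "X ^ 2 = 1 - of_int c * u"
    proof -
      have "X ^ 2 = - (u2 * u)"
        by (simp add: X_def power_mult_distrib sqi_squared mult_ac)
      thus ?thesis unfolding u2u by simp
    qed
    have "(X * Y) ^ 2 = \<i> * (u4 * u2 * u)"
      by (simp add: X_def Y_def power_mult_distrib sqi_squared mult_ac)
    also have "\<dots> = (\<i> * V) ^ 2"
      by (simp add: u4u2u V_def power_mult_distrib sqi_squared)
    finally have pm: "X * Y = \<i> * V \<or> X * Y = - (\<i> * V)"
      by (simp add: power2_eq_iff)
    note Y = sqi_sector[OF u4, folded Y_def]
    note V = sqi_sector[OF \<tau>, folded V_def]
    have X: "Re X > 0"
    proof -
      have "\<bar>Im (sqi u2)\<bar> * \<bar>Im (sqi u)\<bar> < Re (sqi u2) * Re (sqi u)"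
        using sqi_sector[OF u2] sqi_sector[OF u] by (intro mult_strict_mono) auto
      hence "Im (sqi u2) * Im (sqi u) < Re (sqi u2) * Re (sqi u)"
        unfolding abs_mult [symmetric] by linarith
      thus ?thesis by (simp add: X_def)
    qed
    have ImX: "2 * Re X * Im X = - of_int c * Im u"
      using arg_cong[OF X2, of Im] by (simp add: Im_power2)
    have "c \<noteq> 0" using bc by auto
    then consider "c > 0" | "c < 0" by linarith
    thus ?thesis
    proof cases
      case 1
      hence "2 * Re X * Im X < 0"
        unfolding ImX using u by simp
      hence ImX': "Im X < 0"
        using X by (simp add: mult_less_0_iff)
      have "0 < Re X * (Re Y - Im Y) + (- Im X) * (Re Y + Im Y)"
        by (rule add_pos_pos[OF mult_pos_pos mult_pos_pos]) (use X Y ImX' in auto)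
      also have "\<dots> = Re (X * Y) - Im (X * Y)"
        by (simp add: algebra_simps)
      finally have gt: "0 < Re (X * Y) - Im (X * Y)" .
      have "X * Y \<noteq> \<i> * V"
      proof
        assume "X * Y = \<i> * V"
        from gt[unfolded this] V show False by simp
      qed
      with pm 1 show ?thesis by simp
    next
      case 2
      hence "2 * Re X * Im X > 0"
        unfolding ImX using u by (simp add: mult_neg_pos)
      hence ImX': "Im X > 0"
        using X by (simp add: zero_less_mult_iff)
      have "0 < Re X * (Re Y + Im Y) + Im X * (Re Y - Im Y)"
        by (rule add_pos_pos[OF mult_pos_pos mult_pos_pos]) (use X Y ImX' in auto)
      also have "\<dots> = Re (X * Y) + Im (X * Y)"
        by (simp add: algebra_simps)
      finally have gt: "0 < Re (X * Y) + Im (X * Y)" .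
      have "X * Y \<noteq> - (\<i> * V)"
      proof
        assume "X * Y = - (\<i> * V)"
        from gt[unfolded this] V show False by simp
      qed
      with pm 2 show ?thesis by simp
    qed
  qed
  ultimately show ?thesis
    by (simp add: u_def V_def mult_ac)
qed

text \<open>
  The exponent of the character \<open>SL\<^sub>2(\<int>) \<rightarrow> \<mu>\<^sub>1\<^sub>2\<close> of \<open>\<eta>\<^sup>2\<close>; it depends on the entries mod 12 only.
\<close>

definition phi :: "int \<Rightarrow> int \<Rightarrow> int \<Rightarrow> int \<Rightarrow> int" where
  "phi a b c d = (1 - c * c) * (b * d + 3 * (c - 1) * d + c + 3) + c * (a + d - 3)"

lemma phi_cong:
  assumes "[a = a'] (mod m)" "[b = b'] (mod m)" "[c = c'] (mod m)" "[d = d'] (mod m)"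
  shows "[phi a b c d = phi a' b' c' d'] (mod m)"
  unfolding phi_def by (intro cong_add cong_mult cong_diff cong_refl assms)

lemma phi_check_3:
  "\<forall>a\<in>set [0..2]. \<forall>b\<in>set [0..2]. \<forall>c\<in>set [0..2]. \<forall>d\<in>set [0..2]. (a * d - b * c) mod 3 = 1 \<longrightarrow>
     phi (a + c) (b + d) c d mod 3 = (phi a b c d + 1) mod 3 \<and> phi (- c) (- d) a b mod 3 = (phi a b c d - 3) mod 3"
  by code_simp

lemma phi_check_4:
  "\<forall>a\<in>set [0..3]. \<forall>b\<in>set [0..3]. \<forall>c\<in>set [0..3]. \<forall>d\<in>set [0..3]. (a * d - b * c) mod 4 = 1 \<longrightarrow>
     phi (a + c) (b + d) c d mod 4 = (phi a b c d + 1) mod 4 \<and> phi (- c) (- d) a b mod 4 = (phi a b c d - 3) mod 4"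
  by code_simp

text \<open>By \<open>phi_cong\<close> the entries matter only modulo 3 and modulo 4, so both
  identities are checked on all residues and combined by coprimality.\<close>

lemma phi_T: "[phi (a + c) (b + d) c d = phi a b c d + 1] (mod 12)" (is ?T)
  and phi_S: "[phi (- c) (- d) a b = phi a b c d - 3] (mod 12)" (is ?S)
  if det: "a * d - b * c = 1"
proof -
  have *: "[phi (a + c) (b + d) c d = phi a b c d + 1] (mod m) \<and> [phi (- c) (- d) a b = phi a b c d - 3] (mod m)"
    if m: "m = 3 \<or> m = 4" for m
  proof -
    define a' b' c' d' where "a' = a mod m" and "b' = b mod m" and "c' = c mod m" and "d' = d mod m"
    have cong: "[a = a'] (mod m)" "[b = b'] (mod m)" "[c = c'] (mod m)" "[d = d'] (mod m)"
      by (simp_all add: a'_def b'_def c'_def d'_def cong_def)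
    have "[a * d - b * c = a' * d' - b' * c'] (mod m)"
      by (intro cong_diff cong_mult cong)
    hence det': "(a' * d' - b' * c') mod m = 1"
      using det m by (auto simp: cong_def)
    have "a' \<in> set [0..m - 1]" "b' \<in> set [0..m - 1]" "c' \<in> set [0..m - 1]" "d' \<in> set [0..m - 1]"
      using m by (auto simp: a'_def b'_def c'_def d'_def)
    hence check: "[phi (a' + c') (b' + d') c' d' = phi a' b' c' d' + 1] (mod m)"
         "[phi (- c') (- d') a' b' = phi a' b' c' d' - 3] (mod m)"
      using phi_check_3[rule_format, of a' b' c' d'] phi_check_4[rule_format, of a' b' c' d'] det' m
      unfolding cong_def by auto
    have "[phi (a + c) (b + d) c d = phi (a' + c') (b' + d') c' d'] (mod m)"
      by (intro phi_cong cong_add cong)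
    also note check(1)
    also have "[phi a' b' c' d' + 1 = phi a b c d + 1] (mod m)"
      by (intro cong_add phi_cong cong[THEN cong_sym] cong_refl)
    finally have 1: "[phi (a + c) (b + d) c d = phi a b c d + 1] (mod m)" .
    have "[phi (- c) (- d) a b = phi (- c') (- d') a' b'] (mod m)"
      by (intro phi_cong cong_minus_minus_iff[THEN iffD2] cong)
    also note check(2)
    also have "[phi a' b' c' d' - 3 = phi a b c d - 3] (mod m)"
      by (intro cong_diff phi_cong cong[THEN cong_sym] cong_refl)
    finally have 2: "[phi (- c) (- d) a b = phi a b c d - 3] (mod m)" .
    from 1 2 show ?thesis by blast
  qed
  have "coprime (3::int) 4"
    using coprime_add_one_right[of "3::int"] by simp
  hence "[x = y] (mod (3 * 4))" if "[x = y] (mod 3)" "[x = y] (mod 4)" for x y :: int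
    using that by (intro coprime_cong_mult)
  with *[of 3] *[of 4] show ?T ?S by auto
qed

lemma ex_cong_12: "[m = n] (mod 12) \<Longrightarrow> ex (5 * of_int m / 12) = ex (5 * of_int n / 12)"
proof (rule ex_eqI)
  assume "[m = n] (mod 12)"
  then obtain k where "m - n = 12 * k"
    by (auto simp: cong_iff_dvd_diff)
  hence "m = n + 12 * k" by simp
  hence "5 * of_int m / 12 - 5 * of_int n / 12 = (of_int (5 * k) :: complex)"
    by (simp add: field_simps)
  thus "5 * of_int m / 12 - 5 * of_int n / 12 \<in> (\<int> :: complex set)"
    by simp
qed

text \<open>The Legendre symbol modulo 11; the junk value at multiples of 11 is \<open>-1\<close>.\<close>

definition leg :: "int \<Rightarrow> complex" where
  "leg j = (if j mod 11 \<in> set [1, 3, 4, 5, 9] then 1 else -1)"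

lemma leg_squared: "leg j * leg j = 1"
  by (simp add: leg_def)

lemma leg_cong: "[i = j] (mod 11) \<Longrightarrow> leg i = leg j"
  by (simp add: leg_def cong_def)

lemma leg_check:
  "\<forall>x\<in>set [1..10]. \<forall>y\<in>set [1..10]. (x * y) mod 11 \<in> set [1, 3, 4, 5, 9] \<longleftrightarrow>
     (x \<in> set [1, 3, 4, 5, 9] \<longleftrightarrow> y \<in> set [1, 3, 4, 5, 9 :: int])"
  by code_simp

lemma mod_11_range: "\<not> 11 dvd x \<Longrightarrow> x mod 11 \<in> set [1..10]" for x :: int
  using pos_mod_bound[of 11 x] pos_mod_sign[of 11 x] by (auto simp: dvd_eq_mod_eq_0)

lemma leg_mult:
  assumes "\<not> 11 dvd x" "\<not> 11 dvd y"
  shows "leg (x * y) = leg x * leg y"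
proof -
  have "(x * y) mod 11 = ((x mod 11) * (y mod 11)) mod 11"
    by (simp add: mod_mult_eq)
  thus ?thesis
    using leg_check[rule_format, OF mod_11_range[OF assms(1)] mod_11_range[OF assms(2)]]
    by (simp add: leg_def del: set_simps)
qed

lemma prime_11: "prime (11 :: int)"
  by (simp add: prime_int_numeral_eq)

lemma not_11_dvd_power: "\<not> 11 dvd x \<Longrightarrow> \<not> 11 dvd x ^ n" for x :: int
  using prime_11 prime_dvd_power by blast

lemma leg_power: "\<not> 11 dvd x \<Longrightarrow> leg (x ^ n) = leg x ^ n"
  by (induction n) (simp_all add: leg_mult not_11_dvd_power, simp add: leg_def)

lemma fermat_11: "\<not> 11 dvd x \<Longrightarrow> [x ^ 10 = 1] (mod 11)" for x :: int
proof -
  assume x: "\<not> 11 dvd x"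
  have "\<forall>x\<in>set [1..10]. x ^ 10 mod 11 = (1::int)"
    by code_simp
  hence "(x mod 11) ^ 10 mod 11 = 1"
    using mod_11_range[OF x] by blast
  thus ?thesis by (simp add: cong_def power_mod)
qed

section \<open>Eta quotients indexed by vectors modulo 11\<close>

text \<open>The root of unity makes the function depend only on j modulo 11: replacing j by j + 11
  contributes the exponent -121/24 + 1/24 = -5, an integer.\<close>

definition K1 :: "int \<Rightarrow> complex \<Rightarrow> complex" where
  "K1 j \<tau> = ex (- (11 * of_int j / 24)) * eta ((\<tau> + of_int j) / 11) / eta \<tau>"

lemma K1_cong:
  assumes "[i = j] (mod 11)"
  shows "K1 i \<tau> = K1 j \<tau>"
proof -
  obtain k where k: "i = j + 11 * k"
    using assms by (metis cong_iff_lin cong_sym)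
  have "eta ((\<tau> + of_int i) / 11) = ex (of_int k / 24) * eta ((\<tau> + of_int j) / 11)"
    using eta_add_int[of "(\<tau> + of_int j) / 11" k] by (simp add: k add_divide_distrib add_ac)
  moreover have "ex (- (11 * of_int i / 24)) * ex (of_int k / 24) = ex (- (11 * of_int j / 24))"
    unfolding ex_add [symmetric]
  proof (rule ex_eqI)
    have "- (11 * of_int i / 24) + of_int k / 24 - - (11 * of_int j / 24) = (of_int (- 5 * k) :: complex)"
      by (simp add: k field_simps)
    thus "- (11 * of_int i / 24) + of_int k / 24 - - (11 * of_int j / 24) \<in> (\<int> :: complex set)"
      by (simp only: Ints_of_int)
  qed
  ultimately show ?thesis
    by (simp add: K1_def mult.assoc [symmetric])
qed

lemma K1_add_1: "K1 j (\<tau> + 1) = ex (5 / 12) * K1 (j + 1) \<tau>"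
proof -
  have "ex (- (11 * of_int j / 24)) / ex (1 / 24) = ex (5 / 12) * ex (- (11 * of_int (j + 1) / 24))"
    unfolding ex_add [symmetric] ex_diff [symmetric] by (rule arg_cong[of _ _ ex]) (simp add: field_simps)
  moreover have "\<tau> + 1 + of_int j = \<tau> + of_int (j + 1)" by simp
  moreover have "a * x / (b * y) = (a / b) * (x / y)" for a b x y :: complex
    by simp
  ultimately show ?thesis
    unfolding K1_def eta_add_1 by (simp only: mult.assoc times_divide_eq_right)
qed

text \<open>As 12 is 1 modulo 11, a factorization b c = 12 with j = -c modulo 11 forces j' = b
  modulo 11, and \<open>eta_word\<close> applies to this pair. The root of unity left over is
  (-1)^(b + c); together with the sign of c it has to be a Legendre symbol, which is checked pair by
  pair.\<close>

lemma K1_S: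
  assumes \<tau>: "Im \<tau> > 0" and jj': "[j * j' = -1] (mod 11)"
  shows "K1 j (- (1 / \<tau>)) = - \<i> * leg j * K1 j' \<tau>"
proof -
  have *: "K1 (- c) (- (1 / \<tau>)) = - \<i> * leg (- c) * K1 b \<tau>"
    if bc: "b * c = 12" and sgn: "leg (- c) = of_int (sgn c) * (-1) ^ nat \<bar>b + c\<bar>" for b c :: int
  proof -
    have "K1 (- c) (- (1 / \<tau>)) = (ex (11 * of_int c / 24) * ex (of_int (b + c) / 24)) * (- of_int (sgn c) * \<i>) *
             (eta ((\<tau> + of_int b) / 11) / eta \<tau>)"
      unfolding K1_def eta_S'[OF \<tau>] using eta_word[OF bc \<tau>] sqi_nonzero[OF \<tau>] by simp
    also have "eta ((\<tau> + of_int b) / 11) / eta \<tau> = ex (11 * of_int b / 24) * K1 b \<tau>"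
      by (simp add: K1_def ex_minus)
    also have "ex (11 * of_int c / 24) * ex (of_int (b + c) / 24) * (- of_int (sgn c) * \<i>) * (ex (11 * of_int b / 24) * K1 b \<tau>) =
        (ex (11 * of_int c / 24) * ex (of_int (b + c) / 24) * ex (11 * of_int b / 24)) * (- of_int (sgn c) * \<i>) * K1 b \<tau>"
      by simp
    also have "ex (11 * of_int c / 24) * ex (of_int (b + c) / 24) * ex (11 * of_int b / 24) = (-1) ^ nat \<bar>b + c\<bar>"
    proof -
      have "ex (11 * of_int c / 24) * ex (of_int (b + c) / 24) * ex (11 * of_int b / 24) = ex (of_nat (nat \<bar>b + c\<bar>) * (1 / 2))"
        unfolding ex_add [symmetric]
      proof (rule ex_eqI)
        have "of_nat (nat \<bar>b + c\<bar>) = (of_int \<bar>b + c\<bar> :: complex)" by simp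
        hence "11 * of_int c / 24 + of_int (b + c) / 24 + 11 * of_int b / 24 - of_nat (nat \<bar>b + c\<bar>) * (1 / 2) =
            (of_int (if b + c \<ge> 0 then 0 else b + c) :: complex)"
          by (auto simp: abs_if field_simps)
        thus "11 * of_int c / 24 + of_int (b + c) / 24 + 11 * of_int b / 24 - of_nat (nat \<bar>b + c\<bar>) * (1 / 2) \<in> (\<int> :: complex set)"
          by (simp only: Ints_of_int)
      qed
      also have "\<dots> = (-1) ^ nat \<bar>b + c\<bar>"
        unfolding ex_mult_nat by (simp add: ex_def)
      finally show ?thesis .
    qed
    finally show ?thesis unfolding sgn by simp
  qed
  have **: "K1 j (- (1 / \<tau>)) = - \<i> * leg j * K1 j' \<tau>"
    if bc: "b * c = 12" "leg (- c) = of_int (sgn c) * (-1) ^ nat \<bar>b + c\<bar>" "[j = - c] (mod 11)" for b c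
  proof -
    have "[j' = j' * 12] (mod 11)"
      using cong_mult[OF cong_refl[of j' 11], of 1 12] by (simp add: cong_def)
    also have "j' * 12 = - (b * ((- c) * j'))"
      by (simp add: bc(1) [symmetric])
    also have "[- (b * ((- c) * j')) = - (b * (j * j'))] (mod 11)"
      by (intro cong_minus_minus_iff[THEN iffD2] cong_mult cong_refl cong_sym[OF bc(3)])
    also have "[- (b * (j * j')) = - (b * (-1))] (mod 11)"
      by (intro cong_minus_minus_iff[THEN iffD2] cong_mult cong_refl jj')
    finally have "[j' = b] (mod 11)" by simp
    thus ?thesis
      using *[OF bc(1,2)] K1_cong[OF bc(3)] K1_cong leg_cong[OF bc(3)] by metis
  qed
  have "\<not> 11 dvd j"
  proof
    assume "11 dvd j"
    hence "[j * j' = 0] (mod 11)" by (simp add: cong_0_iff)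
    with jj' have "[-1 = (0::int)] (mod 11)" by (metis cong_sym cong_trans)
    thus False by (simp add: cong_def)
  qed
  hence "j mod 11 \<in> set [1..10]" by (rule mod_11_range)
  hence "j mod 11 \<in> {1, 2, 3, 4, 5, 6, 7, 8, 9, 10}" by (simp add: upto.simps)
  \<comment> \<open>One factorization (b, c) for each residue j = 1, ..., 10, in this order, with -c
    = j modulo 11.\<close>
  thus ?thesis
    by (elim insertE emptyE)
       (rule **[of "-12" "-1"] **[of "-6" "-2"] **[of "-4" "-3"] **[of "-3" "-4"] **[of 2 6] **[of "-2" "-6"]
          **[of 3 4] **[of 4 3] **[of 6 2] **[of 12 1]; simp add: leg_def cong_def; fail)+
qed

text \<open>
  Functions indexed by nonzero vectors over the field with 11 elements. The signs make the
  action of the modular group on them uniform.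
\<close>

definition KK :: "int \<Rightarrow> int \<Rightarrow> complex \<Rightarrow> complex" where
  "KK c d \<tau> = (if 11 dvd c then - \<i> * of_real (sqrt 11) * leg d * eta (11 * \<tau>) / eta \<tau>
               else leg c * K1 (d * c ^ 9) \<tau>)"

text \<open>In \<open>KK\<close> the power \<open>c ^ 9\<close> is the inverse of c modulo 11, so a
  vector with c nonzero modulo 11 belongs to the isogeny (\<tau> + d/c) / 11 and the other vectors
  to 11 \<tau>. Translation by 1 adds 1 to d/c, that is, c to d.\<close>

lemma KK_T:
  assumes "\<not> (11 dvd c \<and> 11 dvd d)"
  shows "KK c d (\<tau> + 1) = ex (5 / 12) * KK c (c + d) \<tau>"
proof (cases "11 dvd c")
  case True
  have "leg (c + d) = leg d"
    using True by (intro leg_cong) (auto simp: cong_def mod_add_left_eq [symmetric])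
  moreover have "eta (11 * (\<tau> + 1)) = ex (11 / 24) * eta (11 * \<tau>)"
    using eta_add_int[of "11 * \<tau>" 11] by (simp add: algebra_simps)
  moreover have "ex (11 / 24) = ex (5 / 12) * ex (1 / 24)"
    unfolding ex_add [symmetric] by simp
  ultimately show ?thesis
    using True unfolding KK_def eta_add_1 by simp
next
  case False
  have "[(c + d) * c ^ 9 = d * c ^ 9 + 1] (mod 11)"
  proof -
    have "(c + d) * c ^ 9 = d * c ^ 9 + c ^ 10"
      by (simp add: algebra_simps eval_nat_numeral)
    thus ?thesis using fermat_11[OF False] cong_add[OF cong_refl] by metis
  qed
  from K1_cong[OF this] show ?thesis
    using False by (simp add: KK_def K1_add_1)
qed

text \<open>The inversion exchanges 11 \<tau> with \<tau> / 11 and sends d/c to -c/d. The Legendre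
  symbols in \<open>KK\<close> absorb the one from \<open>K1_S\<close>, and the factor with the root
  of 11 absorbs the weight 1/2 of \<open>eta\<close>, so that one common factor remains.\<close>

lemma KK_S:
  assumes cd: "\<not> (11 dvd c \<and> 11 dvd d)" and \<tau>: "Im \<tau> > 0"
  shows "KK c d (- (1 / \<tau>)) = - \<i> * KK d (- c) \<tau>"
proof -
  have \<tau>0: "\<tau> \<noteq> 0" using \<tau> by auto
  have leg_minus: "leg (- c) = - leg c" if "\<not> 11 dvd c" for c
    using leg_mult[of "-1" c] that by (simp add: leg_def)
  have sqrt11: "complex_of_real (sqrt 11) * complex_of_real (sqrt 11) = 11"
    by (simp flip: of_real_mult)
  consider "11 dvd c" "\<not> 11 dvd d" | "11 dvd d" "\<not> 11 dvd c" | "\<not> 11 dvd c" "\<not> 11 dvd d"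
    using cd by blast
  thus ?thesis
  proof cases
    case 1
    have "eta (11 * (- (1 / \<tau>))) = sqi (\<tau> / 11) * eta (\<tau> / 11)"
      using eta_S'[of "\<tau> / 11"] \<tau> by simp
    moreover have "sqi \<tau> = of_real (sqrt 11) * sqi (\<tau> / 11)"
      using sqi_cmult[of 11 "\<tau> / 11"] by simp
    moreover have "K1 (- c * d ^ 9) \<tau> = K1 0 \<tau>"
      using 1 by (intro K1_cong) (auto simp: cong_0_iff)
    moreover have "sqi (\<tau> / 11) \<noteq> 0"
      using \<tau> by (intro sqi_nonzero) simp
    ultimately show ?thesis
      using 1 by (simp add: KK_def eta_S'[OF \<tau>] K1_def)
  next
    case 2
    have e: "eta (- (1 / (11 * \<tau>))) = of_real (sqrt 11) * sqi \<tau> * eta (11 * \<tau>)"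
      using eta_S'[of "11 * \<tau>"] \<tau> sqi_cmult[of 11 \<tau>] by simp
    have "(- (1 / \<tau>) + of_int 0) / 11 = - (1 / (11 * \<tau>))" by simp
    hence "K1 0 (- (1 / \<tau>)) = eta (- (1 / (11 * \<tau>))) / (sqi \<tau> * eta \<tau>)"
      unfolding K1_def eta_S'[OF \<tau>] by (simp only: of_int_0 mult_zero_right div_0 minus_zero ex_0 mult_1_left)
    also have "\<dots> = of_real (sqrt 11) * eta (11 * \<tau>) / eta \<tau>"
      unfolding e using sqi_nonzero[OF \<tau>] by simp
    finally have "K1 0 (- (1 / \<tau>)) = of_real (sqrt 11) * eta (11 * \<tau>) / eta \<tau>" .
    moreover have "K1 (d * c ^ 9) (- (1 / \<tau>)) = K1 0 (- (1 / \<tau>))"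
      using 2 by (intro K1_cong) (auto simp: cong_0_iff)
    ultimately show ?thesis
      using 2 by (simp add: KK_def leg_minus mult.assoc)
  next
    case 3
    have "[(d * c ^ 9) * (- c * d ^ 9) = -1] (mod 11)"
    proof -
      have "(d * c ^ 9) * (- c * d ^ 9) = - (c ^ 10 * d ^ 10)"
        by (simp add: eval_nat_numeral mult_ac)
      moreover have "[- (c ^ 10 * d ^ 10) = - (1 * 1)] (mod 11)"
        by (intro cong_minus_minus_iff[THEN iffD2] cong_mult fermat_11 3)
      ultimately show ?thesis by simp
    qed
    from K1_S[OF \<tau> this] have "K1 (d * c ^ 9) (- (1 / \<tau>)) = - \<i> * leg (d * c ^ 9) * K1 (- c * d ^ 9) \<tau>" .
    moreover have "leg (d * c ^ 9) = leg d * leg c"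
    proof -
      have "leg (d * c ^ 9) = leg d * leg c ^ 9"
        using 3 by (simp only: leg_mult not_11_dvd_power leg_power not_False_eq_True)
      also have "leg c ^ 9 = leg c"
        by (simp add: leg_def)
      finally show ?thesis .
    qed
    moreover have "leg c * (- \<i> * (leg d * leg c) * x) = - \<i> * (leg d * x) * (leg c * leg c)" for x
      by (simp add: mult_ac)
    ultimately show ?thesis
      using 3 by (simp add: KK_def leg_squared)
  qed
qed

text \<open>\<open>phi\<close> changes by 1 under T and by -3 under S, which matches the factors
  \<open>ex (5 / 12)\<close> and \<open>- \<i> = ex (- 15 / 12)\<close> of \<open>KK_T\<close> and
  \<open>KK_S\<close>. So the induction over the generators closes with one character for all
  vectors.\<close>

theorem KK_sl2:
  assumes det: "a * d - b * c = 1" and \<tau>: "Im \<tau> > 0" and v: "\<not> (11 dvd v1 \<and> 11 dvd v2)"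
  shows "KK v1 v2 (moebius a b c d \<tau>) = ex (5 * of_int (phi a b c d) / 12) * KK (v1 * a + v2 * c) (v1 * b + v2 * d) \<tau>"
proof -
  define P where "P = (\<lambda>a b c d. \<forall>v1 v2. \<not> (11 dvd v1 \<and> 11 dvd v2) \<longrightarrow> KK v1 v2 (moebius a b c d \<tau>) =
      ex (5 * of_int (phi a b c d) / 12) * KK (v1 * a + v2 * c) (v1 * b + v2 * d) \<tau>)"
  have "P a b c d"
    using det
  proof (rule sl2_induct)
    show "P 1 0 0 1" by (simp add: P_def phi_def)
  next
    fix a b c d :: int assume det: "a * d - b * c = 1" and IH: "P a b c d"
    note Im = Im_moebius_pos[OF det \<tau>]
    show "P (a + c) (b + d) c d"
      unfolding P_def
    proof (intro allI impI)
      fix v1 v2 :: int assume v: "\<not> (11 dvd v1 \<and> 11 dvd v2)"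
      hence v': "\<not> (11 dvd v1 \<and> 11 dvd v1 + v2)"
        by (auto simp: dvd_add_right_iff)
      have "KK v1 v2 (moebius (a + c) (b + d) c d \<tau>) = ex (5 / 12) * KK v1 (v1 + v2) (moebius a b c d \<tau>)"
        unfolding moebius_T[OF det \<tau>] by (rule KK_T[OF v])
      also have "KK v1 (v1 + v2) (moebius a b c d \<tau>) = ex (5 * of_int (phi a b c d) / 12) *
          KK (v1 * a + (v1 + v2) * c) (v1 * b + (v1 + v2) * d) \<tau>"
        using IH v' unfolding P_def by blast
      also have "ex (5 / 12) * (ex (5 * of_int (phi a b c d) / 12) * x) = ex (5 * of_int (phi a b c d + 1) / 12) * x" for x
        by (simp add: add_divide_distrib ring_distribs ex_add)
      also have "ex (5 * of_int (phi a b c d + 1) / 12) = ex (5 * of_int (phi (a + c) (b + d) c d) / 12)"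
        by (rule ex_cong_12[OF cong_sym[OF phi_T[OF det]]])
      finally show "KK v1 v2 (moebius (a + c) (b + d) c d \<tau>) = ex (5 * of_int (phi (a + c) (b + d) c d) / 12) *
           KK (v1 * (a + c) + v2 * c) (v1 * (b + d) + v2 * d) \<tau>"
        by (simp add: algebra_simps)
    qed
    show "P (a - c) (b - d) c d"
      unfolding P_def
    proof (intro allI impI)
      fix v1 v2 :: int assume v: "\<not> (11 dvd v1 \<and> 11 dvd v2)"
      hence v': "\<not> (11 dvd v1 \<and> 11 dvd v2 - v1)"
        by (metis dvd_add diff_add_cancel)
      have det': "(a - c) * d - (b - d) * c = 1"
        using det by (simp add: algebra_simps)
      have "KK v1 (v2 - v1) (moebius a b c d \<tau>) = KK v1 (v2 - v1) (moebius (a - c) (b - d) c d \<tau> + 1)"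
        unfolding moebius_T'[OF det \<tau>] by simp
      also have "\<dots> = ex (5 / 12) * KK v1 v2 (moebius (a - c) (b - d) c d \<tau>)"
        using KK_T[OF v'] by simp
      finally have "ex (5 / 12) * KK v1 v2 (moebius (a - c) (b - d) c d \<tau>) = KK v1 (v2 - v1) (moebius a b c d \<tau>)" ..
      also have "\<dots> = ex (5 * of_int (phi a b c d) / 12) * KK (v1 * a + (v2 - v1) * c) (v1 * b + (v2 - v1) * d) \<tau>"
        using IH v' unfolding P_def by blast
      also have "ex (5 * of_int (phi a b c d) / 12) = ex (5 * of_int (phi (a - c) (b - d) c d + 1) / 12)"
        using phi_T[OF det'] by (intro ex_cong_12) simp
      also have "\<dots> = ex (5 / 12) * ex (5 * of_int (phi (a - c) (b - d) c d) / 12)"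
        by (simp add: add_divide_distrib ring_distribs ex_add)
      finally have "ex (5 / 12) * KK v1 v2 (moebius (a - c) (b - d) c d \<tau>) = ex (5 / 12) *
          (ex (5 * of_int (phi (a - c) (b - d) c d) / 12) * KK (v1 * a + (v2 - v1) * c) (v1 * b + (v2 - v1) * d) \<tau>)"
        by (simp only: mult.assoc)
      hence "KK v1 v2 (moebius (a - c) (b - d) c d \<tau>) =
          ex (5 * of_int (phi (a - c) (b - d) c d) / 12) * KK (v1 * a + (v2 - v1) * c) (v1 * b + (v2 - v1) * d) \<tau>"
        by (subst (asm) mult_cancel_left) simp
      thus "KK v1 v2 (moebius (a - c) (b - d) c d \<tau>) = ex (5 * of_int (phi (a - c) (b - d) c d) / 12) *
           KK (v1 * (a - c) + v2 * c) (v1 * (b - d) + v2 * d) \<tau>"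
        by (simp add: algebra_simps)
    qed
    show "P (- c) (- d) a b"
      unfolding P_def
    proof (intro allI impI)
      fix v1 v2 :: int assume v: "\<not> (11 dvd v1 \<and> 11 dvd v2)"
      hence v': "\<not> (11 dvd v2 \<and> 11 dvd - v1)" by auto
      have "KK v1 v2 (moebius (- c) (- d) a b \<tau>) = - \<i> * KK v2 (- v1) (moebius a b c d \<tau>)"
        unfolding moebius_S by (rule KK_S[OF v Im])
      also have "KK v2 (- v1) (moebius a b c d \<tau>) = ex (5 * of_int (phi a b c d) / 12) *
          KK (v2 * a + (- v1) * c) (v2 * b + (- v1) * d) \<tau>"
        using IH v' unfolding P_def by blast
      also have "- \<i> * (ex (5 * of_int (phi a b c d) / 12) * x) = ex (5 * of_int (phi a b c d - 3) / 12) * x" for x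
      proof -
        have "- \<i> = ex (- (5 / 4))"
        proof -
          have "ex (- (5 / 4)) = ex (- (1 / 4))"
            by (rule ex_eqI) simp
          also have "\<dots> = - \<i>"
            by (simp add: ex_def exp_eq_polar)
          finally show ?thesis ..
        qed
        hence "- \<i> * ex (5 * of_int (phi a b c d) / 12) = ex (- (5 / 4) + 5 * of_int (phi a b c d) / 12)"
          by (simp only: ex_add)
        also have "- (5 / 4) + 5 * of_int (phi a b c d) / 12 = (5 * of_int (phi a b c d - 3) / 12 :: complex)"
          by (simp add: field_simps)
        finally show ?thesis by (simp only: mult.assoc [symmetric])
      qed
      also have "ex (5 * of_int (phi a b c d - 3) / 12) = ex (5 * of_int (phi (- c) (- d) a b) / 12)"
        by (rule ex_cong_12[OF cong_sym[OF phi_S[OF det]]])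
      finally show "KK v1 v2 (moebius (- c) (- d) a b \<tau>) = ex (5 * of_int (phi (- c) (- d) a b) / 12) *
           KK (v1 * - c + v2 * a) (v1 * - d + v2 * b) \<tau>"
        by (simp add: algebra_simps)
    qed
  qed
  thus ?thesis using v unfolding P_def by blast
qed

section \<open>The Hecke operator of index 121\<close>

lemma sqi_S: "Im \<tau> > 0 \<Longrightarrow> sqi (- (1 / \<tau>)) * sqi \<tau> = 1"
proof -
  assume \<tau>: "Im \<tau> > 0"
  have "eta \<tau> = (sqi (- (1 / \<tau>)) * sqi \<tau>) * eta \<tau>"
    using eta_S'[OF Im_minus_inverse_pos[OF \<tau>]] eta_S'[OF \<tau>] by simp
  thus ?thesis by simp
qed

text \<open>The residue class is that of the matrix in \<open>eta_S_121\<close>: with translations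
  by multiples of 24 the diagonal entries vanish modulo 12, and the character no longer depends on x
  and y.\<close>

lemma phi_eq_3:
  assumes "[a = 0] (mod 12)" "[b = 1] (mod 12)" "[c = -1] (mod 12)" "[d = 0] (mod 12)"
  shows "ex (5 * of_int (phi a b c d) / 12) = \<i>"
proof -
  have "[phi a b c d = phi 0 1 (-1) 0] (mod 12)"
    by (rule phi_cong[OF assms])
  hence "ex (5 * of_int (phi a b c d) / 12) = ex (5 * of_int 3 / 12)"
    using ex_cong_12[of "phi a b c d" 3] by (simp add: phi_def)
  also have "\<dots> = ex (1 / 4)"
    by (rule ex_eqI) simp
  also have "\<dots> = \<i>"
    by (simp add: ex_def exp_eq_polar)
  finally show ?thesis .
qed

text \<open>
  \<open>\<eta>(\<tau>'/121)\<close> is a product of two functions from the preceding section, each of which is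
  transformed by an explicit matrix; the Legendre symbols and the characters cancel.
\<close>

lemma eta_S_121:
  assumes \<tau>: "Im \<tau> > 0" and xy: "[(24 * x) * (24 * y) = -1] (mod 121)"
  shows "eta ((- (1 / \<tau>) + of_int (24 * x)) / 121) = sqi \<tau> * eta ((\<tau> + of_int (24 * y)) / 121)"
proof -
  from xy have "121 dvd 1 + (24 * x) * (24 * y)"
    by (simp add: cong_iff_dvd_diff add.commute)
  then obtain m where m: "1 + (24 * x) * (24 * y) = 121 * m" by blast
  define p where "p = - (11 * m)"
  define w where "w = (\<tau> + of_int (24 * y)) / 11"
  have w: "Im w > 0" using \<tau> by (simp add: w_def)
  have det: "(24 * x) * (- (24 * y)) - p * 11 = 1"
    using m by (simp add: p_def)
  have moeb: "moebius (24 * x) p 11 (- (24 * y)) w = (- (1 / \<tau>) + of_int (24 * x)) / 11"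
    using moebius_isogeny[of "24 * x" "24 * y" 11 "11 * m" \<tau>] m \<tau> by (simp add: p_def w_def)
  have not_dvd: "\<not> 11 dvd 24 * x"
  proof
    assume "11 dvd 24 * x"
    hence "11 dvd 11 * (11 * m) - (24 * x) * (24 * y)"
      by (rule dvd_diff[OF dvd_triv_left dvd_mult2])
    also have "11 * (11 * m) - (24 * x) * (24 * y) = 1"
      using m by simp
    finally show False by simp
  qed
  have "p - 1 = 12 * (48 * x * y - 11 * m)"
    using m by (simp add: p_def)
  hence "[p = 1] (mod 12)"
    by (simp add: cong_iff_dvd_diff)
  hence chi: "ex (5 * of_int (phi (24 * x) p 11 (- (24 * y))) / 12) = \<i>"
    by (intro phi_eq_3) (auto simp: cong_def)
  \<comment> \<open>The vector (1, 0) stands for division by 11. It is sent to (24 x, p) with 11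
    dividing p, which stands for w / 11 again, up to a Legendre symbol.\<close>
  have "KK 1 0 (moebius (24 * x) p 11 (- (24 * y)) w) = \<i> * KK (24 * x) p w"
    using KK_sl2[OF det w, of 1 0] by (simp add: chi)
  hence K1: "K1 0 ((- (1 / \<tau>) + of_int (24 * x)) / 11) = \<i> * leg (24 * x) * K1 0 w"
  proof -
    have "K1 (p * (24 * x) ^ 9) w = K1 0 w"
      by (intro K1_cong) (simp add: p_def cong_0_iff)
    moreover assume "KK 1 0 (moebius (24 * x) p 11 (- (24 * y)) w) = \<i> * KK (24 * x) p w"
    ultimately show ?thesis
      unfolding moeb using not_dvd by (simp add: KK_def leg_def)
  qed
  have "[(24 * x) * (24 * y) = -1] (mod 11)"
    using xy by (rule cong_dvd_modulus) simp
  from K1_S[OF \<tau> this] have K2: "K1 (24 * x) (- (1 / \<tau>)) = - \<i> * leg (24 * x) * K1 (24 * y) \<tau>" .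
  have ex_24: "ex (- (11 * of_int (24 * z) / 24)) = 1" for z
    using ex_of_int[of "- (11 * z)"] by simp
  have K1_0: "eta (z / 11) = K1 0 z * eta z" for z
    by (simp add: K1_def)
  have K1_24: "eta ((z + of_int (24 * x)) / 11) = K1 (24 * x) z * eta z" for z x
    unfolding K1_def ex_24 by simp
  have "eta ((- (1 / \<tau>) + of_int (24 * x)) / 121) = eta ((- (1 / \<tau>) + of_int (24 * x)) / 11 / 11)"
    by simp
  also have "\<dots> = (\<i> * leg (24 * x) * K1 0 w) * (- \<i> * leg (24 * x) * K1 (24 * y) \<tau> * (sqi \<tau> * eta \<tau>))"
    unfolding K1_0[of "(- (1 / \<tau>) + of_int (24 * x)) / 11"] K1_24[of "- (1 / \<tau>)"] K1 K2 eta_S'[OF \<tau>] ..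
  also have "\<dots> = (leg (24 * x) * leg (24 * x)) * sqi \<tau> * (K1 0 w * (K1 (24 * y) \<tau> * eta \<tau>))"
    by (simp add: mult_ac)
  also have "\<dots> = sqi \<tau> * eta (w / 11)"
    unfolding leg_squared K1_0[of w] by (simp add: w_def flip: K1_24)
  finally show ?thesis by (simp add: w_def)
qed

section \<open>Series in powers j - 1/24\<close>

definition qterm :: "(int \<Rightarrow> int) \<Rightarrow> complex \<Rightarrow> int \<Rightarrow> complex" where
  "qterm a \<tau> j = of_int (a j) * ex (of_int (24 * j - 1) * \<tau> / 24)"

definition qsum :: "(int \<Rightarrow> int) \<Rightarrow> complex \<Rightarrow> complex" where
  "qsum a \<tau> = infsum (qterm a \<tau>) UNIV"

text \<open>
  Coefficient sequences \<open>a\<close> for which \<open>\<Sum>\<^sub>j a(j) q\<^sup>j\<^sup>-\<^sup>1\<^sup>/\<^sup>2\<^sup>4\<close> is, after multiplication by \<open>\<eta>\<close>, a weakly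
  holomorphic modular form of weight 4.
\<close>

definition eform :: "(int \<Rightarrow> int) \<Rightarrow> bool" where
  "eform a \<longleftrightarrow> (\<exists>N. \<forall>j < - int N. a j = 0) \<and>
     (\<forall>\<tau>. Im \<tau> > 0 \<longrightarrow> (\<lambda>j. norm (qterm a \<tau> j)) summable_on UNIV) \<and>
     (\<forall>\<tau>. Im \<tau> > 0 \<longrightarrow> qsum a (- (1 / \<tau>)) = \<tau> ^ 4 / sqi \<tau> * qsum a \<tau>)"

lemma eform_has_sum:
  assumes "eform a" "Im \<tau> > 0"
  shows "(qterm a \<tau> has_sum qsum a \<tau>) UNIV"
  using assms abs_summable_summable unfolding eform_def qsum_def by (intro has_sum_infsum) blast

lemma qsum_add_int: "qsum a (\<tau> + of_int n) = ex (- of_int n / 24) * qsum a \<tau>"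
proof -
  have "qterm a (\<tau> + of_int n) j = ex (- of_int n / 24) * qterm a \<tau> j" for j
  proof -
    have "ex (of_int (24 * j - 1) * (\<tau> + of_int n) / 24) =
            ex (of_int (24 * j - 1) * \<tau> / 24 + (- of_int n / 24 + of_int (j * n)))"
      by (rule arg_cong[of _ _ ex]) (simp add: field_simps)
    also have "\<dots> = ex (of_int (24 * j - 1) * \<tau> / 24) * ex (- of_int n / 24)"
      by (simp only: ex_add ex_of_int mult_1_right)
    finally show ?thesis by (simp add: qterm_def)
  qed
  hence "qterm a (\<tau> + of_int n) = (\<lambda>j. ex (- of_int n / 24) * qterm a \<tau> j)" by auto
  thus ?thesis
    unfolding qsum_def by (simp add: infsum_cmult_right')
qed

text \<open>Multiplication by \<open>eta\<close> cancels the multiplier, and the product has weight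
  4 and trivial character, so the general isogeny lemma applies. The known behaviour of
  \<open>eta\<close> can then be divided out.\<close>

lemma eform_isogeny:
  assumes a: "eform a" and "1 + x * y = p * m" "p > 0" "Im \<tau> > 0"
  defines "f \<equiv> \<lambda>\<tau>. qsum a \<tau> * eta \<tau>"
  shows "f ((- (1 / \<tau>) + of_int x) / of_int p) = \<tau> ^ 4 * f ((\<tau> + of_int y) / of_int p)"
proof (rule modular_form_isogeny[OF _ _ assms(2-4)])
  fix \<tau> :: complex assume \<tau>: "Im \<tau> > 0"
  have "f (\<tau> + 1) = (ex (- (1 / 24)) * ex (1 / 24)) * f \<tau>"
    using qsum_add_int[of a \<tau> 1] by (simp add: f_def eta_add_1)
  also have "ex (- (1 / 24)) * ex (1 / 24) = 1"
    by (simp flip: ex_add)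
  finally show "f (\<tau> + 1) = f \<tau>" by simp
  show "f (- (1 / \<tau>)) = \<tau> ^ 4 * f \<tau>"
    using a \<tau> sqi_nonzero[OF \<tau>] by (simp add: f_def eform_def eta_S'[OF \<tau>])
qed

lemma qsum_S: "eform a \<Longrightarrow> Im \<tau> > 0 \<Longrightarrow> qsum a (- (1 / \<tau>)) = \<tau> ^ 4 / sqi \<tau> * qsum a \<tau>"
  by (simp add: eform_def)

section \<open>The summands of the Hecke operator\<close>

text \<open>Representatives of the nonzero residues modulo 11 among the divisors of 12, so that
  \<open>eta_word\<close> applies with \<open>c = 12 div b\<close>.\<close>

definition cusps :: "int set" where
  "cusps = {1, 2, 3, 4, 6, -1, -2, -3, -4, -6}"

lemma cusps_mult: "b \<in> cusps \<Longrightarrow> b * (12 div b) = 12"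
  by (auto simp: cusps_def)

text \<open>The root of unity produced by \<open>eta_word\<close> and a translation by 11 c; with it
  \<open>hecke_mid\<close> is exactly what the inversion makes of a \<open>hecke_zero\<close>
  term.\<close>

definition kappa :: "int \<Rightarrow> complex" where
  "kappa b = of_int (sgn b) * \<i> * (-1) ^ nat \<bar>12 div b\<bar> * ex (- of_int b / 24)"

text \<open>The three kinds of summand belong to the primitive upper triangular matrices of
  determinant 121, namely \<open>[121, 0; 0, 1]\<close>, \<open>[1, 24 * x; 0, 121]\<close> and
  \<open>[11, b; 0, 11]\<close>. Translations by multiples of 24 avoid roots of unity in the second
  kind.\<close>

definition hecke_inf :: "(int \<Rightarrow> int) \<Rightarrow> complex \<Rightarrow> complex" where
  "hecke_inf a \<tau> = 11 ^ 5 * qsum a (121 * \<tau>)"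

definition hecke_zero :: "(int \<Rightarrow> int) \<Rightarrow> int \<Rightarrow> complex \<Rightarrow> complex" where
  "hecke_zero a x \<tau> = qsum a ((\<tau> + of_int (24 * x)) / 121) / 121"

definition hecke_mid :: "(int \<Rightarrow> int) \<Rightarrow> int \<Rightarrow> complex \<Rightarrow> complex" where
  "hecke_mid a b \<tau> = 11 * of_real (sqrt 11) * kappa b * qsum a (\<tau> + of_int b / 11)"

lemma hecke_zero_cong:
  assumes "[x = y] (mod 121)"
  shows "hecke_zero a x \<tau> = hecke_zero a y \<tau>"
proof -
  obtain k where k: "x = y + 121 * k"
    using assms by (metis cong_iff_lin cong_sym)
  have "qsum a ((\<tau> + of_int (24 * x)) / 121) = qsum a ((\<tau> + of_int (24 * y)) / 121 + of_int (24 * k))"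
    by (rule arg_cong[of _ _ "qsum a"]) (simp add: k field_simps)
  also have "\<dots> = qsum a ((\<tau> + of_int (24 * y)) / 121)"
    unfolding qsum_add_int using ex_of_int[of "- k"] by simp
  finally show ?thesis by (simp add: hecke_zero_def)
qed

lemma hecke_inf_S:
  assumes a: "eform a" and \<tau>: "Im \<tau> > 0"
  shows "hecke_inf a (- (1 / \<tau>)) = \<tau> ^ 4 / sqi \<tau> * hecke_zero a 0 \<tau>"
proof -
  have "sqi \<tau> = 11 * sqi (\<tau> / 121)"
    using sqi_cmult[of 121 "\<tau> / 121"] real_sqrt_abs[of 11] by simp
  moreover have "121 * (- (1 / \<tau>)) = - (1 / (\<tau> / 121))" by simp
  ultimately show ?thesis
    using qsum_S[OF a, of "\<tau> / 121"] \<tau> by (simp add: hecke_inf_def hecke_zero_def power_divide)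
qed

lemma hecke_zero_0_S:
  assumes a: "eform a" and \<tau>: "Im \<tau> > 0"
  shows "hecke_zero a 0 (- (1 / \<tau>)) = \<tau> ^ 4 / sqi \<tau> * hecke_inf a \<tau>"
proof -
  have "sqi (121 * \<tau>) = 11 * sqi \<tau>"
    using sqi_cmult[of 121 \<tau>] real_sqrt_abs[of 11] by simp
  moreover have "(- (1 / \<tau>) + of_int (24 * 0)) / 121 = - (1 / (121 * \<tau>))" by simp
  ultimately show ?thesis
    using qsum_S[OF a, of "121 * \<tau>"] \<tau>
    unfolding hecke_inf_def hecke_zero_def by (simp only:) (simp add: power_mult_distrib)
qed

lemma hecke_zero_S:
  assumes a: "eform a" and \<tau>: "Im \<tau> > 0" and xy: "[(24 * x) * (24 * y) = -1] (mod 121)"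
  shows "hecke_zero a x (- (1 / \<tau>)) = \<tau> ^ 4 / sqi \<tau> * hecke_zero a y \<tau>"
proof -
  define u where "u = (\<tau> + of_int (24 * y)) / 121"
  from xy have "121 dvd 1 + (24 * x) * (24 * y)"
    by (simp add: cong_iff_dvd_diff add.commute)
  then obtain m where m: "1 + (24 * x) * (24 * y) = 121 * m" by blast
  have "qsum a ((- (1 / \<tau>) + of_int (24 * x)) / 121) * (sqi \<tau> * eta u) = \<tau> ^ 4 * (qsum a u * eta u)"
    using eform_isogeny[OF a m _ \<tau>] unfolding of_int_numeral eta_S_121[OF \<tau> xy] u_def by simp
  hence "qsum a ((- (1 / \<tau>) + of_int (24 * x)) / 121) = \<tau> ^ 4 / sqi \<tau> * qsum a u"
    using sqi_nonzero[OF \<tau>] by (simp add: field_simps)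
  thus ?thesis
    unfolding hecke_zero_def u_def by simp
qed

text \<open>Put c = 12 / b. Since 24 * 55 = 121 * 11 - 11, the argument of this
  \<open>hecke_zero\<close> term is, up to translation by 11 c, the point (-1/(11 \<tau>) - c) / 11.
  So \<open>eform_isogeny\<close> and \<open>eta_word\<close> apply at 11 \<tau> and lead to (11
  \<tau> + b) / 11.\<close>

lemma hecke_zero_mid_S:
  assumes a: "eform a" and \<tau>: "Im \<tau> > 0" and b: "b \<in> cusps"
  shows "hecke_zero a (55 * (12 div b)) (- (1 / \<tau>)) = \<tau> ^ 4 / sqi \<tau> * hecke_mid a b \<tau>"
proof -
  have \<tau>0: "\<tau> \<noteq> 0" using \<tau> by auto
  define c where "c = 12 div b"
  have bc: "b * c = 12" using cusps_mult[OF b] by (simp add: c_def)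
  have bc': "of_int b * of_int c = (12::complex)"
    using bc by (metis of_int_mult of_int_numeral)
  have sgn: "sgn c = sgn b" "\<bar>sgn b\<bar> = 1"
    using b by (auto simp: c_def cusps_def)
  define u where "u = \<tau> + of_int b / 11"
  have arg: "(- (1 / (11 * \<tau>)) + of_int (- c)) / of_int 11 = (- (1 / \<tau>) - of_int (11 * c)) / 121"
    using \<tau>0 by (simp add: field_simps)
  have u: "(11 * \<tau> + of_int b) / of_int 11 = u"
    by (simp add: u_def field_simps)
  have Im: "Im (11 * \<tau>) > 0" using \<tau> by simp
  have "1 + (- c) * b = 11 * (- 1)" using bc by (simp add: mult.commute)
  from eform_isogeny[OF a this _ Im]
  have "qsum a ((- (1 / \<tau>) - of_int (11 * c)) / 121) * eta ((- (1 / \<tau>) - of_int (11 * c)) / 121) =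
          (11 * \<tau>) ^ 4 * (qsum a u * eta u)"
    unfolding arg u by simp
  moreover have "eta ((- (1 / \<tau>) - of_int (11 * c)) / 121) =
     ex (of_int (b + c) / 24) * (- of_int (sgn c) * \<i>) * (of_real (sqrt 11) * sqi \<tau>) * eta u"
    using eta_word[OF bc Im] sqi_cmult[of 11 \<tau>] unfolding arg [symmetric] u [symmetric] by simp
  ultimately have *: "qsum a ((- (1 / \<tau>) - of_int (11 * c)) / 121) *
     (ex (of_int (b + c) / 24) * (- of_int (sgn c) * \<i>) * (of_real (sqrt 11) * sqi \<tau>) * eta u) =
       (11 * \<tau>) ^ 4 * (qsum a u * eta u)"
    by simp
  define E where "E = ex (of_int (b + c) / 24)"
  define r where "r = complex_of_real (sqrt 11)"
  have r: "r * r = 11" "r \<noteq> 0"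
    by (simp_all add: r_def flip: of_real_mult)
  define \<epsilon> where "\<epsilon> = (of_int (sgn c) :: complex)"
  have \<epsilon>: "\<epsilon> * \<epsilon> = 1" "\<epsilon> \<noteq> 0"
    using sgn by (auto simp: \<epsilon>_def abs_if sgn_if split: if_splits)
  define Z where "Z = qsum a ((- (1 / \<tau>) - of_int (11 * c)) / 121)"
  have "Z * E * (\<epsilon> * \<epsilon>) * (r * r) * sqi \<tau> = \<epsilon> * \<i> * r * 11 ^ 4 * \<tau> ^ 4 * qsum a u"
  proof -
    have "(Z * (E * (- \<epsilon> * \<i>) * (r * sqi \<tau>))) * eta u = (11 ^ 4 * \<tau> ^ 4 * qsum a u) * eta u"
      using * by (simp add: Z_def E_def r_def \<epsilon>_def power_mult_distrib mult_ac)
    hence "Z * (E * (- \<epsilon> * \<i>) * (r * sqi \<tau>)) = 11 ^ 4 * \<tau> ^ 4 * qsum a u"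
      by (rule mult_right_cancel[OF eta_nonzero, THEN iffD1])
    hence "(\<epsilon> * \<i> * r) * (Z * (E * (- \<epsilon> * \<i>) * (r * sqi \<tau>))) = (\<epsilon> * \<i> * r) * (11 ^ 4 * \<tau> ^ 4 * qsum a u)"
      by (rule arg_cong)
    thus ?thesis by (simp add: mult_ac)
  qed
  hence Z: "Z = \<epsilon> * \<i> * r * 11 ^ 3 * \<tau> ^ 4 / sqi \<tau> * qsum a u * (1 / E)"
    unfolding \<epsilon> r using sqi_nonzero[OF \<tau>] by (simp add: E_def field_simps)
  have "qsum a ((- (1 / \<tau>) + of_int (24 * (55 * c))) / 121) =
          qsum a ((- (1 / \<tau>) - of_int (11 * c)) / 121 + of_int (11 * c))"
    by (rule arg_cong[of _ _ "qsum a"]) (simp add: field_simps)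
  also have "\<dots> = ex (- of_int (11 * c) / 24) * Z"
    unfolding qsum_add_int Z_def ..
  also have "\<dots> = (ex (- of_int (11 * c) / 24) * (1 / E)) * (\<epsilon> * \<i> * r * 11 ^ 3 * \<tau> ^ 4 / sqi \<tau> * qsum a u)"
    unfolding Z by simp
  also have "ex (- of_int (11 * c) / 24) * (1 / E) = (-1) ^ nat \<bar>c\<bar> * ex (- of_int b / 24)"
  proof -
    have "ex (- of_int (11 * c) / 24) * (1 / E) = ex (- of_int (11 * c) / 24 - of_int (b + c) / 24)"
      by (simp add: E_def ex_diff)
    also have "\<dots> = ex (of_nat (nat \<bar>c\<bar>) * (1 / 2) + - of_int b / 24)"
    proof (rule ex_eqI)
      have "of_nat (nat \<bar>c\<bar>) = (of_int \<bar>c\<bar> :: complex)" by simp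
      hence "- of_int (11 * c) / 24 - of_int (b + c) / 24 - (of_nat (nat \<bar>c\<bar>) * (1 / 2) + - of_int b / 24) =
          (of_int (if c \<ge> 0 then - c else 0) :: complex)"
        by (auto simp: abs_if field_simps)
      thus "- of_int (11 * c) / 24 - of_int (b + c) / 24 - (of_nat (nat \<bar>c\<bar>) * (1 / 2) + - of_int b / 24) \<in> (\<int> :: complex set)"
        by (simp only: Ints_of_int)
    qed
    also have "\<dots> = (-1) ^ nat \<bar>c\<bar> * ex (- of_int b / 24)"
      unfolding ex_add ex_mult_nat by (simp add: ex_def)
    finally show ?thesis .
  qed
  finally show ?thesis
    by (simp add: hecke_zero_def hecke_mid_def kappa_def u_def r_def \<epsilon>_def sgn(1) flip: c_def)
qed

lemma hecke_mid_S:
  assumes a: "eform a" and \<tau>: "Im \<tau> > 0" and b: "b \<in> cusps"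
  shows "hecke_mid a b (- (1 / \<tau>)) = \<tau> ^ 4 / sqi \<tau> * hecke_zero a (55 * (12 div b)) \<tau>"
proof -
  have \<tau>0: "\<tau> \<noteq> 0" using \<tau> by auto
  have "hecke_zero a (55 * (12 div b)) \<tau> = (- (1 / \<tau>)) ^ 4 / sqi (- (1 / \<tau>)) * hecke_mid a b (- (1 / \<tau>))"
    using hecke_zero_mid_S[OF a Im_minus_inverse_pos[OF \<tau>] b] by simp
  also have "(- (1 / \<tau>)) ^ 4 / sqi (- (1 / \<tau>)) = sqi \<tau> / \<tau> ^ 4"
  proof -
    have "sqi (- (1 / \<tau>)) = 1 / sqi \<tau>"
      using sqi_S[OF \<tau>] sqi_nonzero[OF \<tau>] by (simp add: field_simps)
    thus ?thesis by (simp add: power_divide)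
  qed
  finally show ?thesis
    using \<tau>0 sqi_nonzero[OF \<tau>] by simp
qed

definition hecke :: "(int \<Rightarrow> int) \<Rightarrow> complex \<Rightarrow> complex" where
  "hecke a \<tau> = hecke_inf a \<tau> + (\<Sum>x\<in>{0..<121}. hecke_zero a x \<tau>) + (\<Sum>b\<in>cusps. hecke_mid a b \<tau>)"

text \<open>The classes x modulo 121 are sorted by their partners under the inversion: 0 goes with
  \<open>hecke_inf\<close>, the nonzero multiples of 11 with \<open>hecke_mid\<close>, and the units
  are permuted among themselves.\<close>

lemma hecke_split:
  "hecke a \<tau> = hecke_inf a \<tau> + hecke_zero a 0 \<tau> + (\<Sum>x | x \<in> {0..<121} \<and> \<not> 11 dvd x. hecke_zero a x \<tau>) +
     (\<Sum>b\<in>cusps. hecke_zero a (55 * (12 div b)) \<tau>) + (\<Sum>b\<in>cusps. hecke_mid a b \<tau>)"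
proof -
  define U where "U = {x::int. x \<in> {0..<121} \<and> \<not> 11 dvd x}"
  define V where "V = (\<lambda>b. (55 * (12 div b)) mod 121) ` cusps"
  have V: "V = {11, 22, 33, 44, 55, 66, 77, 88, 99, 110}"
    by (auto simp: V_def cusps_def)
  have inj: "inj_on (\<lambda>b. (55 * (12 div b)) mod 121) cusps"
    by (auto simp: inj_on_def cusps_def)
  have "{0..<121} = insert 0 (U \<union> V)"
  proof (intro equalityI subsetI)
    fix x :: int assume x: "x \<in> {0..<121}"
    show "x \<in> insert 0 (U \<union> V)"
    proof (cases "11 dvd x")
      case True
      then obtain y where y: "x = 11 * y" by blast
      hence "y \<in> {0..10}" using x by auto
      hence "y \<in> {0,1,2,3,4,5,6,7,8,9,10}"
        unfolding atLeastAtMost_iff insert_iff empty_iff by presburger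
      thus ?thesis unfolding V using y by auto
    qed (use x in \<open>auto simp: U_def\<close>)
  qed (auto simp: U_def V)
  moreover have "0 \<notin> U \<union> V" "U \<inter> V = {}" "finite V"
    by (auto simp: U_def V)
  moreover have "finite U"
    by (rule finite_subset[of _ "{0..<121}"]) (auto simp: U_def)
  ultimately have "(\<Sum>x\<in>{0..<121}. hecke_zero a x \<tau>) =
      hecke_zero a 0 \<tau> + ((\<Sum>x\<in>U. hecke_zero a x \<tau>) + (\<Sum>x\<in>V. hecke_zero a x \<tau>))"
    by (simp add: sum.union_disjoint)
  also have "(\<Sum>x\<in>V. hecke_zero a x \<tau>) = (\<Sum>b\<in>cusps. hecke_zero a ((55 * (12 div b)) mod 121) \<tau>)"
    unfolding V_def by (simp add: sum.reindex[OF inj])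
  also have "\<dots> = (\<Sum>b\<in>cusps. hecke_zero a (55 * (12 div b)) \<tau>)"
    by (intro sum.cong refl hecke_zero_cong) (simp add: cong_def)
  finally show ?thesis
    by (simp add: hecke_def U_def)
qed

theorem hecke_S:
  assumes a: "eform a" and \<tau>: "Im \<tau> > 0"
  shows "hecke a (- (1 / \<tau>)) = \<tau> ^ 4 / sqi \<tau> * hecke a \<tau>"
proof -
  define U where "U = {x::int. x \<in> {0..<121} \<and> \<not> 11 dvd x}"
  have coprime_121: "coprime x 121" if "\<not> 11 dvd x" for x :: int
  proof -
    have "coprime 11 x"
      by (rule prime_imp_coprime[OF prime_11 that])
    hence "coprime (x ^ 1) (11 ^ 2)"
      by (simp only: coprime_power_left_iff coprime_power_right_iff) (simp add: coprime_commute)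
    thus ?thesis by simp
  qed
  have coprime_U: "coprime x 121" if "x \<in> U" for x
    using that by (intro coprime_121) (simp add: U_def)
  have coprime_576: "coprime (576 :: int) 121"
    by (rule coprime_121) simp
  have ex1: "\<exists>y. y \<in> U \<and> [(24 * x) * (24 * y) = -1] (mod 121)" if "x \<in> U" for x
  proof -
    have "coprime (576 * x) 121"
      using coprime_U[OF that] coprime_576 by simp
    then obtain y where y: "[576 * x * y = 1] (mod 121)"
      using cong_solve_coprime_int by blast
    have y': "[(24 * x) * (24 * ((- y) mod 121)) = -1] (mod 121)"
    proof -
      have "[(24 * x) * (24 * ((- y) mod 121)) = (24 * x) * (24 * (- y))] (mod 121)"
        by (intro cong_mult cong_refl) (simp add: cong_def)
      also have "(24 * x) * (24 * (- y)) = - (576 * x * y)"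
        by simp
      also have "[- (576 * x * y) = -1] (mod 121)"
        using y by (simp only: cong_minus_minus_iff)
      finally show ?thesis .
    qed
    moreover have "\<not> 11 dvd (- y) mod 121"
    proof
      assume "11 dvd (- y) mod 121"
      hence "[(24 * x) * (24 * ((- y) mod 121)) = 0] (mod 11)"
        by (simp add: cong_0_iff)
      moreover have "[(24 * x) * (24 * ((- y) mod 121)) = -1] (mod 11)"
        using y' by (rule cong_dvd_modulus) simp
      ultimately have "[-1 = (0::int)] (mod 11)"
        using cong_trans cong_sym by blast
      thus False by (simp add: cong_def)
    qed
    ultimately show ?thesis
      by (intro exI[of _ "(- y) mod 121"]) (auto simp: U_def)
  qed
  \<comment> \<open>The involution x -> -1 / (576 x) on the units modulo 121, which re-indexes the
    sum over U.\<close>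
  define j where "j = (\<lambda>x. SOME y. y \<in> U \<and> [(24 * x) * (24 * y) = -1] (mod 121))"
  have j: "j x \<in> U" "[(24 * x) * (24 * j x) = -1] (mod 121)" if "x \<in> U" for x
    using someI_ex[OF ex1[OF that]] unfolding j_def by blast+
  have jj: "j (j x) = x" if x: "x \<in> U" for x
  proof -
    have "[(24 * j x) * (24 * j (j x)) = (24 * j x) * (24 * x)] (mod 121)"
      using cong_trans[OF j(2)[OF j(1)[OF x]] cong_sym[OF j(2)[OF x]]]
      by (simp only: mult.commute[of "24 * x"])
    hence "[(576 * j x) * j (j x) = (576 * j x) * x] (mod 121)"
      by (simp add: mult_ac)
    moreover have "coprime (576 * j x) 121"
      using coprime_U[OF j(1)[OF x]] coprime_576 by simp
    ultimately have "[j (j x) = x] (mod 121)"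
      by (simp add: cong_mult_lcancel)
    moreover have "x \<in> {0..<121}" "j (j x) \<in> {0..<121}"
      using x j(1)[OF j(1)[OF x]] by (auto simp: U_def)
    ultimately show ?thesis
      by (simp add: cong_def)
  qed
  define w where "w = \<tau> ^ 4 / sqi \<tau>"
  have "(\<Sum>x\<in>U. hecke_zero a x (- (1 / \<tau>))) = (\<Sum>x\<in>U. w * hecke_zero a x \<tau>)"
  proof (rule sum.reindex_bij_witness[of _ j j])
    fix x assume x: "x \<in> U"
    show "w * hecke_zero a (j x) \<tau> = hecke_zero a x (- (1 / \<tau>))"
      unfolding w_def using hecke_zero_S[OF a \<tau> j(2)[OF x]] by simp
  qed (use j jj in auto)
  thus ?thesis
    unfolding hecke_split hecke_inf_S[OF a \<tau>] hecke_zero_0_S[OF a \<tau>] w_def [symmetric] U_def [symmetric]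
    by (simp add: hecke_mid_S[OF a \<tau>] hecke_zero_mid_S[OF a \<tau>] ring_distribs sum_distrib_left flip: w_def)
qed

section \<open>Coefficients of the image\<close>

lemma has_sum_sum_finite:
  fixes f :: "'a \<Rightarrow> 'b \<Rightarrow> complex"
  assumes "finite A" "\<And>x. x \<in> A \<Longrightarrow> (f x has_sum s x) B"
  shows "((\<lambda>j. \<Sum>x\<in>A. f x j) has_sum (\<Sum>x\<in>A. s x)) B"
  using assms by (induction A rule: finite_induct) (auto intro!: has_sum_add)

definition mid_coeff :: "int \<Rightarrow> complex" where
  "mid_coeff j = (\<Sum>b\<in>cusps. kappa b * ex (of_int (24 * j - 1) * of_int b / 264))"

text \<open>Up to a factor \<open>\<i>\<close>, \<open>mid_coeff j\<close> is a quadratic Gauss sum modulo 11.\<close>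

lemma mid_coeff_squared: "mid_coeff j = 0 \<or> mid_coeff j ^ 2 = 11"
proof -
  define \<zeta> where "\<zeta> = (of_int (2 * j - 1) / 22 :: complex)"
  define z where "z = ex \<zeta>"
  have z11: "z ^ 11 = -1"
  proof -
    have "z ^ 11 = ex (of_nat 11 * \<zeta>)"
      unfolding ex_mult_nat z_def ..
    also have "\<dots> = ex (1 / 2)"
    proof (rule ex_eqI)
      have "of_nat 11 * \<zeta> - 1 / 2 = of_int (j - 1)"
        by (simp add: \<zeta>_def field_simps)
      thus "of_nat 11 * \<zeta> - 1 / 2 \<in> \<int>" by (simp only: Ints_of_int)
    qed
    also have "\<dots> = -1" by (simp add: ex_def)
    finally show ?thesis .
  qed
  have kap: "kappa b * ex (of_int (24 * j - 1) * of_int b / 264) =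
               of_int (sgn b) * \<i> * (-1) ^ nat \<bar>12 div b\<bar> * ex (of_int b * \<zeta>)" for b
  proof -
    have "ex (- of_int b / 24) * ex (of_int (24 * j - 1) * of_int b / 264) = ex (of_int b * \<zeta>)"
      unfolding ex_add [symmetric] by (rule arg_cong[of _ _ ex]) (simp add: \<zeta>_def field_simps)
    thus ?thesis by (simp add: kappa_def mult.assoc)
  qed
  have pos: "ex (of_int b * \<zeta>) = z ^ nat b" if "b \<ge> 0" for b
    using ex_mult_nat[of "nat b" \<zeta>] that by (simp add: z_def)
  have neg: "ex (of_int b * \<zeta>) = - (z ^ nat (11 + b))" if "b < 0" "b \<ge> -11" for b
  proof -
    have "ex (of_int b * \<zeta>) * z ^ 11 = ex (of_int (11 + b) * \<zeta>)"
      unfolding z_def ex_mult_nat [symmetric] ex_add [symmetric] by (rule arg_cong[of _ _ ex]) (simp add: algebra_simps)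
    also have "\<dots> = z ^ nat (11 + b)"
      using that by (intro pos) simp
    finally have "- ex (of_int b * \<zeta>) = z ^ nat (11 + b)"
      unfolding z11 by simp
    thus ?thesis by (metis minus_minus)
  qed
  \<comment> \<open>Written in the 11th root of unity \<omega> = -z, the coefficient of \<omega>^b
    is minus the Legendre symbol of b.\<close>
  define G where "G = z + z ^ 2 + z ^ 3 - z ^ 4 + z ^ 5 + z ^ 6 - z ^ 7 + z ^ 8 + z ^ 9 + z ^ 10"
  have G: "mid_coeff j = \<i> * G"
  proof -
    note vals = pos[of 1] pos[of 2] pos[of 3] pos[of 4] pos[of 6]
      neg[of "-1"] neg[of "-2"] neg[of "-3"] neg[of "-4"] neg[of "-6"]
    show ?thesis
      unfolding mid_coeff_def kap cusps_def by (simp add: vals[simplified]) (simp add: G_def algebra_simps)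
  qed
  \<comment> \<open>As \<open>z ^ 11 = -1\<close>, z is a root of 1 + z or of Q, the 22nd cyclotomic
    polynomial. The first case means that 11 divides 24 j - 1, and then the Gauss sum
    vanishes.\<close>
  define Q where "Q = 1 - z + z ^ 2 - z ^ 3 + z ^ 4 - z ^ 5 + z ^ 6 - z ^ 7 + z ^ 8 - z ^ 9 + z ^ 10"
  have "(1 + z) * Q = 1 + z ^ 11"
    unfolding Q_def by (simp add: algebra_simps eval_nat_numeral)
  hence "(1 + z) * Q = 0" unfolding z11 by simp
  hence "z = -1 \<or> Q = 0" by (auto simp: add_eq_0_iff)
  thus ?thesis
  proof
    assume "z = -1"
    hence "G = 0" by (simp add: G_def)
    thus ?thesis by (simp add: G)
  next
    assume "Q = 0"
    \<comment> \<open>The second factor is the quotient in the polynomial division of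
      \<open>G ^ 2 + 11\<close> by Q.\<close>
    have "G ^ 2 + 11 = Q * (11 + 11 * z + z ^ 2 + 3 * z ^ 3 + 5 * z ^ 4 + 3 * z ^ 5 + z ^ 6 + 3 * z ^ 7 + 5 * z ^ 8 + 3 * z ^ 9 + z ^ 10)"
      unfolding G_def Q_def by (simp add: algebra_simps eval_nat_numeral)
    hence "G ^ 2 = - 11" using \<open>Q = 0\<close> by (simp add: add_eq_0_iff2)
    thus ?thesis by (simp add: G power_mult_distrib)
  qed
qed

lemma mid_coeff_integral: "\<exists>k. 11 * of_real (sqrt 11) * mid_coeff j = of_int (121 * k)"
proof -
  define r where "r = complex_of_real (sqrt 11)"
  have r: "r * r = 11"
    by (simp add: r_def flip: of_real_mult)
  have "mid_coeff j = 0 \<or> mid_coeff j ^ 2 = r ^ 2"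
    using mid_coeff_squared[of j] r by (simp add: power2_eq_square)
  hence "mid_coeff j = 0 \<or> mid_coeff j = r \<or> mid_coeff j = - r"
    by (auto simp: power2_eq_iff)
  thus ?thesis
  proof (elim disjE)
    assume "mid_coeff j = r"
    thus ?thesis using r by (intro exI[of _ 1]) (simp add: r_def mult.assoc)
  next
    assume "mid_coeff j = - r"
    thus ?thesis using r by (intro exI[of _ "-1"]) (simp add: r_def mult.assoc)
  qed (auto intro: exI[of _ 0])
qed

text \<open>By \<open>mid_coeff_squared\<close> the value is 0, 1 or -1; it is the Legendre symbol
  of j + 5 modulo 11. The argument below relies on its integrality.\<close>

definition hecke_mult :: "int \<Rightarrow> int" where
  "hecke_mult j = (SOME k. 11 * of_real (sqrt 11) * mid_coeff j = of_int (121 * k))"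

lemma hecke_mult: "11 * of_real (sqrt 11) * mid_coeff j = of_int (121 * hecke_mult j)"
  unfolding hecke_mult_def by (rule someI_ex[OF mid_coeff_integral])

text \<open>The powers 11^2 and 11^5 are the standard ones for weight 3 + 1/2. In terms of 24 j - 1,
  the index \<open>121 * j - 5\<close> is multiplication by 121 and \<open>(j + 5) div 121\<close>
  is division by 121.\<close>

definition hecke_coeff :: "(int \<Rightarrow> int) \<Rightarrow> int \<Rightarrow> int" where
  "hecke_coeff a j = a (121 * j - 5) + 121 * hecke_mult j * a j +
     (if 121 dvd j + 5 then 11 ^ 5 * a ((j + 5) div 121) else 0)"

lemma inj_shift: "inj (\<lambda>i::int. 121 * i - 5)"
  by (auto simp: inj_def)

lemma range_shift: "j \<in> range (\<lambda>i::int. 121 * i - 5) \<longleftrightarrow> 121 dvd j + 5"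
proof
  assume "121 dvd j + 5"
  then obtain i where "j + 5 = 121 * i" by blast
  hence "j = 121 * i - 5" by simp
  thus "j \<in> range (\<lambda>i::int. 121 * i - 5)" by blast
qed auto

lemma sum_roots_of_unity:
  assumes "p > 0"
  shows "(\<Sum>x\<in>{0..<int p}. ex (of_int m * of_int x / of_nat p)) = (if int p dvd m then of_nat p else 0)"
proof -
  define z where "z = ex (of_int m / of_nat p)"
  have "(\<Sum>x\<in>{0..<int p}. ex (of_int m * of_int x / of_nat p)) = (\<Sum>n<p. z ^ n)"
  proof (rule sum.reindex_bij_witness[of _ int nat])
    fix x :: int assume "x \<in> {0..<int p}"
    thus "z ^ nat x = ex (of_int m * of_int x / of_nat p)"
      unfolding z_def ex_mult_nat [symmetric] by (simp add: mult_ac)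
  qed auto
  also have "\<dots> = (if int p dvd m then of_nat p else 0)"
  proof (cases "int p dvd m")
    case True
    then obtain i where "m = int p * i" by blast
    hence "of_int m / of_nat p = (of_int i :: complex)"
      using assms by simp
    thus ?thesis using True by (simp add: z_def)
  next
    case False
    have "z \<noteq> 1"
    proof
      assume "z = 1"
      then obtain i where "of_int m / of_nat p = (of_int i :: complex)"
        unfolding z_def ex_eq_1_iff by (elim Ints_cases)
      hence "of_int m = (of_int (int p * i) :: complex)"
        using assms by (simp add: field_simps)
      hence "m = int p * i" by (simp only: of_int_eq_iff)
      with False show False by simp
    qed
    moreover have "z ^ p = 1"
      unfolding z_def ex_mult_nat [symmetric] using assms by simp
    ultimately show ?thesis
      using False geometric_sum[of z p] by simp
  qed
  finally show ?thesis .
qed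

lemma hecke_inf_has_sum:
  assumes a: "eform a" and \<tau>: "Im \<tau> > 0"
  shows "((\<lambda>j. of_int (if 121 dvd j + 5 then 11 ^ 5 * a ((j + 5) div 121) else 0) *
            ex (of_int (24 * j - 1) * \<tau> / 24)) has_sum hecke_inf a \<tau>) UNIV"
proof -
  define g where "g = (\<lambda>j. of_int (if 121 dvd j + 5 then 11 ^ 5 * a ((j + 5) div 121) else 0) *
            ex (of_int (24 * j - 1) * \<tau> / 24))"
  have "((\<lambda>i. 11 ^ 5 * qterm a (121 * \<tau>) i) has_sum hecke_inf a \<tau>) UNIV"
    unfolding hecke_inf_def using eform_has_sum[OF a, of "121 * \<tau>"] \<tau> by (intro has_sum_cmult_right) simp
  moreover have "11 ^ 5 * qterm a (121 * \<tau>) i = g (121 * i - 5)" for i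
  proof -
    have "of_int (24 * i - 1) * (121 * \<tau>) / 24 = of_int (24 * (121 * i - 5) - 1) * \<tau> / 24"
      by (simp add: algebra_simps)
    moreover have "121 dvd (121 * i - 5) + 5" "((121 * i - 5) + 5) div 121 = i"
      by simp_all
    ultimately show ?thesis
      unfolding g_def qterm_def by (simp only: if_True of_int_mult of_int_power of_int_numeral mult.assoc)
  qed
  ultimately have "((g \<circ> (\<lambda>i. 121 * i - 5)) has_sum hecke_inf a \<tau>) UNIV"
    by (simp add: o_def)
  hence "(g has_sum hecke_inf a \<tau>) (range (\<lambda>i. 121 * i - 5))"
    by (simp add: has_sum_reindex[OF inj_shift])
  hence "(g has_sum hecke_inf a \<tau>) UNIV"
    by (rule has_sum_cong_neutral[THEN iffD1, rotated -1]) (auto simp: range_shift g_def)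
  thus ?thesis unfolding g_def .
qed

lemma hecke_zero_has_sum:
  assumes a: "eform a" and \<tau>: "Im \<tau> > 0"
  shows "((\<lambda>j. of_int (a (121 * j - 5)) * ex (of_int (24 * j - 1) * \<tau> / 24)) has_sum
            (\<Sum>x\<in>{0..<121}. hecke_zero a x \<tau>)) UNIV"
proof -
  define g where "g = (\<lambda>j. \<Sum>x\<in>{0..<121}. qterm a ((\<tau> + of_int (24 * x)) / 121) j / 121)"
  have "(g has_sum (\<Sum>x\<in>{0..<121}. hecke_zero a x \<tau>)) UNIV"
    unfolding g_def hecke_zero_def
    unfolding divide_inverse
    by (intro has_sum_sum_finite has_sum_cmult_left eform_has_sum[OF a]) (use \<tau> in auto)
  moreover have g: "g j = (if 121 dvd j + 5 then of_int (a j) * ex (of_int (24 * j - 1) * \<tau> / (24 * 121)) else 0)" for j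
  proof -
    have "qterm a ((\<tau> + of_int (24 * x)) / 121) j =
        of_int (a j) * ex (of_int (24 * j - 1) * \<tau> / (24 * 121)) * ex (of_int (24 * j - 1) * of_int x / 121)" for x
    proof -
      have "of_int (24 * j - 1) * ((\<tau> + of_int (24 * x)) / 121) / 24 =
             of_int (24 * j - 1) * \<tau> / (24 * 121) + of_int (24 * j - 1) * of_int x / 121"
        by (simp add: field_simps)
      thus ?thesis by (simp only: qterm_def ex_add mult.assoc)
    qed
    hence gj: "g j = of_int (a j) * ex (of_int (24 * j - 1) * \<tau> / (24 * 121)) *
        (\<Sum>x\<in>{0..<121}. ex (of_int (24 * j - 1) * of_int x / 121)) / 121"
      unfolding g_def by (simp only: sum_divide_distrib sum_distrib_left)
    \<comment> \<open>Since 24 * 5 = 121 - 1, the inverse of 24 modulo 121 is -5; so the roots of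
      unity select the indices of the form 121 i - 5.\<close>
    have "121 dvd 24 * j - 1 \<longleftrightarrow> 121 dvd j + 5"
    proof
      assume *: "121 dvd 24 * j - 1"
      have eq: "j + 5 = 121 * j - 5 * (24 * j - 1)" by simp
      show "121 dvd j + 5" by (subst eq) (intro dvd_diff dvd_triv_left dvd_mult *)
    next
      assume *: "121 dvd j + 5"
      have eq: "24 * j - 1 = 24 * (j + 5) - 121" by simp
      show "121 dvd 24 * j - 1" by (subst eq) (intro dvd_diff dvd_refl dvd_mult *)
    qed
    thus ?thesis unfolding gj using sum_roots_of_unity[of 121 "24 * j - 1"] by simp
  qed
  ultimately have "(g has_sum (\<Sum>x\<in>{0..<121}. hecke_zero a x \<tau>)) (range (\<lambda>i. 121 * i - 5))"
    by (elim has_sum_cong_neutral[THEN iffD1, rotated -1]) (auto simp: range_shift)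
  hence "((g \<circ> (\<lambda>i. 121 * i - 5)) has_sum (\<Sum>x\<in>{0..<121}. hecke_zero a x \<tau>)) UNIV"
    by (simp add: has_sum_reindex[OF inj_shift])
  moreover have "g (121 * i - 5) = of_int (a (121 * i - 5)) * ex (of_int (24 * i - 1) * \<tau> / 24)" for i
  proof -
    have "24 * (121 * i - 5) - 1 = 121 * (24 * i - 1)" by simp
    hence eq: "of_int (24 * (121 * i - 5) - 1) * \<tau> / (24 * 121) = of_int (24 * i - 1) * \<tau> / 24"
      by (simp only: of_int_mult) simp
    show ?thesis unfolding g eq by simp
  qed
  ultimately show ?thesis by (simp add: o_def)
qed

lemma hecke_mid_has_sum:
  assumes a: "eform a" and \<tau>: "Im \<tau> > 0"
  shows "((\<lambda>j. of_int (121 * hecke_mult j * a j) * ex (of_int (24 * j - 1) * \<tau> / 24)) has_sum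
            (\<Sum>b\<in>cusps. hecke_mid a b \<tau>)) UNIV"
proof -
  define g where "g = (\<lambda>j. \<Sum>b\<in>cusps. 11 * of_real (sqrt 11) * kappa b * qterm a (\<tau> + of_int b / 11) j)"
  have "(g has_sum (\<Sum>b\<in>cusps. hecke_mid a b \<tau>)) UNIV"
    unfolding g_def hecke_mid_def
    by (intro has_sum_sum_finite has_sum_cmult_right eform_has_sum[OF a]) (use \<tau> in \<open>auto simp: cusps_def\<close>)
  moreover have "g = (\<lambda>j. of_int (121 * hecke_mult j * a j) * ex (of_int (24 * j - 1) * \<tau> / 24))"
  proof
    fix j
    have "11 * of_real (sqrt 11) * kappa b * qterm a (\<tau> + of_int b / 11) j =
        11 * of_real (sqrt 11) * (kappa b * ex (of_int (24 * j - 1) * of_int b / 264)) *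
          (of_int (a j) * ex (of_int (24 * j - 1) * \<tau> / 24))" for b
    proof -
      have "of_int (24 * j - 1) * (\<tau> + of_int b / 11) / 24 =
            of_int (24 * j - 1) * of_int b / 264 + of_int (24 * j - 1) * \<tau> / 24"
        by (simp add: field_simps)
      hence "ex (of_int (24 * j - 1) * (\<tau> + of_int b / 11) / 24) =
            ex (of_int (24 * j - 1) * of_int b / 264) * ex (of_int (24 * j - 1) * \<tau> / 24)"
        by (simp only: ex_add)
      thus ?thesis by (simp only: qterm_def mult_ac)
    qed
    hence "g j = 11 * of_real (sqrt 11) * mid_coeff j * (of_int (a j) * ex (of_int (24 * j - 1) * \<tau> / 24))"
      unfolding g_def mid_coeff_def by (simp only: sum_distrib_left sum_distrib_right)
    thus "g j = of_int (121 * hecke_mult j * a j) * ex (of_int (24 * j - 1) * \<tau> / 24)"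
      unfolding hecke_mult by simp
  qed
  ultimately show ?thesis by (simp only:)
qed

lemma hecke_has_sum:
  assumes a: "eform a" and \<tau>: "Im \<tau> > 0"
  shows "(qterm (hecke_coeff a) \<tau> has_sum hecke a \<tau>) UNIV"
proof -
  have eq: "qterm (hecke_coeff a) \<tau> = (\<lambda>j.
      of_int (if 121 dvd j + 5 then 11 ^ 5 * a ((j + 5) div 121) else 0) * ex (of_int (24 * j - 1) * \<tau> / 24) +
      of_int (a (121 * j - 5)) * ex (of_int (24 * j - 1) * \<tau> / 24) +
      of_int (121 * hecke_mult j * a j) * ex (of_int (24 * j - 1) * \<tau> / 24))"
    unfolding qterm_def hecke_coeff_def of_int_add by (simp only: ring_distribs add_ac)
  show ?thesis
    unfolding eq hecke_def
    using has_sum_add[OF has_sum_add[OF hecke_inf_has_sum[OF a \<tau>] hecke_zero_has_sum[OF a \<tau>]] hecke_mid_has_sum[OF a \<tau>]] .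
qed

section \<open>Closure under the operator and determination by the polar part\<close>

lemma eformI:
  assumes "\<exists>N. \<forall>j < - int N. a j = 0"
  assumes "\<And>\<tau>. Im \<tau> > 0 \<Longrightarrow> (qterm a \<tau> has_sum F \<tau>) UNIV"
  assumes "\<And>\<tau>. Im \<tau> > 0 \<Longrightarrow> F (- (1 / \<tau>)) = \<tau> ^ 4 / sqi \<tau> * F \<tau>"
  shows "eform a"
proof -
  have "qsum a \<tau> = F \<tau>" if "Im \<tau> > 0" for \<tau>
    unfolding qsum_def using assms(2)[OF that] by (rule infsumI)
  moreover have "(\<lambda>j. norm (qterm a \<tau> j)) summable_on UNIV" if "Im \<tau> > 0" for \<tau>
    using assms(2)[OF that] summable_on_iff_abs_summable_on_complex summable_on_def by blast
  ultimately show ?thesis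
    unfolding eform_def using assms(1,3) Im_minus_inverse_pos by simp
qed

theorem eform_hecke:
  assumes a: "eform a"
  shows "eform (hecke_coeff a)"
proof (rule eformI[where F = "hecke a"])
  obtain N where N: "\<And>j. j < - int N \<Longrightarrow> a j = 0"
    using a by (auto simp: eform_def)
  have "hecke_coeff a j = 0" if "j < - int (121 * N + 5)" for j
  proof -
    have "j + 5 = 121 * ((j + 5) div 121) + (j + 5) mod 121" "(j + 5) mod 121 \<ge> 0"
      by simp_all
    hence "(j + 5) div 121 < - int N"
      using that by linarith
    moreover have "j < - int N" "121 * j - 5 < - int N"
      using that by auto
    ultimately show ?thesis
      by (simp add: hecke_coeff_def N)
  qed
  thus "\<exists>N. \<forall>j < - int N. hecke_coeff a j = 0" by blast
qed (use hecke_has_sum[OF a] hecke_S[OF a] in auto)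

lemma eform_diff_cmult:
  assumes "eform a" "eform b"
  shows "eform (\<lambda>j. a j - c * b j)"
proof (rule eformI[where F = "\<lambda>\<tau>. qsum a \<tau> + of_int (- c) * qsum b \<tau>"])
  obtain M N where "\<And>j. j < - int M \<Longrightarrow> a j = 0" "\<And>j. j < - int N \<Longrightarrow> b j = 0"
    using assms unfolding eform_def by metis
  thus "\<exists>N. \<forall>j < - int N. a j - c * b j = 0"
    by (intro exI[of _ "max M N"]) auto
next
  fix \<tau> :: complex assume \<tau>: "Im \<tau> > 0"
  have "qterm (\<lambda>j. a j - c * b j) \<tau> = (\<lambda>j. qterm a \<tau> j + of_int (- c) * qterm b \<tau> j)"
    by (rule ext) (simp add: qterm_def ring_distribs)
  thus "(qterm (\<lambda>j. a j - c * b j) \<tau> has_sum qsum a \<tau> + of_int (- c) * qsum b \<tau>) UNIV"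
    using assms \<tau> by (simp only:) (intro has_sum_add has_sum_cmult_right eform_has_sum)
  show "qsum a (- (1 / \<tau>)) + of_int (- c) * qsum b (- (1 / \<tau>)) =
         \<tau> ^ 4 / sqi \<tau> * (qsum a \<tau> + of_int (- c) * qsum b \<tau>)"
    unfolding qsum_S[OF assms(1) \<tau>] qsum_S[OF assms(2) \<tau>] by (simp add: ring_distribs)
qed

text \<open>Multiplication by \<open>qq_inf\<close> leads to a form of weight 4 with a pole of order
  at most N, to which \<open>wform_dvd\<close> applies; the indices j \<le> 0 become n \<le> N. As
  \<open>qq_inf\<close> is invertible over the integers, divisibility passes back from g to the
  coefficients.\<close>

theorem eform_dvd:
  assumes a: "eform a" and dvd: "\<And>j. j \<le> 0 \<Longrightarrow> M dvd a j"
  shows "M dvd a j"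
proof -
  obtain N where N: "\<And>j. j < - int N \<Longrightarrow> a j = 0"
    using a by (auto simp: eform_def)
  define A where "A = Abs_fps (\<lambda>n. a (int n - int N))"
  have sums: "(\<lambda>n. fps_nth (cfps A) n * ex \<tau> ^ n) sums (ex (of_int (24 * int N + 1) * \<tau> / 24) * qsum a \<tau>)"
    if \<tau>: "Im \<tau> > 0" for \<tau>
  proof -
    have inj: "inj (\<lambda>n. int n - int N)" by (auto simp: inj_def)
    have "(qterm a \<tau> has_sum qsum a \<tau>) (range (\<lambda>n. int n - int N))"
    proof (rule has_sum_cong_neutral[THEN iffD1, OF _ _ _ eform_has_sum[OF a \<tau>]])
      fix j :: int assume "j \<in> UNIV - range (\<lambda>n. int n - int N)"
      hence "j \<noteq> int (nat (j + int N)) - int N" by blast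
      hence "j < - int N" by linarith
      thus "qterm a \<tau> j = 0" by (simp add: qterm_def N)
    qed auto
    hence "((qterm a \<tau> \<circ> (\<lambda>n. int n - int N)) has_sum qsum a \<tau>) UNIV"
      by (simp add: has_sum_reindex[OF inj])
    hence "((\<lambda>n. ex (of_int (24 * int N + 1) * \<tau> / 24) * qterm a \<tau> (int n - int N)) has_sum
             (ex (of_int (24 * int N + 1) * \<tau> / 24) * qsum a \<tau>)) UNIV"
      unfolding o_def by (rule has_sum_cmult_right)
    moreover have "ex (of_int (24 * int N + 1) * \<tau> / 24) * qterm a \<tau> (int n - int N) =
                     fps_nth (cfps A) n * ex \<tau> ^ n" for n
    proof -
      have "of_int (24 * int N + 1) * \<tau> / 24 + of_int (24 * (int n - int N) - 1) * \<tau> / 24 = of_nat n * \<tau>"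
        by (simp add: field_simps)
      hence "ex (of_int (24 * int N + 1) * \<tau> / 24) * ex (of_int (24 * (int n - int N) - 1) * \<tau> / 24) = ex \<tau> ^ n"
        by (simp only: ex_add [symmetric] ex_mult_nat)
      thus ?thesis by (simp add: qterm_def A_def)
    qed
    ultimately show ?thesis
      by (intro has_sum_imp_sums) simp
  qed
  have rad: "fps_conv_radius (cfps A) \<ge> 1"
    by (rule fps_conv_radius_geI_ex) (use sums in \<open>auto simp: sums_iff\<close>)
  have eval_A: "eval_fps (cfps A) (ex \<tau>) = ex (of_int (24 * int N + 1) * \<tau> / 24) * qsum a \<tau>" if "Im \<tau> > 0" for \<tau>
    using sums[OF that] by (simp add: eval_fps_def sums_iff)
  define g where "g = A * qq_inf"
  have eval_g: "eval_fps (cfps g) (ex \<tau>) / ex \<tau> ^ N = qsum a \<tau> * eta \<tau>" if \<tau>: "Im \<tau> > 0" for \<tau>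
  proof -
    have "of_int (24 * int N + 1) * \<tau> / 24 = of_nat N * \<tau> + \<tau> / 24"
      by (simp add: field_simps)
    hence "eval_fps (cfps A) (ex \<tau>) = ex \<tau> ^ N * ex (\<tau> / 24) * qsum a \<tau>"
      using eval_A[OF \<tau>] by (simp only: ex_add ex_mult_nat)
    thus ?thesis
      unfolding g_def cfps_mult using norm_ex_less_radius[OF \<tau> rad] norm_ex_less_radius[OF \<tau> fps_conv_radius_qq_inf] \<tau>
      by (simp add: eval_fps_mult eval_qq_inf norm_ex_less_1_iff eta_def)
  qed
  have "wform N g"
    unfolding wform_def
  proof (intro conjI allI impI)
    show "fps_conv_radius (cfps g) \<ge> 1"
      unfolding g_def cfps_mult by (intro fps_conv_radius_multI rad fps_conv_radius_qq_inf)
    fix \<tau> :: complex assume \<tau>: "Im \<tau> > 0"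
    show "eval_fps (cfps g) (ex (- (1 / \<tau>))) / ex (- (1 / \<tau>)) ^ N =
            \<tau> ^ 4 * (eval_fps (cfps g) (ex \<tau>) / ex \<tau> ^ N)"
      unfolding eval_g[OF \<tau>] eval_g[OF Im_minus_inverse_pos[OF \<tau>]] qsum_S[OF a \<tau>] eta_S'[OF \<tau>]
      using sqi_nonzero[OF \<tau>] by simp
  qed
  moreover have "M dvd fps_nth g n" if "n \<le> N" for n
    unfolding g_def fps_mult_nth by (intro dvd_sum dvd_mult2) (use that in \<open>auto simp: A_def intro!: dvd\<close>)
  ultimately have g: "M dvd fps_nth g n" for n
    by (rule wform_dvd)
  have "A = g * inv_qq"
    unfolding g_def mult.assoc qq_inf_inv_qq by simp
  hence "M dvd fps_nth A n" for n
    by (auto simp: fps_mult_nth intro!: dvd_sum dvd_mult2 g)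
  from this[of "nat (j + int N)"] show ?thesis
    by (cases "j < - int N") (auto simp: A_def N)
qed

definition e4_seq :: "int \<Rightarrow> int" where
  "e4_seq j = (if j < 0 then 0 else e4 (nat j))"

lemma Abs_fps_e4: "Abs_fps e4 = E4 * inv_qq"
  by (rule fps_ext) (simp add: e4_def inv_qq_def)

lemma eform_e4_seq: "eform e4_seq"
proof (rule eformI[where F = "\<lambda>\<tau>. G4 \<tau> / eta \<tau>"])
  show "\<exists>N. \<forall>j < - int N. e4_seq j = 0"
    by (intro exI[of _ 0]) (simp add: e4_seq_def)
next
  fix \<tau> :: complex assume \<tau>: "Im \<tau> > 0"
  show "G4 (- (1 / \<tau>)) / eta (- (1 / \<tau>)) = \<tau> ^ 4 / sqi \<tau> * (G4 \<tau> / eta \<tau>)"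
    unfolding G4_S[OF \<tau>] eta_S'[OF \<tau>] by simp
  define F where "F = cfps (E4 * inv_qq)"
  have rad: "fps_conv_radius F \<ge> 1"
    unfolding F_def cfps_mult by (intro fps_conv_radius_multI fps_conv_radius_E4 fps_conv_radius_inv_qq)
  from eval_fps_has_sum[OF \<tau> rad]
  have "((\<lambda>n. ex (- \<tau> / 24) * (fps_nth F n * ex \<tau> ^ n)) has_sum (ex (- \<tau> / 24) * eval_fps F (ex \<tau>))) UNIV"
    by (rule has_sum_cmult_right)
  also have "ex (- \<tau> / 24) * eval_fps F (ex \<tau>) = G4 \<tau> / eta \<tau>"
    unfolding F_def cfps_mult
    using norm_ex_less_radius[OF \<tau> fps_conv_radius_E4] norm_ex_less_radius[OF \<tau> fps_conv_radius_inv_qq] \<tau>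
    by (simp add: eval_fps_mult eval_E4 eval_inv_qq norm_ex_less_1_iff eta_def ex_minus exp_minus field_simps)
  also have "(\<lambda>n. ex (- \<tau> / 24) * (fps_nth F n * ex \<tau> ^ n)) = qterm e4_seq \<tau> \<circ> int"
  proof
    fix n
    have "fps_nth F n = of_int (e4 n)"
      by (simp add: F_def flip: Abs_fps_e4)
    moreover have "of_int (24 * int n - 1) * \<tau> / 24 = - \<tau> / 24 + of_nat n * \<tau>"
      by (simp add: field_simps)
    ultimately show "ex (- \<tau> / 24) * (fps_nth F n * ex \<tau> ^ n) = (qterm e4_seq \<tau> \<circ> int) n"
      by (simp only: o_def qterm_def ex_add ex_mult_nat e4_seq_def) simp
  qed
  finally have "(qterm e4_seq \<tau> has_sum (G4 \<tau> / eta \<tau>)) (range int)"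
    by (simp add: has_sum_reindex o_def)
  thus "(qterm e4_seq \<tau> has_sum (G4 \<tau> / eta \<tau>)) UNIV"
  proof (rule has_sum_cong_neutral[THEN iffD1, rotated -1])
    fix j :: int assume "j \<in> UNIV - range int"
    hence "j < 0" by (metis Diff_iff nonneg_int_cases not_le rangeI)
    thus "qterm e4_seq \<tau> j = 0" by (simp add: qterm_def e4_seq_def)
  qed auto
qed

section \<open>The congruence modulo 11\<close>

text \<open>
  \<open>t64\<close> is the image of \<open>f64 = E\<^sub>4 \<Delta>\<^sup>5\<close> under the Hecke operator \<open>T\<^sub>1\<^sub>1\<close>. Since
  \<open>f64 = q\<^sup>5 (E\<^sub>4 / (q;q)\<^sub>\<infinity>) (q;q)\<^sub>\<infinity>\<^sup>1\<^sup>2\<^sup>1\<close> and the last factor is a series in \<open>q\<^sup>1\<^sup>1\<close> modulo 11, it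
  vanishes modulo 11 iff \<open>e4 (11 n + 6)\<close> does.
\<close>

definition f64 :: "complex \<Rightarrow> complex" where
  "f64 \<tau> = G4 \<tau> * (eta \<tau> ^ 24) ^ 5"

lemma f64_add_1: "Im \<tau> > 0 \<Longrightarrow> f64 (\<tau> + 1) = f64 \<tau>"
  by (simp add: f64_def eta_24 G4_def ex_add)

lemma f64_S: "Im \<tau> > 0 \<Longrightarrow> f64 (- (1 / \<tau>)) = \<tau> ^ 64 * f64 \<tau>"
proof -
  assume \<tau>: "Im \<tau> > 0"
  have "\<tau> ^ 64 = \<tau> ^ 4 * (\<tau> ^ 12) ^ 5"
    by (simp flip: power_mult power_add)
  thus ?thesis
    unfolding f64_def G4_S[OF \<tau>] eta_24_S[OF \<tau>] power_mult_distrib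
    by (simp only: mult_ac)
qed

definition t64 :: "complex \<Rightarrow> complex" where
  "t64 \<tau> = 11 ^ 63 * f64 (11 * \<tau>) + (\<Sum>x\<in>{0..<11}. f64 ((\<tau> + of_int x) / 11)) / 11"

lemma f64_11_S:
  assumes \<tau>: "Im \<tau> > 0" and xy: "[x * y = -1] (mod 11)"
  shows "f64 ((- (1 / \<tau>) + of_int x) / 11) = \<tau> ^ 64 * f64 ((\<tau> + of_int y) / 11)"
proof -
  from xy have "11 dvd 1 + x * y"
    by (simp add: cong_iff_dvd_diff add.commute)
  then obtain m where "1 + x * y = 11 * m" by blast
  from modular_form_isogeny[OF f64_add_1 f64_S this _ \<tau>] show ?thesis by simp
qed

text \<open>The inversion exchanges 11 \<tau> with \<tau> / 11 and permutes the other points by x ->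
  -1/x modulo 11, written as \<open>- (x ^ 9)\<close>. The factor 11^63 makes the two exchanged
  terms match.\<close>

lemma t64_S:
  assumes \<tau>: "Im \<tau> > 0"
  shows "t64 (- (1 / \<tau>)) = \<tau> ^ 64 * t64 \<tau>"
proof -
  have \<tau>0: "\<tau> \<noteq> 0" using \<tau> by auto
  define h where "h = (\<lambda>x \<tau>. f64 ((\<tau> + of_int x) / 11))"
  define j where "j = (\<lambda>x::int. (- (x ^ 9)) mod 11)"
  have j: "[x * j x = -1] (mod 11)" if "\<not> 11 dvd x" for x
  proof -
    have "[x * j x = x * (- (x ^ 9))] (mod 11)"
      unfolding j_def by (intro cong_mult cong_refl) (simp add: cong_def)
    also have "x * (- (x ^ 9)) = - (x ^ 10)"
      by (simp add: eval_nat_numeral)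
    also have "[- (x ^ 10) = -1] (mod 11)"
      using fermat_11[OF that] by (simp only: cong_minus_minus_iff)
    finally show ?thesis .
  qed
  have split: "{0..<11} = insert 0 {1..10::int}" by auto
  have "\<forall>x\<in>set [1..10]. j x \<in> set [1..10] \<and> j (j x) = x"
    unfolding j_def by code_simp
  hence jj: "j x \<in> {1..10}" "j (j x) = x" if "x \<in> {1..10}" for x
    using that by auto
  have "(\<Sum>x\<in>{1..10}. h x (- (1 / \<tau>))) = (\<Sum>x\<in>{1..10}. \<tau> ^ 64 * h x \<tau>)"
  proof (rule sum.reindex_bij_witness[of _ j j])
    fix x :: int assume x: "x \<in> {1..10}"
    hence "\<not> 11 dvd x" by (auto dest: zdvd_imp_le)
    from f64_11_S[OF \<tau> j[OF this]] show "\<tau> ^ 64 * h (j x) \<tau> = h x (- (1 / \<tau>))"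
      by (simp add: h_def)
  qed (use jj in auto)
  moreover have "f64 (11 * (- (1 / \<tau>))) = \<tau> ^ 64 * (h 0 \<tau> / 11 ^ 64)"
    using f64_S[of "\<tau> / 11"] \<tau> by (simp add: h_def power_divide)
  moreover have "h 0 (- (1 / \<tau>)) = \<tau> ^ 64 * (11 ^ 64 * f64 (11 * \<tau>))"
  proof -
    have "(- (1 / \<tau>) + of_int 0) / 11 = - (1 / (11 * \<tau>))" by simp
    hence "h 0 (- (1 / \<tau>)) = f64 (- (1 / (11 * \<tau>)))" by (simp only: h_def)
    also have "\<dots> = (11 * \<tau>) ^ 64 * f64 (11 * \<tau>)"
      by (rule f64_S) (use \<tau> in simp)
    finally show ?thesis by (simp only: power_mult_distrib mult_ac)
  qed
  moreover have t64: "t64 \<sigma> = 11 ^ 63 * f64 (11 * \<sigma>) + (h 0 \<sigma> + (\<Sum>x\<in>{1..10}. h x \<sigma>)) / 11" for \<sigma>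
    unfolding t64_def split h_def by simp
  ultimately have "t64 (- (1 / \<tau>)) = 11 ^ 63 * (\<tau> ^ 64 * (h 0 \<tau> / 11 ^ 64)) +
     (\<tau> ^ 64 * (11 ^ 64 * f64 (11 * \<tau>)) + \<tau> ^ 64 * (\<Sum>x\<in>{1..10}. h x \<tau>)) / 11"
    by (simp only: sum_distrib_left)
  also have "\<dots> = \<tau> ^ 64 * t64 \<tau>"
    unfolding t64 by (simp add: field_simps)
  finally show ?thesis .
qed

definition c64 :: "nat \<Rightarrow> int" where
  "c64 n = fps_nth (fps_X ^ 5 * (E4 * qq_inf ^ 120)) n"

definition d64 :: "nat \<Rightarrow> int" where
  "d64 n = c64 (11 * n) + (if 11 dvd n then 11 ^ 63 * c64 (n div 11) else 0)"

lemma f64_has_sum: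
  assumes "Im \<tau> > 0"
  shows "((\<lambda>n. of_int (c64 n) * ex (of_nat n * \<tau>)) has_sum f64 \<tau>) UNIV"
proof -
  define F where "F = cfps (fps_X ^ 5 * (E4 * qq_inf ^ 120))"
  have rad: "fps_conv_radius (cfps E4) \<ge> 1" "fps_conv_radius (cfps qq_inf ^ n) \<ge> 1"
     "fps_conv_radius (fps_X ^ n :: complex fps) \<ge> 1" "fps_conv_radius (cfps E4 * cfps qq_inf ^ n) \<ge> 1" for n
    by (intro fps_conv_radius_multI fps_conv_radius_powerI fps_conv_radius_E4 fps_conv_radius_qq_inf; simp)+
  have radF: "fps_conv_radius F \<ge> 1"
    unfolding F_def cfps_mult cfps_power cfps_X by (intro fps_conv_radius_multI rad)
  note lt = norm_ex_less_radius[OF assms]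
  have "((\<lambda>n. fps_nth F n * ex \<tau> ^ n) has_sum eval_fps F (ex \<tau>)) UNIV"
    by (rule eval_fps_has_sum[OF assms radF])
  also have "eval_fps F (ex \<tau>) = f64 \<tau>"
    unfolding F_def cfps_mult cfps_power cfps_X
    using lt[OF rad(1)] lt[OF rad(2)] lt[OF rad(3)] lt[OF rad(4)] lt[OF fps_conv_radius_qq_inf] assms
    by (simp add: eval_fps_mult eval_fps_power eval_E4 eval_qq_inf norm_ex_less_1_iff f64_def eta_24
          power_mult_distrib flip: power_mult)
  finally show ?thesis
    by (simp add: F_def c64_def ex_mult_nat)
qed

lemma t64_has_sum:
  assumes \<tau>: "Im \<tau> > 0"
  shows "((\<lambda>n. of_int (d64 n) * ex (of_nat n * \<tau>)) has_sum t64 \<tau>) UNIV"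
proof -
  have inj: "inj (\<lambda>n::nat. 11 * n)" by (auto simp: inj_def)
  have rng: "n \<in> range (\<lambda>n. 11 * n) \<longleftrightarrow> 11 dvd n" for n :: nat by auto
  define g where "g = (\<lambda>n. of_int (if 11 dvd n then 11 ^ 63 * c64 (n div 11) else 0) * ex (of_nat n * \<tau>))"
  have "((\<lambda>n. 11 ^ 63 * (of_int (c64 n) * ex (of_nat n * (11 * \<tau>)))) has_sum (11 ^ 63 * f64 (11 * \<tau>))) UNIV"
    by (intro has_sum_cmult_right f64_has_sum) (use \<tau> in simp)
  moreover have "(\<lambda>n. 11 ^ 63 * (of_int (c64 n) * ex (of_nat n * (11 * \<tau>)))) = g \<circ> (\<lambda>n. 11 * n)"
    by (rule ext) (simp add: g_def mult_ac)
  ultimately have "(g has_sum (11 ^ 63 * f64 (11 * \<tau>))) (range (\<lambda>n. 11 * n))"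
    by (simp only: has_sum_reindex[OF inj])
  hence 1: "(g has_sum (11 ^ 63 * f64 (11 * \<tau>))) UNIV"
    by (rule has_sum_cong_neutral[THEN iffD1, rotated -1]) (auto simp: rng g_def)
  define k where "k = (\<lambda>n. \<Sum>x\<in>{0..<11::int}. of_int (c64 n) * ex (of_nat n * ((\<tau> + of_int x) / 11)))"
  have "(k has_sum (\<Sum>x\<in>{0..<11}. f64 ((\<tau> + of_int x) / 11))) UNIV"
    unfolding k_def by (intro has_sum_sum_finite f64_has_sum) (use \<tau> in auto)
  moreover have k: "k n = (if 11 dvd n then 11 * (of_int (c64 n) * ex (of_nat n * \<tau> / 11)) else 0)" for n
  proof -
    have "ex (of_nat n * ((\<tau> + of_int x) / 11)) = ex (of_nat n * \<tau> / 11) * ex (of_nat n * of_int x / 11)" for x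
      unfolding ex_add [symmetric] by (rule arg_cong[of _ _ ex]) (simp add: field_simps)
    hence k: "k n = of_int (c64 n) * ex (of_nat n * \<tau> / 11) * (\<Sum>x\<in>{0..<11::int}. ex (of_nat n * of_int x / 11))"
      unfolding k_def by (simp only: sum_distrib_left mult.assoc)
    have "11 dvd int n \<longleftrightarrow> 11 dvd n" using int_dvd_int_iff[of 11 n] by simp
    thus ?thesis unfolding k using sum_roots_of_unity[of 11 "int n"] by simp
  qed
  ultimately have "(k has_sum (\<Sum>x\<in>{0..<11}. f64 ((\<tau> + of_int x) / 11))) (range (\<lambda>n. 11 * n))"
    by (elim has_sum_cong_neutral[THEN iffD1, rotated -1]) (auto simp: rng)
  hence "((k \<circ> (\<lambda>n. 11 * n)) has_sum (\<Sum>x\<in>{0..<11}. f64 ((\<tau> + of_int x) / 11))) UNIV"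
    by (simp only: has_sum_reindex[OF inj])
  hence 2: "((\<lambda>n. (k \<circ> (\<lambda>n. 11 * n)) n * inverse 11) has_sum (\<Sum>x\<in>{0..<11}. f64 ((\<tau> + of_int x) / 11)) * inverse 11) UNIV"
    by (rule has_sum_cmult_left)
  have "(\<lambda>n. of_int (d64 n) * ex (of_nat n * \<tau>)) = (\<lambda>n. g n + (k \<circ> (\<lambda>n. 11 * n)) n * inverse 11)"
    by (rule ext) (simp add: g_def k d64_def ring_distribs)
  thus ?thesis
    unfolding t64_def divide_inverse[of "\<Sum>x\<in>{0..<11}. f64 ((\<tau> + of_int x) / 11)"]
    using has_sum_add[OF 1 2] by (simp only:)
qed

text \<open>Division by the fifth power of \<Delta> lowers the weight from 64 to 4 and creates a
  pole of order at most 5, so the values of \<open>d64\<close> up to 5 control all others.\<close>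

lemma wform_d64: "wform 5 (Abs_fps d64 * inv_qq ^ 120)"
proof -
  define A where "A = Abs_fps d64"
  have sums: "(\<lambda>n. fps_nth (cfps A) n * ex \<tau> ^ n) sums t64 \<tau>" if "Im \<tau> > 0" for \<tau>
    using has_sum_imp_sums[OF t64_has_sum[OF that]] by (simp add: A_def ex_mult_nat)
  have rad: "fps_conv_radius (cfps A) \<ge> 1"
    by (rule fps_conv_radius_geI_ex) (use sums in \<open>auto simp: sums_iff\<close>)
  have rad': "fps_conv_radius (cfps inv_qq ^ 120) \<ge> 1"
    by (intro fps_conv_radius_powerI fps_conv_radius_inv_qq)
  have eval: "eval_fps (cfps (A * inv_qq ^ 120)) (ex \<tau>) / ex \<tau> ^ 5 = t64 \<tau> / (eta \<tau> ^ 24) ^ 5" if \<tau>: "Im \<tau> > 0" for \<tau>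
  proof -
    have "eval_fps (cfps inv_qq) (ex \<tau>) = 1 / exp (- eval_fps log_fps (ex \<tau>))"
      using \<tau> by (simp add: eval_inv_qq norm_ex_less_1_iff exp_minus inverse_eq_divide)
    moreover have "eval_fps (cfps A) (ex \<tau>) = t64 \<tau>"
      using sums[OF \<tau>] by (simp add: eval_fps_def sums_iff)
    ultimately have "eval_fps (cfps (A * inv_qq ^ 120)) (ex \<tau>) = t64 \<tau> * (1 / exp (- eval_fps log_fps (ex \<tau>))) ^ 120"
      using norm_ex_less_radius[OF \<tau> rad] norm_ex_less_radius[OF \<tau> rad'] norm_ex_less_radius[OF \<tau> fps_conv_radius_inv_qq]
      by (simp only: cfps_mult cfps_power eval_fps_mult eval_fps_power)
    thus ?thesis
      by (simp add: eta_24 power_mult_distrib power_divide flip: power_mult)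
  qed
  show ?thesis
    unfolding wform_def A_def [symmetric]
  proof (intro conjI allI impI)
    show "fps_conv_radius (cfps (A * inv_qq ^ 120)) \<ge> 1"
      unfolding cfps_mult cfps_power by (intro fps_conv_radius_multI rad rad')
    fix \<tau> :: complex assume \<tau>: "Im \<tau> > 0"
    have nz: "(\<tau> ^ 12) ^ 5 \<noteq> 0" using \<tau> by auto
    have pow: "\<tau> ^ 64 = \<tau> ^ 4 * (\<tau> ^ 12) ^ 5"
      by (simp flip: power_mult power_add)
    have "a * p * x / (p * y) = a * (x / y)" if "p \<noteq> 0" for a p x y :: complex
      using that by simp
    from this[OF nz] have "\<tau> ^ 64 * x / ((\<tau> ^ 12) ^ 5 * y) = \<tau> ^ 4 * (x / y)" for x y
      unfolding pow .
    hence "t64 (- (1 / \<tau>)) / (eta (- (1 / \<tau>)) ^ 24) ^ 5 = \<tau> ^ 4 * (t64 \<tau> / (eta \<tau> ^ 24) ^ 5)"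
      unfolding t64_S[OF \<tau>] eta_24_S[OF \<tau>] power_mult_distrib .
    thus "eval_fps (cfps (A * inv_qq ^ 120)) (ex (- (1 / \<tau>))) / ex (- (1 / \<tau>)) ^ 5 =
            \<tau> ^ 4 * (eval_fps (cfps (A * inv_qq ^ 120)) (ex \<tau>) / ex \<tau> ^ 5)"
      unfolding eval[OF \<tau>] eval[OF Im_minus_inverse_pos[OF \<tau>]] .
  qed
qed

text \<open>The derivative of an 11th power is divisible by 11, so n times the n-th coefficient is,
  and n itself is prime to 11.\<close>

lemma fps_power_11_nth_dvd:
  fixes f :: "int fps"
  assumes "\<not> 11 dvd n"
  shows "11 dvd fps_nth (f ^ 11) n"
proof -
  have "fps_deriv (f ^ 11) = 11 * (fps_deriv f * f ^ 10)"
    by (simp add: fps_deriv_power' numeral_fps_const fps_of_nat [symmetric] mult_ac)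
  hence "fps_nth (fps_X * fps_deriv (f ^ 11)) n = fps_nth (fps_X * (11 * (fps_deriv f * f ^ 10))) n"
    by simp
  also have "fps_nth (fps_X * fps_deriv (f ^ 11)) n = int n * fps_nth (f ^ 11) n"
    by (simp add: fps_mult_fps_X_deriv_shift)
  also have "fps_X * (11 * (fps_deriv f * f ^ 10)) = 11 * (fps_X * (fps_deriv f * f ^ 10))"
    by (rule mult.left_commute)
  also have "fps_nth (11 * (fps_X * (fps_deriv f * f ^ 10))) n = 11 * fps_nth (fps_X * (fps_deriv f * f ^ 10)) n"
    by (rule fps_mult_numeral_left)
  finally have "11 dvd int n * fps_nth (f ^ 11) n" by simp
  hence "11 dvd int n \<or> 11 dvd fps_nth (f ^ 11) n"
    using prime_11 by (simp add: prime_dvd_mult_iff)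
  moreover have "\<not> 11 dvd int n"
    using assms int_dvd_int_iff[of 11 n] by (simp add: dvd_eq_mod_eq_0)
  ultimately show ?thesis by simp
qed

lemma fps_mult_power_11_nth_dvd:
  fixes g f :: "int fps"
  assumes "\<And>m. m \<le> n \<Longrightarrow> m mod 11 = 6 \<Longrightarrow> 11 dvd fps_nth g m" and n: "n mod 11 = 6"
  shows "11 dvd fps_nth (g * f ^ 11) n"
  unfolding fps_mult_nth
proof (rule dvd_sum)
  fix m assume m: "m \<in> {0..n}"
  show "11 dvd fps_nth g m * fps_nth (f ^ 11) (n - m)"
  proof (cases "11 dvd n - m")
    case True
    have "n = m + (n - m)" using m by simp
    with True n have "m mod 11 = 6"
      by (metis dvd_eq_mod_eq_0 mod_add_right_eq Nat.add_0_right)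
    thus ?thesis using assms(1)[of m] m by (intro dvd_mult2) auto
  next
    case False
    thus ?thesis by (intro dvd_mult fps_power_11_nth_dvd)
  qed
qed

section \<open>Numerical values up to index 50\<close>

text \<open>The tables end at 50 = 11 * 5 - 5, the largest index that enters \<open>d64 5\<close>.
  Each is verified from divisor sums or from a recursion.\<close>

definition sigma1_list :: "int list" where
  "sigma1_list =
    [0, 1, 3, 4, 7, 6, 12, 8, 15, 13, 18, 12, 28, 14, 24, 24, 31, 18, 39, 20, 42, 32, 36, 24, 60,
     31, 42, 40, 56, 30, 72, 32, 63, 48, 54, 48, 91, 38, 60, 56, 90, 42, 96, 44, 84, 78, 72, 48,
     124, 57, 93]"

definition sigma3_list :: "int list" where
  "sigma3_list =
    [0, 1, 9, 28, 73, 126, 252, 344, 585, 757, 1134, 1332, 2044, 2198, 3096, 3528, 4681, 4914,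
     6813, 6860, 9198, 9632, 11988, 12168, 16380, 15751, 19782, 20440, 25112, 24390, 31752, 29792,
     37449, 37296, 44226, 43344, 55261, 50654, 61740, 61544, 73710, 68922, 86688, 79508, 97236,
     95382, 109512, 103824, 131068, 117993, 141759]"

definition qq_list :: "int list" where
  "qq_list =
    [1, -1, -1, 0, 0, 1, 0, 1, 0, 0, 0, 0, -1, 0, 0, -1, 0, 0, 0, 0, 0, 0, 1, 0, 0, 0, 1, 0, 0, 0,
     0, 0, 0, 0, 0, -1, 0, 0, 0, 0, -1, 0, 0, 0, 0, 0, 0, 0, 0, 0, 0]"

definition e4_list :: "int list" where
  "e4_list =
    [1, 241, 2402, 9363, 29285, 68887, 158411, 307455, 596662, 1054110, 1844682, 3030776, 4989677,
     7793141, 12166695, 18374576, 27609351, 40400217, 58988545, 84215530, 119909427, 167873112,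
     234037002, 321859735, 441253575, 597624038, 806704836, 1078583170, 1436823718, 1898220005,
     2499917604, 3268031162, 4259035869, 5516012943, 7121526070, 9144122163, 11707775257,
     14915358997, 18949882655, 23971122945, 30241922298, 38002778583, 47637316694, 59498706861,
     74138191975, 92079754414, 114101911158, 140970302354, 173793620553, 213666395525, 262151723746]"

lemma divisor_sum_conv_list:
  assumes "n > 0"
  shows "int (\<Sum>d | d dvd n. d ^ k) = (\<Sum>d\<leftarrow>[1..int n]. if d dvd int n then d ^ k else 0)"
proof -
  have "{d. d dvd n} = {d \<in> {1..n}. d dvd n}"
    using assms by (auto dest: dvd_imp_le intro!: Suc_leI Nat.gr0I)
  hence "int (\<Sum>d | d dvd n. d ^ k) = (\<Sum>d\<in>{1..n}. if d dvd n then int d ^ k else 0)"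
    by (simp only: of_nat_sum sum.inter_filter finite_atLeastAtMost) (intro sum.cong refl, simp)
  also have "\<dots> = (\<Sum>d\<in>{1..int n}. if d dvd int n then d ^ k else 0)"
    by (rule sum.reindex_bij_witness[of _ nat int]) (auto simp: int_dvd_int_iff)
  also have "\<dots> = (\<Sum>d\<leftarrow>[1..int n]. if d dvd int n then d ^ k else 0)"
    by (simp add: interv_sum_list_conv_sum_set_int)
  finally show ?thesis .
qed

lemma sigma_check:
  "\<forall>n\<in>set [1..<51]. (\<Sum>d\<leftarrow>[1..int n]. if d dvd int n then d ^ 1 else 0) = sigma1_list ! n \<and>
     (\<Sum>d\<leftarrow>[1..int n]. if d dvd int n then d ^ 3 else 0) = sigma3_list ! n"
  by code_simp

text \<open>The recursion is \<open>qq_inf_deriv\<close> at q^n, where the term i = n drops out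
  because the \<sigma>-series has no constant term. \<open>e4_check\<close> is
  \<open>e4_gen_fun\<close> solved for the last coefficient in the same manner.\<close>

lemma qq_check:
  "\<forall>n\<in>set [1..<51]. int n * qq_list ! n = - (\<Sum>i\<leftarrow>[0..<n]. qq_list ! i * sigma1_list ! (n - i))"
  by code_simp

lemma e4_check:
  "\<forall>n\<in>set [0..<51]. e4_list ! n = (if n = 0 then 1 else 240 * sigma3_list ! n) -
     (\<Sum>i\<leftarrow>[0..<n]. e4_list ! i * qq_list ! (n - i))"
  by code_simp

lemma sigma1_fps_values: "0 < n \<Longrightarrow> n \<le> 50 \<Longrightarrow> fps_nth sigma1_fps n = sigma1_list ! n"
  using sigma_check divisor_sum_conv_list[of n 1] by (simp add: sigma1_fps_def del: of_nat_sum)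

lemma E4_values: "n \<le> 50 \<Longrightarrow> fps_nth E4 n = (if n = 0 then 1 else 240 * sigma3_list ! n)"
  using sigma_check divisor_sum_conv_list[of n 3]
  by (auto simp: E4_def sigma3_def fps_mult_numeral_left simp del: of_nat_sum)

lemma qq_inf_values: "n \<le> 50 \<Longrightarrow> fps_nth qq_inf n = qq_list ! n"
proof (induction n rule: less_induct)
  case (less n)
  show ?case
  proof (cases "n = 0")
    case False
    have "int n * fps_nth qq_inf n = fps_nth (fps_X * fps_deriv qq_inf) n"
      by (simp add: fps_mult_fps_X_deriv_shift)
    also have "\<dots> = - (\<Sum>i=0..n. fps_nth qq_inf i * fps_nth sigma1_fps (n - i))"
      by (simp add: qq_inf_deriv fps_mult_nth)
    also have "(\<Sum>i=0..n. fps_nth qq_inf i * fps_nth sigma1_fps (n - i)) =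
                 (\<Sum>i=0..<n. fps_nth qq_inf i * fps_nth sigma1_fps (n - i))"
      by (simp add: sum.last_plus sigma1_fps_def)
    also have "\<dots> = (\<Sum>i=0..<n. qq_list ! i * sigma1_list ! (n - i))"
      using less by (intro sum.cong refl) (simp add: sigma1_fps_values)
    also have "\<dots> = (\<Sum>i\<leftarrow>[0..<n]. qq_list ! i * sigma1_list ! (n - i))"
      by (simp add: interv_sum_list_conv_sum_set_nat)
    also have "- \<dots> = int n * qq_list ! n"
      using qq_check[rule_format, of n] False less.prems by simp
    finally show ?thesis using False by simp
  qed (simp add: qq_inf_nth_0 qq_list_def)
qed

lemma e4_values: "n \<le> 50 \<Longrightarrow> e4 n = e4_list ! n"
proof (induction n rule: less_induct)
  case (less n)
  have "(\<Sum>i=0..n. e4 i * fps_nth qq_inf (n - i)) = fps_nth E4 n"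
    by (simp add: e4_gen_fun[symmetric] fps_mult_nth)
  moreover have "(\<Sum>i=0..n. e4 i * fps_nth qq_inf (n - i)) = (\<Sum>i=0..<n. e4 i * fps_nth qq_inf (n - i)) + e4 n"
    by (simp add: sum.last_plus qq_inf_nth_0)
  ultimately have "e4 n = fps_nth E4 n - (\<Sum>i=0..<n. e4 i * fps_nth qq_inf (n - i))"
    by simp
  also have "(\<Sum>i=0..<n. e4 i * fps_nth qq_inf (n - i)) = (\<Sum>i=0..<n. e4_list ! i * qq_list ! (n - i))"
    using less by (intro sum.cong refl) (simp add: qq_inf_values)
  also have "\<dots> = (\<Sum>i\<leftarrow>[0..<n]. e4_list ! i * qq_list ! (n - i))"
    by (simp add: interv_sum_list_conv_sum_set_nat)
  also have "fps_nth E4 n - \<dots> = e4_list ! n"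
    using e4_check[rule_format, of n] less.prems E4_values[of n] by simp
  finally show ?case .
qed

lemma e4_mod_11_small:
  assumes "n \<le> 50" "n mod 11 = 6"
  shows "11 dvd e4 n"
proof -
  have "\<forall>n\<in>set [0..<51]. n mod 11 = 6 \<longrightarrow> 11 dvd e4_list ! n"
    by code_simp
  thus ?thesis using assms by (simp add: e4_values)
qed

theorem e4_mod_11:
  assumes "n mod 11 = 6"
  shows "11 dvd e4 n"
proof -
  define B where "B = E4 * qq_inf ^ 120"
  \<comment> \<open>Since 120 + 1 = 11 * 11, B differs from the series of \<open>e4\<close> by an
    11th power, which modulo 11 is a series in q^11. Hence exponents congruent to 6 are only
    combined with one another.\<close>
  have B: "B = Abs_fps e4 * (qq_inf ^ 11) ^ 11"
  proof -
    have "(qq_inf ^ 11) ^ 11 = qq_inf ^ Suc 120"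
      unfolding power_mult [symmetric] by simp
    also have "\<dots> = qq_inf * qq_inf ^ 120"
      by (rule power_Suc)
    finally show ?thesis
      by (simp only: B_def e4_gen_fun [symmetric] mult.assoc)
  qed
  have c64: "c64 m = (if m < 5 then 0 else fps_nth B (m - 5))" for m
    unfolding c64_def B_def [symmetric] by (simp add: fps_X_power_mult_nth)
  define D where "D = Abs_fps d64 * inv_qq ^ 120"
  \<comment> \<open>Only the indices 6, 17, 28, 39 and 50 of \<open>e4\<close> are involved
    here.\<close>
  have d64_small: "11 dvd d64 m" if "m \<le> 5" for m
  proof (cases "m = 0")
    case False
    have "11 dvd fps_nth B (11 * m - 5)"
      unfolding B
    proof (rule fps_mult_power_11_nth_dvd)
      show "11 dvd fps_nth (Abs_fps e4) i" if "i \<le> 11 * m - 5" "i mod 11 = 6" for i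
        using e4_mod_11_small[of i] that \<open>m \<le> 5\<close> by simp
      have "11 * m - 5 = 6 + 11 * (m - 1)" using False by simp
      thus "(11 * m - 5) mod 11 = 6"
        by (simp only: mod_mult_self2) simp
    qed
    thus ?thesis using False by (auto simp: d64_def c64)
  qed (simp add: d64_def c64)
  have D: "11 dvd fps_nth D m" for m
    unfolding D_def
  proof (rule wform_dvd[OF wform_d64])
    fix m :: nat assume "m \<le> 5"
    thus "11 dvd fps_nth (Abs_fps d64 * inv_qq ^ 120) m"
      unfolding fps_mult_nth by (intro dvd_sum dvd_mult2) (simp add: d64_small)
  qed
  have d64_eq: "Abs_fps d64 = D * qq_inf ^ 120"
  proof -
    have "inv_qq ^ 120 * qq_inf ^ 120 = 1"
      by (simp only: power_mult_distrib [symmetric] mult.commute[of inv_qq] qq_inf_inv_qq power_one)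
    thus ?thesis by (simp only: D_def mult.assoc mult_1_right)
  qed
  have d64: "11 dvd d64 m" for m
  proof -
    have "d64 m = fps_nth (Abs_fps d64) m" by simp
    also have "11 dvd \<dots>"
      unfolding d64_eq fps_mult_nth by (intro dvd_sum dvd_mult2 D)
    finally show ?thesis .
  qed
  have B_dvd: "11 dvd fps_nth B m" if m: "m mod 11 = 6" for m
  proof -
    define l where "l = m div 11 + 1"
    have l: "11 * l = m + 5" using m div_mult_mod_eq[of m 11] by (simp add: l_def)
    have "11 dvd d64 l - (if 11 dvd l then 11 ^ 63 * c64 (l div 11) else 0)"
      by (intro dvd_diff d64) auto
    thus ?thesis using l by (simp add: d64_def c64)
  qed
  have "Abs_fps e4 = B * (inv_qq ^ 11) ^ 11"
    by (simp add: B mult.assoc qq_inf_inv_qq flip: power_mult_distrib)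
  hence "e4 n = fps_nth (B * (inv_qq ^ 11) ^ 11) n"
    by (metis fps_nth_Abs_fps)
  thus ?thesis
    using fps_mult_power_11_nth_dvd[of n B "inv_qq ^ 11"] B_dvd assms by simp
qed

section \<open>Powers of 11\<close>

definition iter_seq :: "nat \<Rightarrow> int \<Rightarrow> int" where
  "iter_seq s = (hecke_coeff ^^ s) e4_seq"

lemma iter_seq_0: "iter_seq 0 = e4_seq"
  by (simp add: iter_seq_def)

lemma iter_seq_Suc:
  "iter_seq (Suc s) j = iter_seq s (121 * j - 5) + 121 * hecke_mult j * iter_seq s j +
     (if 121 dvd j + 5 then 11 ^ 5 * iter_seq s ((j + 5) div 121) else 0)"
  by (simp add: iter_seq_def hecke_coeff_def)

lemma eform_iter_seq: "eform (iter_seq s)"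
  by (induction s) (simp_all add: iter_seq_def eform_e4_seq eform_hecke)

text \<open>
  A form is determined by its polar part, so divisibility only has to be traced through the
  polar coefficients.
\<close>

lemma iter_seq_polar:
  assumes "if i = 0 then j \<le> 0 else 24 * j - 1 < - (121 ^ (i - 1))"
  shows "11 ^ (2 * s + 3 * i) dvd iter_seq s j"
  using assms
proof (induction s arbitrary: i j)
  case 0
  show ?case
  proof (cases "i = 0")
    case False
    hence "24 * j - 1 < - (121 ^ (i - 1))" using 0 by simp
    moreover have "(121 :: int) ^ (i - 1) > 0" by simp
    ultimately have "j < 0" by linarith
    thus ?thesis by (simp add: iter_seq_0 e4_seq_def)
  qed simp
next
  case (Suc s)
  \<comment> \<open>The depth i of the pole grows by one, which gains 11^3 where 11^2 is
    wanted.\<close>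
  have 1: "11 ^ (2 * Suc s + 3 * i) dvd iter_seq s (121 * j - 5)"
  proof -
    have "24 * (121 * j - 5) - 1 < - (121 ^ (Suc i - 1))"
    proof (cases "i = 0")
      case False
      then obtain i' where i': "i = Suc i'" by (cases i) auto
      show ?thesis using Suc.prems by (simp add: i')
    qed (use Suc.prems in simp)
    hence "11 ^ (2 * s + 3 * Suc i) dvd iter_seq s (121 * j - 5)"
      by (intro Suc.IH) simp
    moreover have "(11 :: int) ^ (2 * Suc s + 3 * i) dvd 11 ^ (2 * s + 3 * Suc i)"
      by (rule le_imp_power_dvd) simp
    ultimately show ?thesis by (rule dvd_trans[rotated])
  qed
  have 2: "11 ^ (2 * Suc s + 3 * i) dvd 121 * hecke_mult j * iter_seq s j"
  proof -
    have "(11 :: int) ^ (2 * Suc s + 3 * i) = 121 * 11 ^ (2 * s + 3 * i)"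
      by simp
    also have "\<dots> dvd 121 * (hecke_mult j * iter_seq s j)"
      by (intro mult_dvd_mono dvd_refl dvd_mult Suc.IH Suc.prems)
    finally show ?thesis by (simp only: mult.assoc)
  qed
  \<comment> \<open>Division by 121 lowers the depth by one and loses 11^3, so the factor 11^5
    leaves the required 11^2. At i = 0 the truncated subtraction keeps the depth and nothing is
    lost.\<close>
  have 3: "11 ^ (2 * Suc s + 3 * i) dvd 11 ^ 5 * iter_seq s ((j + 5) div 121)" if dvd: "121 dvd j + 5"
  proof -
    obtain l where l: "j + 5 = 121 * l" using dvd by blast
    have "11 ^ (2 * s + 3 * (i - 1)) dvd iter_seq s l"
    proof (rule Suc.IH)
      show "if i - 1 = 0 then l \<le> 0 else 24 * l - 1 < - (121 ^ (i - 1 - 1))"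
      proof (cases "i \<le> 1")
        case True
        hence "j \<le> 0" using Suc.prems by (cases "i = 0") auto
        hence "l \<le> 0" using l by linarith
        thus ?thesis using True by simp
      next
        case False
        then obtain i' where i': "i = Suc (Suc i')"
          by (metis One_nat_def Suc_le_mono le0 not0_implies_Suc)
        have "24 * j - 1 = 121 * (24 * l - 1)" using l by simp
        hence "121 * (24 * l - 1) < 121 * (- (121 ^ i'))"
          using Suc.prems by (simp add: i')
        thus ?thesis by (simp add: i')
      qed
    qed
    hence "11 ^ 5 * 11 ^ (2 * s + 3 * (i - 1)) dvd 11 ^ 5 * iter_seq s l"
      by (intro mult_dvd_mono dvd_refl)
    moreover have "(11 :: int) ^ (2 * Suc s + 3 * i) dvd 11 ^ 5 * 11 ^ (2 * s + 3 * (i - 1))"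
      unfolding power_add [symmetric] by (rule le_imp_power_dvd) simp
    ultimately show ?thesis using l by (simp add: dvd_trans)
  qed
  show ?case
    unfolding iter_seq_Suc using 1 2 3 by (auto intro!: dvd_add)
qed

lemma iter_seq_dvd: "11 ^ (2 * s) dvd iter_seq s j"
  by (rule eform_dvd[OF eform_iter_seq]) (use iter_seq_polar[of 0 _ s] in simp)

text \<open>Subtracting c times \<open>e4_seq\<close>, with c the coefficient at 0, cancels the
  coefficient at 0 and leaves those at j < 0, all divisible by \<open>11 ^ (2 * s + 3)\<close>. The
  multiple c \<open>e4_seq\<close> gets \<open>11 ^ (2 * s)\<close> from c and one more factor from
  \<open>e4_mod_11\<close>.\<close>

lemma iter_seq_dvd_mod_6:
  assumes "j mod 11 = 6"
  shows "11 ^ (2 * s + 1) dvd iter_seq s j"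
proof -
  define c where "c = iter_seq s 0"
  have e4_0: "e4_seq 0 = 1"
    by (simp add: e4_seq_def e4_def fps_mult_nth E4_nth_0)
  have "11 ^ (2 * s + 1) dvd iter_seq s j - c * e4_seq j" for j
  proof (rule eform_dvd[OF eform_diff_cmult[OF eform_iter_seq eform_e4_seq]])
    fix j :: int assume "j \<le> 0"
    then consider "j = 0" | "j < 0" by linarith
    thus "11 ^ (2 * s + 1) dvd iter_seq s j - c * e4_seq j"
    proof cases
      case 2
      hence "11 ^ (2 * s + 3 * 1) dvd iter_seq s j"
        by (intro iter_seq_polar) simp
      hence "11 ^ (2 * s + 1) dvd iter_seq s j"
        by (rule dvd_trans[OF le_imp_power_dvd, rotated]) simp
      thus ?thesis using 2 by (simp add: e4_seq_def)
    qed (simp add: c_def e4_0)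
  qed
  moreover have "11 dvd e4_seq j"
  proof (cases "j < 0")
    case False
    hence "nat j mod 11 = 6" using assms by (simp add: nat_mod_distrib [symmetric] flip: nat_numeral)
    thus ?thesis using e4_mod_11 False by (simp add: e4_seq_def)
  qed (simp add: e4_seq_def)
  hence "11 ^ (2 * s) * 11 dvd c * e4_seq j"
    unfolding c_def by (intro mult_dvd_mono iter_seq_dvd)
  hence "11 ^ (2 * s + 1) dvd c * e4_seq j" by (simp add: mult.commute)
  ultimately have "11 ^ (2 * s + 1) dvd (iter_seq s j - c * e4_seq j) + c * e4_seq j"
    by (intro dvd_add)
  thus ?thesis by simp
qed

text \<open>The formula for the next iterate is solved for its first term, the value at 121 x - 5.
  This trades one step t along the orbit for one unit of s, so the induction runs over t for all s
  at once.\<close>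

lemma iter_seq_descent:
  assumes r: "r \<le> 1" and j: "\<And>s. 11 ^ (2 * s + r) dvd iter_seq s j"
  shows "11 ^ (2 * (s + t) + r) dvd iter_seq s (((\<lambda>j. 121 * j - 5) ^^ t) j)"
proof (induction t arbitrary: s rule: less_induct)
  case (less t)
  show ?case
  proof (cases t)
    case 0
    thus ?thesis using j by simp
  next
    case (Suc t')
    define x where "x = ((\<lambda>j. 121 * j - 5) ^^ t') j"
    define E where "E = (11 :: int) ^ (2 * (s + t) + r)"
    have 1: "E dvd iter_seq (Suc s) x"
      using less[of t' "Suc s"] by (simp add: E_def x_def Suc)
    have 2: "E dvd 121 * hecke_mult x * iter_seq s x"
    proof -
      have "E = 121 * 11 ^ (2 * (s + t') + r)" by (simp add: E_def Suc)
      also have "\<dots> dvd 121 * (hecke_mult x * iter_seq s x)"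
        unfolding x_def by (intro mult_dvd_mono dvd_refl dvd_mult less) (simp add: Suc)
      finally show ?thesis by (simp only: mult.assoc)
    qed
    \<comment> \<open>For t' = 0 the index (j + 5) / 121 lies before the start of the orbit, where
      only the factor \<open>11 ^ (2 * s)\<close> is known; 11^5 makes up for this because r \<le>
      1. Otherwise the index is two steps back on the orbit, a loss of 11^4.\<close>
    have 3: "E dvd 11 ^ 5 * iter_seq s ((x + 5) div 121)"
    proof (cases t')
      case 0
      have "E dvd 11 ^ 5 * 11 ^ (2 * s)"
        unfolding E_def power_add [symmetric] using r by (intro le_imp_power_dvd) (simp add: Suc 0)
      also have "\<dots> dvd 11 ^ 5 * iter_seq s ((x + 5) div 121)"
        by (intro mult_dvd_mono dvd_refl iter_seq_dvd)
      finally show ?thesis .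
    next
      case (Suc t'')
      have "E dvd 11 ^ 5 * 11 ^ (2 * (s + t'') + r)"
        unfolding E_def power_add [symmetric] by (intro le_imp_power_dvd) (simp add: \<open>t = Suc t'\<close> Suc)
      also have "\<dots> dvd 11 ^ 5 * iter_seq s (((\<lambda>j. 121 * j - 5) ^^ t'') j)"
        by (intro mult_dvd_mono dvd_refl less) (simp add: \<open>t = Suc t'\<close> Suc)
      finally show ?thesis by (simp add: x_def Suc)
    qed
    have "iter_seq s (121 * x - 5) = iter_seq (Suc s) x - 121 * hecke_mult x * iter_seq s x -
            (if 121 dvd x + 5 then 11 ^ 5 * iter_seq s ((x + 5) div 121) else 0)"
      by (simp add: iter_seq_Suc)
    also have "E dvd \<dots>"
      using 1 2 3 by (auto intro!: dvd_diff)
    finally show ?thesis by (simp add: E_def x_def Suc)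
  qed
qed

lemma e4_dvd:
  assumes x: "24 * int x - 1 = 121 ^ s * (24 * j - 1)"
    and r: "r = 0 \<or> r = 1 \<and> j mod 11 = 6"
  shows "11 ^ (2 * s + r) dvd e4 x"
proof -
  have "24 * ((\<lambda>j. 121 * j - 5) ^^ s) j - 1 = 121 ^ s * (24 * j - 1)"
    by (induction s) (simp_all add: algebra_simps)
  hence "((\<lambda>j. 121 * j - 5) ^^ s) j = int x"
    unfolding x [symmetric] by simp
  moreover have "11 ^ (2 * (0 + s) + r) dvd iter_seq 0 (((\<lambda>j. 121 * j - 5) ^^ s) j)"
    by (rule iter_seq_descent) (use r iter_seq_dvd iter_seq_dvd_mod_6 in auto)
  ultimately show ?thesis
    by (simp add: iter_seq_0 e4_seq_def)
qed

theorem theorem7p7: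
  fixes k n :: nat
  assumes "k \<ge> 1"
  shows "[e4 (11 ^ k * n + delta 11 k) = 0] (mod 11 ^ k)"
proof -
  define x where "x = 11 ^ k * n + delta 11 k"
  have "[24 * delta 11 k = 1] (mod 11 ^ k)"
    using theI'[OF delta_unique_existence[of 11 k]] assms by (simp add: delta_def)
  hence "[24 * (11 ^ k * n) + 24 * delta 11 k = 0 + 1] (mod 11 ^ k)"
    by (intro cong_add) (simp add: cong_0_iff)
  hence "[24 * x = 1] (mod 11 ^ k)"
    by (simp add: x_def algebra_simps)
  hence "[24 * int x = 1] (mod 11 ^ k)"
    using cong_int_iff[of "24 * x" 1 "11 ^ k"] by simp
  then obtain w where w: "24 * int x - 1 = 11 ^ k * w"
    by (auto simp: cong_iff_dvd_diff)
  define s r where "s = k div 2" and "r = k mod 2"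
  have k: "k = 2 * s + r" by (simp add: s_def r_def)
  have r: "r = 0 \<or> r = 1" by (auto simp: r_def)
  have pow: "(11 :: int) ^ k = 121 ^ s * 11 ^ r"
    by (simp add: k power_add power_mult)
  \<comment> \<open>Since 121 is 1 modulo 24, the cofactor \<open>11 ^ r * w\<close> is -1 modulo 24
    and so has the form 24 j - 1: x is reached from j after s steps of the orbit.\<close>
  have "[121 ^ s * (11 ^ r * w) = 1 ^ s * (11 ^ r * w)] (mod 24)"
    by (intro cong_mult cong_pow cong_refl) (simp add: cong_def)
  hence "[24 * int x - 1 = 11 ^ r * w] (mod 24)"
    by (simp add: w pow mult.assoc)
  hence "24 dvd 24 * int x - 1 - 11 ^ r * w"
    by (simp add: cong_iff_dvd_diff)
  hence "24 dvd 24 * int x - (24 * int x - 1 - 11 ^ r * w)"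
    by (rule dvd_diff[OF dvd_triv_left])
  hence "24 dvd 11 ^ r * w + 1"
    by (simp add: algebra_simps)
  then obtain j where j: "11 ^ r * w + 1 = 24 * j" by blast
  hence "24 * int x - 1 = 121 ^ s * (24 * j - 1)"
    by (simp add: w pow mult.assoc flip: j)
  moreover have "r = 0 \<or> r = 1 \<and> j mod 11 = 6"
  proof -
    have "j mod 11 = 6" if "r = 1"
    proof -
      \<comment> \<open>Multiply 24 j = 11 w + 1 by 6, the inverse of 24 modulo 11.\<close>
      have "j = 6 + 11 * (6 * w - 13 * j)" using j that by simp
      hence "j mod 11 = (6 + 11 * (6 * w - 13 * j)) mod 11" by (rule arg_cong)
      thus ?thesis by (simp only: mod_mult_self2) simp
    qed
    thus ?thesis using r by blast
  qed
  ultimately have "11 ^ k dvd e4 x"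
    unfolding k by (rule e4_dvd)
  thus ?thesis
    by (simp add: cong_0_iff x_def)
qed

end
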